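(* Assume: (A1) for all $t\ge0$, $g_t(x)>0$ for every $x\in\mathbb X$, and $\sup_{t\ge0}|g_t|_\infty<\infty$; (A2) $\sup_{t\ge1}|\vartheta_t|_\infty<\infty$ and $\sup_{t\ge0}|\omega_t|_\infty<\infty$; (A3) $|m|_\infty<\infty$ and $\sup_{t\ge1}|p_t|_\infty<\infty$; (A4) there exist constants $0<\sigma_-\le\sigma_+<\infty$ such that $\sigma_-\le m(x,x')\le\sigma_+$ for all $(x,x')\in\mathbb X\times\mathbb X$, and there exists a constant $c_->0$ such that $\int\chi(dx_0)g_0(x_0)\ge c_-$ and $\inf_{x\in\mathbb X}\int M(x,dx')g_t(x')\ge c_-$ for all $t\ge1$. Then there exist constants $0<B<\infty$ and $0<C<\infty$ such that for all integers $N\ge1$, $s\ge0$ and $T\ge0$ with $s\le T$, all $\epsilon>0$, and all $h\in\mathcal F_b(\mathbb X)$, $$\mathbb P\big[\,|\phi^N_{s|T}(h)-\phi_{s|T}(h)|\ge\epsilon\,\big]\le B\,e^{-CN\epsilon^2/\operatorname{osc}^2(h)},$$ $$\mathbb P\big[\,|\tilde\phi^N_{s|T}(h)-\phi_{s|T}(h)|\ge\epsilon\,\big]\le B\,e^{-CN\epsilon^2/\operatorname{osc}^2(h)}.$$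
   Context: Model. $(\mathbb X,\mathcal B(\mathbb X))$ and $(\mathbb Y,\mathcal B(\mathbb Y))$ are Polish spaces with their Borel $\sigma$-algebras; $\mathcal F_b(\mathbb X^d)$ is the set of bounded measurable real functions on $\mathbb X^d$; $|f|_\infty$ is the supremum norm, $\operatorname{osc}(f)=\sup_{x,x'}|f(x)-f(x')|$, $\operatorname{osc}^2(f)=(\operatorname{osc}(f))^2$, and $x_{m:n}=(x_m,\dots,x_n)$. $\chi$ is a probability measure on $\mathbb X$ (initial law), $M$ is a Markov kernel on $\mathbb X$ with transition density $m$ with respect to a $\sigma$-finite measure $\nu$: $M(x,dx')=m(x,x')\,dx'$, where $dx'$ stands for $\nu(dx')$. $g:\mathbb X\times\mathbb Y\to[0,\infty)$ is the likelihood (density of an observation given the state). The observations $y_0,y_1,\dots$ are a fixed infinite sequence and $g_t(x)=g(x,y_t)$. For each $T\ge0$ the joint smoothing distribution is $$\phi_{0:T|T}(f)=\frac{\int\cdots\int\chi(dx_0)\prod_{u=1}^T g_{u-1}(x_{u-1})M(x_{u-1},dx_u)\,g_T(x_T)\,f(x_{0:T})}{\int\cdots\int\chi(dx_0)\prod_{u=1}^T g_{u-1}(x_{u-1})M(x_{u-1},dx_u)\,g_T(x_T)},$$ the denominator being positive, and $\phi_{s|T}$ is its marginal for the component $x_s$. Particle filter. $\rho_0$ is a probability measure on $\mathbb X$ with $\chi\ll\rho_0$; for $t\ge1$, $\vartheta_t:\mathbb X\to(0,\infty)$ is measurable, and $P_t$ is a Markov kernel with density $p_t$ with respect to $\nu$,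 with $p_t(x,x')>0$ whenever $m(x,x')g_t(x')>0$. Weight functions: $\omega_0(x)=\frac{d\chi}{d\rho_0}(x)g_0(x)$ and $\omega_t(x,x')=\frac{m(x,x')g_t(x')}{\vartheta_t(x)p_t(x,x')}$, $t\ge1$. For each $N\ge1$: $\xi_0^1,\dots,\xi_0^N$ are i.i.d. with law $\rho_0$ and $\omega_0^i=\omega_0(\xi_0^i)$; for $t\ge1$, conditionally on all particles and weights up to time $t-1$, the pairs $(I_t^i,\xi_t^i)$, $i=1,\dots,N$, are i.i.d. on $\{1,\dots,N\}\times\mathbb X$ with law proportional to $(j,dx)\mapsto\omega_{t-1}^j\vartheta_t(\xi_{t-1}^j)P_t(\xi_{t-1}^j,dx)$, and $\omega_t^i=\omega_t(\xi_{t-1}^{I_t^i},\xi_t^i)$. Put $\Omega_t=\sum_{i=1}^N\omega_t^i$ and $\phi_t^N(f)=\Omega_t^{-1}\sum_{i=1}^N\omega_t^if(\xi_t^i)$. FFBS estimator. For a probability measure $\eta$ on $\mathbb X$, $\mathrm B_\eta(x,f)=\frac{\int\eta(dx')m(x',x)f(x')}{\int\eta(dx')m(x',x)}$. The FFBS marginal estimator is $$\phi^N_{s|T}(h)=\int\cdots\int\phi_T^N(dx_T)\,\mathrm B_{\phi^N_{T-1}}(x_T,dx_{T-1})\cdots\mathrm B_{\phi_s^N}(x_{s+1},dx_s)\,h(x_s).$$ FFBSi estimator. Conditionally on all particles and weights up to time $T$, the index paths $(J_0^\ell,\dots,J_T^\ell)$, $\ell=1,\dots,N$, are i.i.d. with: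 $J_T^\ell=i$ with probability $\omega_T^i/\Omega_T$; and, backward in time, given $J_{t+1}^\ell=i$, $J_t^\ell=j$ with probability $\frac{\omega_t^jm(\xi_t^j,\xi_{t+1}^i)}{\sum_{k=1}^N\omega_t^km(\xi_t^k,\xi_{t+1}^i)}$, $0\le t\le T-1$. Then $\tilde\phi^N_{s|T}(h)=N^{-1}\sum_{\ell=1}^Nh(\xi_s^{J_s^\ell})$. *)

theory Defs
  imports "HOL-Probability.Probability"
begin

text \<open>
  The class \<^class>\<open>polish_space\<close> fixes a complete metric, but only the topology and its
  Borel sets are used below.
\<close>

record ('x, 'y) smc =
  chi :: "'x measure"
  nu :: "'x measure"
  mdens :: "'x \<Rightarrow> 'x \<Rightarrow> real"
  lik :: "'x \<Rightarrow> 'y \<Rightarrow> real"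
  obs :: "nat \<Rightarrow> 'y"
  rho0 :: "'x measure"
  dchi :: "'x \<Rightarrow> real" \<comment> \<open>a finite version of the Radon-Nikodym derivative of chi w.r.t. rho0\<close>
  theta :: "nat \<Rightarrow> 'x \<Rightarrow> real" \<comment> \<open>only times \<open>t \<ge> 1\<close> matter\<close>
  pdens :: "nat \<Rightarrow> 'x \<Rightarrow> 'x \<Rightarrow> real" \<comment> \<open>only times \<open>t \<ge> 1\<close> matter\<close>

definition sup_norm :: "('a \<Rightarrow> real) \<Rightarrow> ereal" where
  "sup_norm f = (SUP z. ereal \<bar>f z\<bar>)"

text \<open>For bounded functions only: the supremum is taken in the reals.\<close>

definition osc :: "('a \<Rightarrow> real) \<Rightarrow> real" where
  "osc f = (SUP (x, x'). \<bar>f x - f x'\<bar>)"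

definition Fb :: "('x::topological_space \<Rightarrow> real) set" where
  "Fb = {h \<in> borel_measurable borel. bounded (range h)}"

definition gt :: "('x, 'y) smc \<Rightarrow> nat \<Rightarrow> 'x \<Rightarrow> real" where
  "gt S t x = lik S x (obs S t)"

definition Mker :: "('x, 'y) smc \<Rightarrow> 'x \<Rightarrow> 'x measure" where
  "Mker S x = density (nu S) (\<lambda>x'. ennreal (mdens S x x'))"

definition Pker :: "('x, 'y) smc \<Rightarrow> nat \<Rightarrow> 'x \<Rightarrow> 'x measure" where
  "Pker S t x = density (nu S) (\<lambda>x'. ennreal (pdens S t x x'))"

subsection \<open>Joint smoothing distribution\<close>

text \<open>
  A path \<open>x\<^sub>0, \<dots>, x\<^sub>T\<close> is a function on the naturals of which only the coordinates up to \<open>T\<close> are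
  relevant.  With the path given up to time \<open>t\<close>, \<open>path_int S f k t x\<close> is the iterated integral
  of \<open>g\<^sub>t(x\<^sub>t) M(x\<^sub>t, dx\<^sub>t\<^sub>+\<^sub>1) \<dots> M(x\<^sub>t\<^sub>+\<^sub>k\<^sub>-\<^sub>1, dx\<^sub>t\<^sub>+\<^sub>k) g\<^sub>t\<^sub>+\<^sub>k(x\<^sub>t\<^sub>+\<^sub>k) f(x)\<close>.
\<close>

primrec path_int ::
    "('x, 'y) smc \<Rightarrow> ((nat \<Rightarrow> 'x) \<Rightarrow> real) \<Rightarrow> nat \<Rightarrow> nat \<Rightarrow> (nat \<Rightarrow> 'x) \<Rightarrow> real" where
  "path_int S f 0 t x = gt S t (x t) * f x"
| "path_int S f (Suc k) t x =
     gt S t (x t) * (\<integral>x'. path_int S f k (Suc t) (x(Suc t := x')) \<partial>Mker S (x t))"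

definition smooth_unnorm :: "('x, 'y) smc \<Rightarrow> nat \<Rightarrow> ((nat \<Rightarrow> 'x) \<Rightarrow> real) \<Rightarrow> real" where
  "smooth_unnorm S T f = (\<integral>x. path_int S f T 0 (\<lambda>_. x) \<partial>chi S)"

definition joint_smooth :: "('x, 'y) smc \<Rightarrow> nat \<Rightarrow> ((nat \<Rightarrow> 'x) \<Rightarrow> real) \<Rightarrow> real" where
  "joint_smooth S T f = smooth_unnorm S T f / smooth_unnorm S T (\<lambda>_. 1)"

definition marg_smooth :: "('x, 'y) smc \<Rightarrow> nat \<Rightarrow> nat \<Rightarrow> ('x \<Rightarrow> real) \<Rightarrow> real" where
  "marg_smooth S s T h = joint_smooth S T (\<lambda>x. h (x s))"

subsection \<open>Standing assumptions\<close>

text \<open>The last equation of \<open>rho0\<close> contains the absolute continuity of \<open>chi\<close>.\<close>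

definition smc_model :: "('x::polish_space, 'y::polish_space) smc \<Rightarrow> bool" where
  "smc_model S \<longleftrightarrow>
     prob_space (chi S) \<and> sets (chi S) = sets borel \<and>
     sigma_finite_measure (nu S) \<and> sets (nu S) = sets borel \<and>
     (\<forall>x x'. 0 \<le> mdens S x x') \<and>
     (\<lambda>(x, x'). mdens S x x') \<in> borel_measurable (borel \<Otimes>\<^sub>M borel) \<and>
     (\<forall>x. prob_space (Mker S x)) \<and>
     (\<forall>x y. 0 \<le> lik S x y) \<and>
     (\<lambda>(x, y). lik S x y) \<in> borel_measurable (borel \<Otimes>\<^sub>M borel) \<and>
     (\<forall>T. 0 < smooth_unnorm S T (\<lambda>_. 1)) \<and>
     prob_space (rho0 S) \<and> sets (rho0 S) = sets borel \<and>
     (\<forall>x. 0 \<le> dchi S x) \<and> dchi S \<in> borel_measurable borel \<and>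
     chi S = density (rho0 S) (\<lambda>x. ennreal (dchi S x)) \<and>
     (\<forall>t\<ge>1. theta S t \<in> borel_measurable borel \<and> (\<forall>x. 0 < theta S t x)) \<and>
     (\<forall>t\<ge>1. (\<lambda>(x, x'). pdens S t x x') \<in> borel_measurable (borel \<Otimes>\<^sub>M borel) \<and>
        (\<forall>x x'. 0 \<le> pdens S t x x') \<and> (\<forall>x. prob_space (Pker S t x)) \<and>
        (\<forall>x x'. mdens S x x' * gt S t x' > 0 \<longrightarrow> pdens S t x x' > 0))"

subsection \<open>Particle filter\<close>

definition weight0 :: "('x, 'y) smc \<Rightarrow> 'x \<Rightarrow> real" where
  "weight0 S x = dchi S x * gt S 0 x"

definition weight :: "('x, 'y) smc \<Rightarrow> nat \<Rightarrow> 'x \<Rightarrow> 'x \<Rightarrow> real" where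
  "weight S t x x' = mdens S x x' * gt S t x' / (theta S t x * pdens S t x x')"

definition pweight ::
    "('x, 'y) smc \<Rightarrow> (nat \<Rightarrow> nat \<Rightarrow> 'w \<Rightarrow> 'x) \<Rightarrow> (nat \<Rightarrow> nat \<Rightarrow> 'w \<Rightarrow> nat) \<Rightarrow>
     nat \<Rightarrow> nat \<Rightarrow> 'w \<Rightarrow> real" where
  "pweight S \<xi> I t i \<omega> =
     (if t = 0 then weight0 S (\<xi> 0 i \<omega>)
      else weight S t (\<xi> (t - 1) (I t i \<omega>) \<omega>) (\<xi> t i \<omega>))"

text \<open>
  Nothing excludes that all initial weights vanish simultaneously (\<open>dchi\<close> may be zero on a set of
  positive \<open>rho0\<close>-measure), and then the normalised weights are undefined.  On this event
  the uniform distribution is used, so that every ``law proportional to \<open>w\<close>'' is a probability;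
  the value \<open>0/0 = 0\<close> would not give a probability measure.
\<close>

definition nweight :: "nat \<Rightarrow> (nat \<Rightarrow> real) \<Rightarrow> nat \<Rightarrow> real" where
  "nweight N w i = (if (\<Sum>j=1..N. w j) = 0 then 1 / real N else w i / (\<Sum>j=1..N. w j))"

text \<open>
  The sigma-algebra generated by all particles and weights up to time \<open>t\<close> (not by the
  ancestor indices).
\<close>

definition history ::
    "('x::polish_space, 'y) smc \<Rightarrow> nat \<Rightarrow> 'w measure \<Rightarrow> (nat \<Rightarrow> nat \<Rightarrow> 'w \<Rightarrow> 'x) \<Rightarrow>
     (nat \<Rightarrow> nat \<Rightarrow> 'w \<Rightarrow> nat) \<Rightarrow> nat \<Rightarrow> 'w measure" where
  "history S N P \<xi> I t =
     vimage_algebra (space P)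
       (\<lambda>\<omega>. \<lambda>(u, i) \<in> {..t} \<times> {1..N}. (\<xi> u i \<omega>, pweight S \<xi> I u i \<omega>))
       (PiM ({..t} \<times> {1..N}) (\<lambda>_. borel \<Otimes>\<^sub>M borel))"

text \<open>
  Conditionally on the sub-sigma-algebra \<open>F\<close> of \<open>P\<close>, the \<open>E\<close>-valued random variables
  \<open>Z i\<close>, \<open>i \<in> A\<close> (\<open>A\<close> finite), are i.i.d. with the random law \<open>K\<close>.
\<close>

definition cond_iid ::
    "'w measure \<Rightarrow> 'w measure \<Rightarrow> 'i set \<Rightarrow> 'e measure \<Rightarrow> ('i \<Rightarrow> 'w \<Rightarrow> 'e) \<Rightarrow>
     ('w \<Rightarrow> 'e measure) \<Rightarrow> bool" where
  "cond_iid P F A E Z K \<longleftrightarrow>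
     (\<forall>i\<in>A. Z i \<in> measurable P E) \<and>
     (\<forall>D. (\<forall>i\<in>A. D i \<in> sets E) \<longrightarrow>
        (AE \<omega> in P. real_cond_exp P F (indicator {\<omega> \<in> space P. \<forall>i\<in>A. Z i \<omega> \<in> D i}) \<omega>
           = (\<Prod>i\<in>A. measure (K \<omega>) (D i))))"

text \<open>
  The law on \<open>{1..N} \<times> 'x\<close> of one pair (ancestor index, particle) at time \<open>t \<ge> 1\<close>, through its
  density with respect to counting measure times \<open>nu\<close>.
\<close>

definition mutation_law ::
    "('x::polish_space, 'y) smc \<Rightarrow> nat \<Rightarrow> (nat \<Rightarrow> nat \<Rightarrow> 'w \<Rightarrow> 'x) \<Rightarrow>
     (nat \<Rightarrow> nat \<Rightarrow> 'w \<Rightarrow> nat) \<Rightarrow> nat \<Rightarrow> 'w \<Rightarrow> (nat \<times> 'x) measure" where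
  "mutation_law S N \<xi> I t \<omega> =
     density (count_space {1..N} \<Otimes>\<^sub>M nu S)
       (\<lambda>(j, x). ennreal
          (nweight N (\<lambda>k. pweight S \<xi> I (t - 1) k \<omega> * theta S t (\<xi> (t - 1) k \<omega>)) j
           * pdens S t (\<xi> (t - 1) j \<omega>) x))"

definition particle_filter ::
    "('x::polish_space, 'y) smc \<Rightarrow> nat \<Rightarrow> 'w measure \<Rightarrow> (nat \<Rightarrow> nat \<Rightarrow> 'w \<Rightarrow> 'x) \<Rightarrow>
     (nat \<Rightarrow> nat \<Rightarrow> 'w \<Rightarrow> nat) \<Rightarrow> bool" where
  "particle_filter S N P \<xi> I \<longleftrightarrow>
     prob_space P \<and>
     prob_space.indep_vars P (\<lambda>_. borel) (\<xi> 0) {1..N} \<and>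
     (\<forall>i\<in>{1..N}. distr P borel (\<xi> 0 i) = rho0 S) \<and>
     (\<forall>t\<ge>1. cond_iid P (history S N P \<xi> I (t - 1)) {1..N} (count_space {1..N} \<Otimes>\<^sub>M borel)
        (\<lambda>i \<omega>. (I t i \<omega>, \<xi> t i \<omega>)) (mutation_law S N \<xi> I t))"

definition filter_measure ::
    "('x::polish_space, 'y) smc \<Rightarrow> nat \<Rightarrow> (nat \<Rightarrow> nat \<Rightarrow> 'w \<Rightarrow> 'x) \<Rightarrow>
     (nat \<Rightarrow> nat \<Rightarrow> 'w \<Rightarrow> nat) \<Rightarrow> nat \<Rightarrow> 'w \<Rightarrow> 'x measure" where
  "filter_measure S N \<xi> I t \<omega> =
     distr (point_measure {1..N} (\<lambda>i. ennreal (nweight N (\<lambda>k. pweight S \<xi> I t k \<omega>) i)))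
       borel (\<lambda>i. \<xi> t i \<omega>)"

subsection \<open>FFBS estimator\<close>

definition Bker :: "('x, 'y) smc \<Rightarrow> 'x measure \<Rightarrow> 'x \<Rightarrow> ('x \<Rightarrow> real) \<Rightarrow> real" where
  "Bker S \<eta> x f = (\<integral>x'. mdens S x' x * f x' \<partial>\<eta>) / (\<integral>x'. mdens S x' x \<partial>\<eta>)"

text \<open>\<open>backward S \<eta> s k h\<close> maps the state at time \<open>s + k\<close> to the expectation of \<open>h\<close> at time \<open>s\<close>.\<close>

primrec backward ::
    "('x, 'y) smc \<Rightarrow> (nat \<Rightarrow> 'x measure) \<Rightarrow> nat \<Rightarrow> nat \<Rightarrow> ('x \<Rightarrow> real) \<Rightarrow> 'x \<Rightarrow> real" where
  "backward S \<eta> s 0 h x = h x"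
| "backward S \<eta> s (Suc k) h x = Bker S (\<eta> (s + k)) x (backward S \<eta> s k h)"

definition ffbs ::
    "('x::polish_space, 'y) smc \<Rightarrow> nat \<Rightarrow> (nat \<Rightarrow> nat \<Rightarrow> 'w \<Rightarrow> 'x) \<Rightarrow>
     (nat \<Rightarrow> nat \<Rightarrow> 'w \<Rightarrow> nat) \<Rightarrow> nat \<Rightarrow> nat \<Rightarrow> ('x \<Rightarrow> real) \<Rightarrow> 'w \<Rightarrow> real" where
  "ffbs S N \<xi> I s T h \<omega> =
     (\<integral>x. backward S (\<lambda>t. filter_measure S N \<xi> I t \<omega>) s (T - s) h x
        \<partial>filter_measure S N \<xi> I T \<omega>)"

subsection \<open>FFBSi estimator\<close>

text \<open>Law of one index path, a Markov chain run backwards from time \<open>T\<close>.\<close>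

definition index_path_law ::
    "('x, 'y) smc \<Rightarrow> nat \<Rightarrow> (nat \<Rightarrow> nat \<Rightarrow> 'w \<Rightarrow> 'x) \<Rightarrow> (nat \<Rightarrow> nat \<Rightarrow> 'w \<Rightarrow> nat) \<Rightarrow>
     nat \<Rightarrow> 'w \<Rightarrow> (nat \<Rightarrow> nat) measure" where
  "index_path_law S N \<xi> I T \<omega> =
     point_measure (PiE {..T} (\<lambda>_. {1..N}))
       (\<lambda>j. ennreal
          (nweight N (\<lambda>k. pweight S \<xi> I T k \<omega>) (j T) *
           (\<Prod>t<T. nweight N
              (\<lambda>k. pweight S \<xi> I t k \<omega> * mdens S (\<xi> t k \<omega>) (\<xi> (t + 1) (j (t + 1)) \<omega>)) (j t))))"

definition backward_sampler ::
    "('x::polish_space, 'y) smc \<Rightarrow> nat \<Rightarrow> 'w measure \<Rightarrow> (nat \<Rightarrow> nat \<Rightarrow> 'w \<Rightarrow> 'x) \<Rightarrow>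
     (nat \<Rightarrow> nat \<Rightarrow> 'w \<Rightarrow> nat) \<Rightarrow> nat \<Rightarrow> (nat \<Rightarrow> nat \<Rightarrow> 'w \<Rightarrow> nat) \<Rightarrow> bool" where
  "backward_sampler S N P \<xi> I T J \<longleftrightarrow>
     cond_iid P (history S N P \<xi> I T) {1..N} (count_space (PiE {..T} (\<lambda>_. {1..N})))
       (\<lambda>l \<omega>. \<lambda>t\<in>{..T}. J t l \<omega>) (index_path_law S N \<xi> I T)"

definition ffbsi ::
    "nat \<Rightarrow> (nat \<Rightarrow> nat \<Rightarrow> 'w \<Rightarrow> 'x) \<Rightarrow> (nat \<Rightarrow> nat \<Rightarrow> 'w \<Rightarrow> nat) \<Rightarrow>
     nat \<Rightarrow> ('x \<Rightarrow> real) \<Rightarrow> 'w \<Rightarrow> real" where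
  "ffbsi N \<xi> J s h \<omega> = (\<Sum>l=1..N. h (\<xi> s (J s l \<omega>) \<omega>)) / real N"

subsection \<open>Deviation bound\<close>

text \<open>For constant \<open>h\<close> the exponent is minus infinity, whereas division by zero would give \<open>B\<close>.\<close>

definition dev_bound :: "real \<Rightarrow> real \<Rightarrow> nat \<Rightarrow> real \<Rightarrow> ('a \<Rightarrow> real) \<Rightarrow> real" where
  "dev_bound B C N \<epsilon> h =
     (if osc h = 0 then 0 else B * exp (- C * real N * \<epsilon>\<^sup>2 / (osc h)\<^sup>2))"

end

theory Submission
  imports Defs
begin

text \<open>
  Fix \<open>s \<le> T\<close>.  For \<open>t \<le> T\<close> let \<open>R\<^sub>t\<close> be the estimator that uses the particles up to time \<open>t\<close> and the
  exact dynamics afterwards: the particles at time \<open>t\<close> are weighted by their importance weight times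
  the likelihood of the future observations, and the averaged function is the conditional
  expectation of \<open>h\<close> at time \<open>s\<close> given the state at time \<open>t\<close> and the future observations if \<open>t \<le> s\<close>,
  and the image of \<open>h\<close> under the particle backward kernels if \<open>t > s\<close>.  Then \<open>R\<^sub>T\<close> is the FFBS
  estimator, and \<open>R\<^sub>t\<close> is a ratio of two empirical means whose conditional means given the past have
  the ratio \<open>R\<^sub>t\<^sub>-\<^sub>1\<close> (the exact smoothing value if \<open>t = 0\<close>).  By mixing, the averaged function has an
  oscillation that is geometrically small in \<open>\<bar>t - s\<bar>\<close>, so conditional Hoeffding bounds for numerator and
  denominator give a Gaussian tail for \<open>R\<^sub>t - R\<^sub>t\<^sub>-\<^sub>1\<close> on that scale.  Allotting to time \<open>t\<close> a part of \<open>\<epsilon>\<close>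
  that decays more slowly makes the union bound over \<open>t\<close> summable uniformly in \<open>T\<close>.

  The identity for the conditional means fails only if all initial weights vanish, because they are
  then replaced by uniform ones; by Hoeffding this has exponentially small probability.  For FFBSi,
  one more Hoeffding bound is applied conditionally on all particles.
\<close>

subsection \<open>Conditionally i.i.d. variables with a conditional density\<close>

text \<open>The conditional means fit together exactly because of two cancellations. The importance
  weight times the proposal density is the transition density times the likelihood over
  \<open>theta\<close>, and the selection probability over \<open>theta\<close> is proportional to
  the filter weight; so a weighted function of a new particle has, up to a common factor, the mean
  obtained by moving the weighted particles through the exact dynamics. After time \<open>s\<close>
  the averaged function is random, but it depends only on particles older than the new one and is
  frozen given the history; and the particle backward kernel is Bayes' rule for precisely the
  mixture of transition densities that occurs in this mean.

  Two obstacles shape the proof. The conditional law is known only on product sets and almost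
  surely, while the integrands depend jointly on history and new particle; a uniqueness argument for
  measures bridges this. Also, the likelihood of \<open>k\<close> future observations is controlled
  directly only by \<open>k\<close>-th powers of constants; its ratios, by mixing, are controlled by
  \<kappa> alone, and this gives constants that do not depend on \<open>T\<close>.\<close>

text \<open>Common frame for the initial sample, a mutation step and the backward index paths. The
  random law is a random density against a fixed measure, so that Fubini makes conditional integrals
  \<open>F\<close>-measurable; \<open>law\<close> is the conditional expectation tested on an event
  of \<open>F\<close>, free of exceptional sets.\<close>

locale cond_iid_density = prob_space P for P :: "'w measure" +
  fixes F :: "'w measure" and M0 :: "'e measure" and k :: "'w \<Rightarrow> 'e \<Rightarrow> real"
    and A :: "'i set" and Z :: "'i \<Rightarrow> 'w \<Rightarrow> 'e"
  assumes sub: "subalgebra P F"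
    and sfin: "sigma_finite_measure M0"
    and k_measurable [measurable]: "(\<lambda>(\<omega>, e). k \<omega> e) \<in> borel_measurable (F \<Otimes>\<^sub>M M0)"
    and k_nonneg: "\<And>\<omega> e. \<omega> \<in> space P \<Longrightarrow> e \<in> space M0 \<Longrightarrow> 0 \<le> k \<omega> e"
    and k_prob: "\<And>\<omega>. \<omega> \<in> space P \<Longrightarrow> prob_space (density M0 (\<lambda>e. ennreal (k \<omega> e)))"
    and fin: "finite A"
    and Z_measurable [measurable]: "\<And>i. i \<in> A \<Longrightarrow> Z i \<in> measurable P M0"
    and law: "\<And>G D. G \<in> sets F \<Longrightarrow> (\<And>i. i \<in> A \<Longrightarrow> D i \<in> sets M0) \<Longrightarrow>
      emeasure P {\<omega> \<in> G. \<forall>i\<in>A. Z i \<omega> \<in> D i} =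
      (\<integral>\<^sup>+\<omega>. indicator G \<omega> * (\<Prod>i\<in>A. emeasure (density M0 (\<lambda>e. ennreal (k \<omega> e))) (D i)) \<partial>P)"
begin

abbreviation "K \<omega> \<equiv> density M0 (\<lambda>e. ennreal (k \<omega> e))"

abbreviation jointly_measurable :: "('w \<Rightarrow> 'e \<Rightarrow> 'b::topological_space) \<Rightarrow> bool" where
  "jointly_measurable f \<equiv> (\<lambda>(\<omega>, e). f \<omega> e) \<in> borel_measurable (F \<Otimes>\<^sub>M M0)"

lemma space_F: "space F = space P"
  using sub by (simp add: subalgebra_def)

lemma measurable_F_P: "f \<in> measurable F N \<Longrightarrow> f \<in> measurable P N"
  using sub by (rule measurable_from_subalg)

lemma k_measurable_section [measurable]: "\<omega> \<in> space P \<Longrightarrow> k \<omega> \<in> borel_measurable M0"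
  using measurable_Pair2[OF k_measurable, of \<omega>] by (simp add: space_F)

lemma nn_K_measurable:
  assumes [measurable]: "jointly_measurable f"
  shows "(\<lambda>\<omega>. \<integral>\<^sup>+e. f \<omega> e \<partial>K \<omega>) \<in> borel_measurable F"
proof -
  interpret sigma_finite_measure M0 by (rule sfin)
  have "(\<lambda>\<omega>. \<integral>\<^sup>+e. ennreal (k \<omega> e) * f \<omega> e \<partial>M0) \<in> borel_measurable F"
    by measurable
  moreover have "(\<integral>\<^sup>+e. f \<omega> e \<partial>K \<omega>) = (\<integral>\<^sup>+e. ennreal (k \<omega> e) * f \<omega> e \<partial>M0)" if "\<omega> \<in> space F" for \<omega>
    using that measurable_Pair2[OF assms that]
    by (intro nn_integral_density) (auto simp: space_F)
  ultimately show ?thesis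
    by (subst measurable_cong) auto
qed

lemma integral_K_measurable:
  fixes f :: "'w \<Rightarrow> 'e \<Rightarrow> real"
  assumes [measurable]: "jointly_measurable f"
  shows "(\<lambda>\<omega>. \<integral>e. f \<omega> e \<partial>K \<omega>) \<in> borel_measurable F"
proof -
  interpret sigma_finite_measure M0 by (rule sfin)
  have "(\<lambda>\<omega>. \<integral>e. k \<omega> e * f \<omega> e \<partial>M0) \<in> borel_measurable F"
    by measurable
  moreover have "(\<integral>e. f \<omega> e \<partial>K \<omega>) = (\<integral>e. k \<omega> e * f \<omega> e \<partial>M0)" if "\<omega> \<in> space F" for \<omega>
    using that measurable_Pair2[OF assms that] k_nonneg
    by (subst integral_density) (auto simp: space_F)
  ultimately show ?thesis
    by (subst measurable_cong) auto
qed

lemma Z_pair_measurable: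
  assumes i: "i \<in> A" and f: "(\<lambda>(\<omega>, e). f \<omega> e) \<in> measurable (F \<Otimes>\<^sub>M M0) N"
  shows "(\<lambda>\<omega>. f \<omega> (Z i \<omega>)) \<in> measurable P N"
proof -
  have "(\<lambda>\<omega>. \<omega>) \<in> measurable P F"
    using sub by (auto simp: subalgebra_def measurable_def)
  then have "(\<lambda>\<omega>. (\<omega>, Z i \<omega>)) \<in> measurable P (F \<Otimes>\<^sub>M M0)"
    using Z_measurable[OF i] by simp
  from measurable_compose[OF this f] show ?thesis by simp
qed

section \<open>Conditional product formula for integrands depending on the history\<close>

text \<open>Coordinates are upgraded one at a time: those in \<open>B\<close> carry general bounded
  integrands, the others are still indicators of fixed sets, for which \<open>law\<close> applies.
  The event \<open>G\<close> has to stay arbitrary in the induction, because it is one side of the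
  rectangles on which the next coordinate is tested.\<close>

lemma nn_integral_prod_aux:
  fixes f :: "'i \<Rightarrow> 'w \<Rightarrow> 'e \<Rightarrow> ennreal"
  assumes "finite B" "B \<subseteq> A"
    and "\<And>i. i \<in> A \<Longrightarrow> jointly_measurable (f i)"
    and "\<And>i \<omega> e. i \<in> A \<Longrightarrow> \<omega> \<in> space P \<Longrightarrow> e \<in> space M0 \<Longrightarrow> f i \<omega> e \<le> ennreal c"
    and "\<And>i. i \<in> A - B \<Longrightarrow> \<exists>D\<in>sets M0. f i = (\<lambda>\<omega> e. indicator D e)"
    and "G \<in> sets F" and c: "1 \<le> c"
  shows "(\<integral>\<^sup>+\<omega>. indicator G \<omega> * (\<Prod>i\<in>A. f i \<omega> (Z i \<omega>)) \<partial>P) =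
    (\<integral>\<^sup>+\<omega>. indicator G \<omega> * (\<Prod>i\<in>A. \<integral>\<^sup>+e. f i \<omega> e \<partial>K \<omega>) \<partial>P)"
  using assms(1-6)
proof (induction B arbitrary: f G rule: finite_induct)
  case empty
  have "\<forall>i\<in>A. \<exists>D. D \<in> sets M0 \<and> f i = (\<lambda>\<omega> e. indicator D e)"
    using empty(4) by auto
  then obtain D where D: "\<And>i. i \<in> A \<Longrightarrow> D i \<in> sets M0"
      "\<And>i. i \<in> A \<Longrightarrow> f i = (\<lambda>\<omega> e. indicator (D i) e)"
    by metis
  note [measurable] = D(1)
  have G [measurable]: "G \<in> sets P" and Gs: "G \<subseteq> space P"
    using empty(5) sub sets.sets_into_space[OF empty(5)] by (auto simp: subalgebra_def)
  have meas: "{\<omega> \<in> G. \<forall>i\<in>A. Z i \<omega> \<in> D i} \<in> sets P"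
  proof -
    have "{\<omega> \<in> G. \<forall>i\<in>A. Z i \<omega> \<in> D i} = G \<inter> {\<omega> \<in> space P. \<forall>i\<in>A. Z i \<omega> \<in> D i}"
      using Gs by auto
    moreover have "{\<omega> \<in> space P. \<forall>i\<in>A. Z i \<omega> \<in> D i} \<in> sets P"
      using fin D(1) by measurable
    ultimately show ?thesis by auto
  qed
  have "(\<integral>\<^sup>+\<omega>. indicator G \<omega> * (\<Prod>i\<in>A. f i \<omega> (Z i \<omega>)) \<partial>P) =
      (\<integral>\<^sup>+\<omega>. indicator {\<omega> \<in> G. \<forall>i\<in>A. Z i \<omega> \<in> D i} \<omega> \<partial>P)"
  proof (intro nn_integral_cong)
    fix \<omega>
    have "(\<Prod>i\<in>A. f i \<omega> (Z i \<omega>)) = (\<Prod>i\<in>A. indicator (D i) (Z i \<omega>))"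
      using D(2) by (intro prod.cong) auto
    also have "\<dots> = (if \<forall>i\<in>A. Z i \<omega> \<in> D i then 1 else 0)"
      using fin by (auto simp: indicator_def intro!: prod.neutral)
    finally show "indicator G \<omega> * (\<Prod>i\<in>A. f i \<omega> (Z i \<omega>)) =
        indicator {\<omega> \<in> G. \<forall>i\<in>A. Z i \<omega> \<in> D i} \<omega>"
      by (auto simp: indicator_def)
  qed
  also have "\<dots> = emeasure P {\<omega> \<in> G. \<forall>i\<in>A. Z i \<omega> \<in> D i}"
    using meas by simp
  also have "\<dots> = (\<integral>\<^sup>+\<omega>. indicator G \<omega> * (\<Prod>i\<in>A. emeasure (K \<omega>) (D i)) \<partial>P)"
    by (intro law empty(5) D(1))
  also have "\<dots> = (\<integral>\<^sup>+\<omega>. indicator G \<omega> * (\<Prod>i\<in>A. \<integral>\<^sup>+e. f i \<omega> e \<partial>K \<omega>) \<partial>P)"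
    using D by (intro nn_integral_cong arg_cong2[where f="(*)"] prod.cong) auto
  finally show ?case .
next
  case (insert b B)
  note fm = insert.prems(2)
  have b: "b \<in> A" using insert by auto
  interpret M0: sigma_finite_measure M0 by (rule sfin)
  define P' where "P' = restr_to_subalg P F"
  interpret P': prob_space P'
    unfolding P'_def by (rule prob_space_restr_to_subalg[OF sub prob_space_axioms])
  interpret PM: pair_sigma_finite P' M0 ..
  have sP' [measurable_cong]: "sets P' = sets F"
    unfolding P'_def by (rule sets_restr_to_subalg[OF sub])
  have spP': "space P' = space P" "space P' = space F"
    using space_restr_to_subalg[of P F] sP' sets_eq_imp_space_eq[of P' F] by (auto simp: P'_def)
  define g1 where "g1 = (\<lambda>\<omega>. \<Prod>i\<in>A-{b}. f i \<omega> (Z i \<omega>))"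
  define g2 where "g2 = (\<lambda>\<omega>. \<Prod>i\<in>A-{b}. \<integral>\<^sup>+e. f i \<omega> e \<partial>K \<omega>)"
  have g1 [measurable]: "g1 \<in> borel_measurable P"
    unfolding g1_def by (intro borel_measurable_prod_ennreal Z_pair_measurable[OF _ fm]) auto
  have g2F [measurable]: "g2 \<in> borel_measurable F"
    unfolding g2_def by (intro borel_measurable_prod_ennreal nn_K_measurable fm) auto
  have split1: "(\<Prod>i\<in>A. f' i \<omega> (Z i \<omega>)) = f' b \<omega> (Z b \<omega>) * g1 \<omega>"
    if "\<And>i. i \<noteq> b \<Longrightarrow> f' i = f i" for f' \<omega>
    unfolding g1_def using that by (subst prod.remove[OF fin b]) (auto intro!: arg_cong2[where f="(*)"] prod.cong)
  have split2: "(\<Prod>i\<in>A. \<integral>\<^sup>+e. f' i \<omega> e \<partial>K \<omega>) = (\<integral>\<^sup>+e. f' b \<omega> e \<partial>K \<omega>) * g2 \<omega>"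
    if "\<And>i. i \<noteq> b \<Longrightarrow> f' i = f i" for f' \<omega>
    unfolding g2_def using that by (subst prod.remove[OF fin b]) (auto intro!: arg_cong2[where f="(*)"] prod.cong)
  have idZ [measurable]: "(\<lambda>\<omega>. (\<omega>, Z b \<omega>)) \<in> measurable P (F \<Otimes>\<^sub>M M0)"
  proof -
    have "(\<lambda>\<omega>. \<omega>) \<in> measurable P F"
      using sub by (auto simp: subalgebra_def measurable_def)
    then show ?thesis using Z_measurable[OF b] by simp
  qed
  \<comment> \<open>The two sides of the claim are the integrals of \<open>f b\<close> times the
    indicator of \<open>G\<close> against these two measures on history times state; the factors of
    the other coordinates are absorbed as the densities \<open>g1\<close> and
    \<open>g2\<close>.\<close>
  define \<mu>1 where "\<mu>1 = distr (density P g1) (F \<Otimes>\<^sub>M M0) (\<lambda>\<omega>. (\<omega>, Z b \<omega>))"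
  define \<mu>2 where "\<mu>2 = density (P' \<Otimes>\<^sub>M M0) (\<lambda>(\<omega>, e). g2 \<omega> * ennreal (k \<omega> e))"
  have PM_cong: "sets (P' \<Otimes>\<^sub>M M0) = sets (F \<Otimes>\<^sub>M M0)"
    by (intro sets_pair_measure_cong sP' refl)
  have I1: "(\<integral>\<^sup>+p. \<phi> p \<partial>\<mu>1) = (\<integral>\<^sup>+\<omega>. \<phi> (\<omega>, Z b \<omega>) * g1 \<omega> \<partial>P)"
    if [measurable]: "\<phi> \<in> borel_measurable (F \<Otimes>\<^sub>M M0)" for \<phi>
    unfolding \<mu>1_def by (simp add: nn_integral_distr nn_integral_density mult.commute)
  have I2: "(\<integral>\<^sup>+p. \<phi> p \<partial>\<mu>2) = (\<integral>\<^sup>+\<omega>. (\<integral>\<^sup>+e. \<phi> (\<omega>, e) \<partial>K \<omega>) * g2 \<omega> \<partial>P)"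
    if \<phi>: "\<phi> \<in> borel_measurable (F \<Otimes>\<^sub>M M0)" for \<phi>
  proof -
    have [measurable]: "\<phi> \<in> borel_measurable (P' \<Otimes>\<^sub>M M0)"
      using \<phi> by (simp cong: measurable_cong_sets add: PM_cong)
    have [measurable]: "(\<lambda>(\<omega>, e). k \<omega> e) \<in> borel_measurable (P' \<Otimes>\<^sub>M M0)"
      using k_measurable by (simp cong: measurable_cong_sets add: PM_cong)
    have [measurable]: "g2 \<in> borel_measurable P'"
      using g2F by (simp cong: measurable_cong_sets add: sP')
    have "(\<integral>\<^sup>+p. \<phi> p \<partial>\<mu>2) = (\<integral>\<^sup>+\<omega>. \<integral>\<^sup>+e. g2 \<omega> * ennreal (k \<omega> e) * \<phi> (\<omega>, e) \<partial>M0 \<partial>P')"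
      unfolding \<mu>2_def
      by (subst nn_integral_density) (auto simp: M0.nn_integral_fst[symmetric] split_beta')
    also have "\<dots> = (\<integral>\<^sup>+\<omega>. (\<integral>\<^sup>+e. \<phi> (\<omega>, e) \<partial>K \<omega>) * g2 \<omega> \<partial>P')"
    proof (intro nn_integral_cong)
      fix \<omega> assume w: "\<omega> \<in> space P'"
      then have wP: "\<omega> \<in> space P" and wF: "\<omega> \<in> space F" by (simp_all add: spP' space_F)
      have [measurable]: "(\<lambda>e. \<phi> (\<omega>, e)) \<in> borel_measurable M0"
        using measurable_Pair2[OF \<phi> wF] .
      show "(\<integral>\<^sup>+e. g2 \<omega> * ennreal (k \<omega> e) * \<phi> (\<omega>, e) \<partial>M0) = (\<integral>\<^sup>+e. \<phi> (\<omega>, e) \<partial>K \<omega>) * g2 \<omega>"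
        using wP by (simp add: nn_integral_density mult.assoc mult.commute[of _ "g2 \<omega>"] nn_integral_cmult)
    qed
    also have "\<dots> = (\<integral>\<^sup>+\<omega>. (\<integral>\<^sup>+e. \<phi> (\<omega>, e) \<partial>K \<omega>) * g2 \<omega> \<partial>P)"
      unfolding P'_def using nn_K_measurable[of "\<lambda>\<omega> e. \<phi> (\<omega>, e)"] \<phi>
      by (intro nn_integral_subalgebra2[OF sub]) auto
    finally show ?thesis .
  qed
  \<comment> \<open>On a rectangle this is the induction hypothesis: \<open>G'\<close> takes the
    place of \<open>G\<close>, and \<open>f b\<close> is replaced by the indicator of
    \<open>D\<close>.\<close>
  have rect: "emeasure \<mu>1 (G' \<times> D) = emeasure \<mu>2 (G' \<times> D)" if G': "G' \<in> sets F" and D: "D \<in> sets M0" for G' D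
  proof -
    define f' where "f' = f(b := (\<lambda>\<omega> e. indicator D e))"
    have f'b: "f' b = (\<lambda>\<omega> e. indicator D e)" by (simp add: f'_def)
    have f'n: "i \<noteq> b \<Longrightarrow> f' i = f i" for i by (simp add: f'_def)
    have m: "indicator (G' \<times> D) \<in> borel_measurable (F \<Otimes>\<^sub>M M0)" using G' D by auto
    have "(\<integral>\<^sup>+\<omega>. indicator G' \<omega> * (\<Prod>i\<in>A. f' i \<omega> (Z i \<omega>)) \<partial>P) =
      (\<integral>\<^sup>+\<omega>. indicator G' \<omega> * (\<Prod>i\<in>A. \<integral>\<^sup>+e. f' i \<omega> e \<partial>K \<omega>) \<partial>P)"
    proof (rule insert.IH)
      show "B \<subseteq> A" using insert by auto
      show "(\<lambda>(\<omega>, e). f' i \<omega> e) \<in> borel_measurable (F \<Otimes>\<^sub>M M0)" if "i \<in> A" for i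
        using fm[OF that] D by (cases "i = b") (auto simp: f'b f'n)
      show "f' i \<omega> e \<le> ennreal c" if "i \<in> A" "\<omega> \<in> space P" "e \<in> space M0" for i \<omega> e
        using insert.prems(3)[OF that] c
        by (cases "i = b") (auto simp: f'b f'n indicator_def)
      show "\<exists>D\<in>sets M0. f' i = (\<lambda>\<omega> e. indicator D e)" if "i \<in> A - B" for i
        using insert.prems(4)[of i] that D by (cases "i = b") (auto simp: f'b f'n)
    qed (use G' in auto)
    moreover have "(\<integral>\<^sup>+\<omega>. indicator G' \<omega> * (\<Prod>i\<in>A. f' i \<omega> (Z i \<omega>)) \<partial>P) = emeasure \<mu>1 (G' \<times> D)"
    proof -
      have "emeasure \<mu>1 (G' \<times> D) = (\<integral>\<^sup>+p. indicator (G' \<times> D) p \<partial>\<mu>1)"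
        using G' D by (simp add: \<mu>1_def)
      also have "\<dots> = (\<integral>\<^sup>+\<omega>. indicator (G' \<times> D) (\<omega>, Z b \<omega>) * g1 \<omega> \<partial>P)"
        by (rule I1[OF m])
      also have "\<dots> = (\<integral>\<^sup>+\<omega>. indicator G' \<omega> * (\<Prod>i\<in>A. f' i \<omega> (Z i \<omega>)) \<partial>P)"
        by (intro nn_integral_cong) (auto simp: split1[of f', OF f'n] f'b indicator_def)
      finally show ?thesis by simp
    qed
    moreover have "(\<integral>\<^sup>+\<omega>. indicator G' \<omega> * (\<Prod>i\<in>A. \<integral>\<^sup>+e. f' i \<omega> e \<partial>K \<omega>) \<partial>P) = emeasure \<mu>2 (G' \<times> D)"
    proof -
      have "emeasure \<mu>2 (G' \<times> D) = (\<integral>\<^sup>+p. indicator (G' \<times> D) p \<partial>\<mu>2)"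
        using G' D by (simp add: \<mu>2_def PM_cong)
      also have "\<dots> = (\<integral>\<^sup>+\<omega>. (\<integral>\<^sup>+e. indicator (G' \<times> D) (\<omega>, e) \<partial>K \<omega>) * g2 \<omega> \<partial>P)"
        by (rule I2[OF m])
      also have "\<dots> = (\<integral>\<^sup>+\<omega>. indicator G' \<omega> * (\<Prod>i\<in>A. \<integral>\<^sup>+e. f' i \<omega> e \<partial>K \<omega>) \<partial>P)"
        using D by (intro nn_integral_cong)
          (auto simp: split2[of f', OF f'n] f'b indicator_times nn_integral_cmult mult.assoc)
      finally show ?thesis by simp
    qed
    ultimately show ?thesis by simp
  qed
  have "\<mu>1 = \<mu>2"
  proof (rule measure_eqI_generator_eq[OF Int_stable_pair_measure_generator[of F M0],
        where \<Omega> = "space F \<times> space M0" and A = "\<lambda>_. space F \<times> space M0"])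
    show "{a \<times> b |a b. a \<in> sets F \<and> b \<in> sets M0} \<subseteq> Pow (space F \<times> space M0)"
      using sets.space_closed[of F] sets.space_closed[of M0] by auto
    show "sets \<mu>1 = sigma_sets (space F \<times> space M0) {a \<times> b |a b. a \<in> sets F \<and> b \<in> sets M0}"
      by (simp add: \<mu>1_def sets_pair_measure)
    show "sets \<mu>2 = sigma_sets (space F \<times> space M0) {a \<times> b |a b. a \<in> sets F \<and> b \<in> sets M0}"
      by (simp add: \<mu>2_def PM_cong) (simp add: sets_pair_measure)
    have "emeasure \<mu>1 (space F \<times> space M0) = (\<integral>\<^sup>+p. indicator (space F \<times> space M0) p \<partial>\<mu>1)"
      by (simp add: \<mu>1_def)
    also have "\<dots> = (\<integral>\<^sup>+\<omega>. indicator (space F \<times> space M0) (\<omega>, Z b \<omega>) * g1 \<omega> \<partial>P)"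
      by (rule I1) auto
    \<comment> \<open>The uniform bound \<open>c\<close> on the factors makes the total mass finite,
      so the whole space serves as the exhausting sequence for uniqueness.\<close>
    also have "\<dots> \<le> (\<integral>\<^sup>+\<omega>. ennreal (c ^ card (A-{b})) \<partial>P)"
    proof (intro nn_integral_mono)
      fix \<omega> assume w: "\<omega> \<in> space P"
      have "g1 \<omega> \<le> (\<Prod>i\<in>A-{b}. ennreal c)"
        unfolding g1_def using insert.prems(3) w measurable_space[OF Z_measurable w]
        by (intro prod_mono_ennreal) auto
      also have "\<dots> = ennreal (c ^ card (A-{b}))"
        using c by (simp add: ennreal_power)
      finally show "indicator (space F \<times> space M0) (\<omega>, Z b \<omega>) * g1 \<omega> \<le> ennreal (c ^ card (A-{b}))"
        by (auto simp: indicator_def)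
    qed
    also have "\<dots> < \<infinity>" using emeasure_space_1 by simp
    finally show "emeasure \<mu>1 (space F \<times> space M0) \<noteq> \<infinity>" by simp
  qed (use rect in auto)
  then have eq: "(\<integral>\<^sup>+p. indicator G (fst p) * f b (fst p) (snd p) \<partial>\<mu>1) =
      (\<integral>\<^sup>+p. indicator G (fst p) * f b (fst p) (snd p) \<partial>\<mu>2)" by simp
  have G [measurable]: "G \<in> sets F" by fact
  have [measurable]: "(\<lambda>p. f b (fst p) (snd p)) \<in> borel_measurable (F \<Otimes>\<^sub>M M0)"
    using fm[OF b] by (simp add: split_beta')
  have m: "(\<lambda>p. indicator G (fst p) * f b (fst p) (snd p)) \<in> borel_measurable (F \<Otimes>\<^sub>M M0)"
    by measurable
  have "(\<integral>\<^sup>+\<omega>. indicator G \<omega> * (\<Prod>i\<in>A. f i \<omega> (Z i \<omega>)) \<partial>P) =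
      (\<integral>\<^sup>+p. indicator G (fst p) * f b (fst p) (snd p) \<partial>\<mu>1)"
    unfolding I1[OF m] by (simp add: split1 mult.assoc)
  also have "\<dots> = (\<integral>\<^sup>+\<omega>. (\<integral>\<^sup>+e. indicator G \<omega> * f b \<omega> e \<partial>K \<omega>) * g2 \<omega> \<partial>P)"
    unfolding eq I2[OF m] by simp
  also have "\<dots> = (\<integral>\<^sup>+\<omega>. indicator G \<omega> * (\<Prod>i\<in>A. \<integral>\<^sup>+e. f i \<omega> e \<partial>K \<omega>) \<partial>P)"
  proof (intro nn_integral_cong)
    fix \<omega> assume w: "\<omega> \<in> space P"
    have "f b \<omega> \<in> borel_measurable M0"
      using measurable_Pair2[OF fm[OF b], of \<omega>] w by (simp add: space_F)
    then show "(\<integral>\<^sup>+e. indicator G \<omega> * f b \<omega> e \<partial>K \<omega>) * g2 \<omega> =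
        indicator G \<omega> * (\<Prod>i\<in>A. \<integral>\<^sup>+e. f i \<omega> e \<partial>K \<omega>)"
      by (simp add: split2 nn_integral_cmult mult.assoc)
  qed
  finally show ?case .
qed

lemma nn_integral_prod:
  fixes f :: "'i \<Rightarrow> 'w \<Rightarrow> 'e \<Rightarrow> ennreal"
  assumes "\<And>i. i \<in> A \<Longrightarrow> jointly_measurable (f i)"
    and "\<And>i \<omega> e. i \<in> A \<Longrightarrow> \<omega> \<in> space P \<Longrightarrow> e \<in> space M0 \<Longrightarrow> f i \<omega> e \<le> ennreal c"
  shows "(\<integral>\<^sup>+\<omega>. (\<Prod>i\<in>A. f i \<omega> (Z i \<omega>)) \<partial>P) = (\<integral>\<^sup>+\<omega>. (\<Prod>i\<in>A. \<integral>\<^sup>+e. f i \<omega> e \<partial>K \<omega>) \<partial>P)"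
proof -
  have "(\<integral>\<^sup>+\<omega>. indicator (space F) \<omega> * (\<Prod>i\<in>A. f i \<omega> (Z i \<omega>)) \<partial>P) =
    (\<integral>\<^sup>+\<omega>. indicator (space F) \<omega> * (\<Prod>i\<in>A. \<integral>\<^sup>+e. f i \<omega> e \<partial>K \<omega>) \<partial>P)"
  proof (rule nn_integral_prod_aux[OF fin order_refl, where c = "max 1 c"])
    show "f i \<omega> e \<le> ennreal (max 1 c)" if "i \<in> A" "\<omega> \<in> space P" "e \<in> space M0" for i \<omega> e
      using assms(2)[OF that] by (rule order_trans) (auto intro: ennreal_leI)
  qed (use assms in auto)
  also have "(\<integral>\<^sup>+\<omega>. indicator (space F) \<omega> * (\<Prod>i\<in>A. f i \<omega> (Z i \<omega>)) \<partial>P) =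
      (\<integral>\<^sup>+\<omega>. (\<Prod>i\<in>A. f i \<omega> (Z i \<omega>)) \<partial>P)"
    by (intro nn_integral_cong) (simp add: space_F)
  also have "(\<integral>\<^sup>+\<omega>. indicator (space F) \<omega> * (\<Prod>i\<in>A. \<integral>\<^sup>+e. f i \<omega> e \<partial>K \<omega>) \<partial>P) =
      (\<integral>\<^sup>+\<omega>. (\<Prod>i\<in>A. \<integral>\<^sup>+e. f i \<omega> e \<partial>K \<omega>) \<partial>P)"
    by (intro nn_integral_cong) (simp add: space_F)
  finally show ?thesis .
qed

section \<open>Hoeffding bounds given the history\<close>

text \<open>By the product formula the exponential moment is the integral of a product of moments
  under \<open>K\<close>, each bounded by Hoeffding's lemma. The interval may move with the history;
  only its width \<open>d\<close> enters, so the bound on each factor is deterministic.\<close>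

lemma cond_Hoeffding_ge:
  fixes \<phi> :: "'w \<Rightarrow> 'e \<Rightarrow> real" and d \<delta> :: real
  assumes \<phi> [measurable]: "jointly_measurable \<phi>"
    and bnd: "\<And>\<omega> e. \<omega> \<in> space P \<Longrightarrow> e \<in> space M0 \<Longrightarrow> lo \<omega> \<le> \<phi> \<omega> e \<and> \<phi> \<omega> e \<le> lo \<omega> + d"
    and mean0: "\<And>\<omega>. \<omega> \<in> space P \<Longrightarrow> (\<integral>e. \<phi> \<omega> e \<partial>K \<omega>) = 0"
    and d: "0 < d" and \<delta>: "0 < \<delta>" and ne: "A \<noteq> {}"
  shows "\<P>(\<omega> in P. \<delta> * real (card A) \<le> (\<Sum>i\<in>A. \<phi> \<omega> (Z i \<omega>)))
    \<le> exp (- 2 * real (card A) * \<delta>\<^sup>2 / d\<^sup>2)"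
proof -
  define n where "n = real (card A)"
  have n: "0 < n" using ne fin by (simp add: n_def card_gt_0_iff)
  \<comment> \<open>The minimiser of
    \<open>- l * \<delta> + l\<^sup>2 * d\<^sup>2 / 8\<close>.\<close>
  define l where "l = 4 * \<delta> / d\<^sup>2"
  have l: "0 < l" using d \<delta> by (simp add: l_def)
  have ivl: "interval_bounded_random_variable (K \<omega>) (\<phi> \<omega>) (lo \<omega>) (lo \<omega> + d)" if w: "\<omega> \<in> space P" for \<omega>
  proof -
    interpret Kp: prob_space "K \<omega>" by (rule k_prob[OF w])
    show ?thesis
    proof
      show "\<phi> \<omega> \<in> borel_measurable (K \<omega>)"
        using measurable_Pair2[OF \<phi>, of \<omega>] w by (simp add: space_F)
      show "AE x in K \<omega>. \<phi> \<omega> x \<in> {lo \<omega>..lo \<omega> + d}"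
        using bnd[OF w] by (intro AE_I2) auto
    qed
  qed
  \<comment> \<open>Mean zero forces \<open>lo \<omega> \<le> 0\<close>, so \<open>d\<close> is an
    upper bound that does not depend on the history, as the product formula requires.\<close>
  have \<phi>d: "\<phi> \<omega> e \<le> d" if w: "\<omega> \<in> space P" and e: "e \<in> space M0" for \<omega> e
  proof -
    interpret Kp: interval_bounded_random_variable "K \<omega>" "\<phi> \<omega>" "lo \<omega>" "lo \<omega> + d" by (rule ivl[OF w])
    have "lo \<omega> \<le> (\<integral>e. \<phi> \<omega> e \<partial>K \<omega>)"
      using bnd[OF w] by (intro Kp.integral_ge_const Kp.integrable AE_I2) auto
    then show ?thesis using mean0[OF w] bnd[OF w e] by simp
  qed
  have Zm [measurable]: "(\<lambda>\<omega>. \<phi> \<omega> (Z i \<omega>)) \<in> borel_measurable P" if "i \<in> A" for i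
    by (rule Z_pair_measurable[OF that \<phi>])
  have "(\<integral>\<^sup>+\<omega>. ennreal (exp (l * (\<Sum>i\<in>A. \<phi> \<omega> (Z i \<omega>)))) \<partial>P) =
      (\<integral>\<^sup>+\<omega>. (\<Prod>i\<in>A. ennreal (exp (l * \<phi> \<omega> (Z i \<omega>)))) \<partial>P)"
    by (intro nn_integral_cong) (simp add: sum_distrib_left exp_sum[OF fin] prod_ennreal)
  also have "\<dots> = (\<integral>\<^sup>+\<omega>. (\<Prod>i\<in>A. \<integral>\<^sup>+e. ennreal (exp (l * \<phi> \<omega> e)) \<partial>K \<omega>) \<partial>P)"
  proof (rule nn_integral_prod[where f = "\<lambda>i \<omega> e. ennreal (exp (l * \<phi> \<omega> e))" and c = "exp (l * d)"])
    show "ennreal (exp (l * \<phi> \<omega> e)) \<le> ennreal (exp (l * d))"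
      if "\<omega> \<in> space P" "e \<in> space M0" for \<omega> e
      using l \<phi>d[OF that] by (intro ennreal_leI) simp
  qed simp
  also have "\<dots> \<le> (\<integral>\<^sup>+\<omega>. (\<Prod>i\<in>A. ennreal (exp (l\<^sup>2 * d\<^sup>2 / 8))) \<partial>P)"
  proof (intro nn_integral_mono prod_mono_ennreal)
    fix \<omega> assume w: "\<omega> \<in> space P"
    interpret Kp: interval_bounded_random_variable "K \<omega>" "\<phi> \<omega>" "lo \<omega>" "lo \<omega> + d" by (rule ivl[OF w])
    show "(\<integral>\<^sup>+e. ennreal (exp (l * \<phi> \<omega> e)) \<partial>K \<omega>) \<le> ennreal (exp (l\<^sup>2 * d\<^sup>2 / 8))"
      using Kp.Hoeffdings_lemma_nn_integral_0[OF l mean0[OF w]] by simp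
  qed
  also have "\<dots> = ennreal (exp (n * (l\<^sup>2 * d\<^sup>2 / 8)))"
    by (simp only: nn_integral_const emeasure_space_1 prod_constant n_def exp_of_nat_mult ennreal_power
        mult_1_right exp_ge_zero)
  finally have mgf: "(\<integral>\<^sup>+\<omega>. ennreal (exp (l * (\<Sum>i\<in>A. \<phi> \<omega> (Z i \<omega>)))) \<partial>P) \<le> ennreal (exp (n * (l\<^sup>2 * d\<^sup>2 / 8)))" .
  let ?E = "{\<omega> \<in> space P. \<delta> * n \<le> (\<Sum>i\<in>A. \<phi> \<omega> (Z i \<omega>))}"
  have sum_m [measurable]: "(\<lambda>\<omega>. \<Sum>i\<in>A. \<phi> \<omega> (Z i \<omega>)) \<in> borel_measurable P"
    by (intro borel_measurable_sum Zm)
  have E [measurable]: "?E \<in> sets P" by measurable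
  have "emeasure P ?E = (\<integral>\<^sup>+\<omega>. indicator ?E \<omega> \<partial>P)" by simp
  also have "\<dots> \<le> (\<integral>\<^sup>+\<omega>. ennreal (exp (- l * \<delta> * n)) * ennreal (exp (l * (\<Sum>i\<in>A. \<phi> \<omega> (Z i \<omega>)))) \<partial>P)"
  proof (intro nn_integral_mono)
    fix \<omega>
    have "1 \<le> exp (- l * \<delta> * n) * exp (l * (\<Sum>i\<in>A. \<phi> \<omega> (Z i \<omega>)))" if "\<omega> \<in> ?E"
      using that l by (simp flip: exp_add add: algebra_simps)
    then show "indicator ?E \<omega> \<le> ennreal (exp (- l * \<delta> * n)) * ennreal (exp (l * (\<Sum>i\<in>A. \<phi> \<omega> (Z i \<omega>))))"
      by (auto simp: indicator_def ennreal_mult'[symmetric] simp del: One_nat_def)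
  qed
  also have "\<dots> = ennreal (exp (- l * \<delta> * n)) * (\<integral>\<^sup>+\<omega>. ennreal (exp (l * (\<Sum>i\<in>A. \<phi> \<omega> (Z i \<omega>)))) \<partial>P)"
    by (intro nn_integral_cmult) measurable
  also have "\<dots> \<le> ennreal (exp (- l * \<delta> * n)) * ennreal (exp (n * (l\<^sup>2 * d\<^sup>2 / 8)))"
    by (intro mult_left_mono mgf) simp
  also have "\<dots> = ennreal (exp (- 2 * n * \<delta>\<^sup>2 / d\<^sup>2))"
  proof -
    have "- l * \<delta> * n + n * (l\<^sup>2 * d\<^sup>2 / 8) = - 2 * n * \<delta>\<^sup>2 / d\<^sup>2"
      using d by (simp add: l_def power2_eq_square field_simps)
    then show ?thesis by (simp flip: ennreal_mult' exp_add)
  qed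
  finally show ?thesis
    unfolding n_def by (simp add: emeasure_eq_measure)
qed

lemma cond_Hoeffding_abs_ge:
  fixes \<phi> :: "'w \<Rightarrow> 'e \<Rightarrow> real" and d \<delta> :: real
  assumes \<phi> [measurable]: "jointly_measurable \<phi>"
    and bnd: "\<And>\<omega> e. \<omega> \<in> space P \<Longrightarrow> e \<in> space M0 \<Longrightarrow> lo \<omega> \<le> \<phi> \<omega> e \<and> \<phi> \<omega> e \<le> lo \<omega> + d"
    and mean0: "\<And>\<omega>. \<omega> \<in> space P \<Longrightarrow> (\<integral>e. \<phi> \<omega> e \<partial>K \<omega>) = 0"
    and d: "0 < d" and \<delta>: "0 < \<delta>" and ne: "A \<noteq> {}"
  shows "\<P>(\<omega> in P. \<delta> * real (card A) \<le> \<bar>\<Sum>i\<in>A. \<phi> \<omega> (Z i \<omega>)\<bar>)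
    \<le> 2 * exp (- 2 * real (card A) * \<delta>\<^sup>2 / d\<^sup>2)"
proof -
  have sum_m [measurable]: "(\<lambda>\<omega>. \<Sum>i\<in>A. \<phi> \<omega> (Z i \<omega>)) \<in> borel_measurable P"
    by (intro borel_measurable_sum Z_pair_measurable[OF _ \<phi>])
  let ?E1 = "{\<omega> \<in> space P. \<delta> * real (card A) \<le> (\<Sum>i\<in>A. \<phi> \<omega> (Z i \<omega>))}"
  let ?E2 = "{\<omega> \<in> space P. \<delta> * real (card A) \<le> (\<Sum>i\<in>A. - \<phi> \<omega> (Z i \<omega>))}"
  have "\<P>(\<omega> in P. \<delta> * real (card A) \<le> \<bar>\<Sum>i\<in>A. \<phi> \<omega> (Z i \<omega>)\<bar>) \<le> measure P (?E1 \<union> ?E2)"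
    by (intro finite_measure_mono) (auto simp: sum_negf)
  also have "\<dots> \<le> measure P ?E1 + measure P ?E2"
    by (intro measure_Un_le) (auto simp: sum_negf)
  also have "measure P ?E1 \<le> exp (- 2 * real (card A) * \<delta>\<^sup>2 / d\<^sup>2)"
    by (rule cond_Hoeffding_ge[OF assms])
  also have "measure P ?E2 \<le> exp (- 2 * real (card A) * \<delta>\<^sup>2 / d\<^sup>2)"
  proof (rule cond_Hoeffding_ge[where lo = "\<lambda>\<omega>. - lo \<omega> - d"])
    show "- lo \<omega> - d \<le> - \<phi> \<omega> e \<and> - \<phi> \<omega> e \<le> - lo \<omega> - d + d"
      if "\<omega> \<in> space P" "e \<in> space M0" for \<omega> e
      using bnd[OF that] by auto
  qed (use mean0 d \<delta> ne in auto)
  finally show ?thesis by simp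
qed

lemma integrable_K_bounded:
  fixes f :: "'w \<Rightarrow> 'e \<Rightarrow> real"
  assumes f: "jointly_measurable f" and w: "\<omega> \<in> space P"
    and bnd: "\<And>e. e \<in> space M0 \<Longrightarrow> lo \<le> f \<omega> e \<and> f \<omega> e \<le> hi"
  shows "integrable (K \<omega>) (f \<omega>)"
proof -
  interpret Kp: prob_space "K \<omega>" by (rule k_prob[OF w])
  have "f \<omega> \<in> borel_measurable M0"
    using measurable_Pair2[OF f, of \<omega>] w by (simp add: space_F)
  then show "integrable (K \<omega>) (f \<omega>)"
    using bnd by (intro Kp.integrable_const_bound[where B = "\<bar>lo\<bar> + \<bar>hi\<bar>"]) (auto intro!: AE_I2, fastforce)
qed

text \<open>The conditional mean of the total is at least \<open>c * card A\<close>, so a total of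
  at most half of that is a deviation of \<open>c / 2\<close> per summand; centring leaves intervals
  of width \<open>w\<close>.\<close>

lemma total_weight_small:
  fixes W :: "'w \<Rightarrow> 'e \<Rightarrow> real" and c w :: real
  assumes W [measurable]: "jointly_measurable W"
    and W_bnd: "\<And>\<omega> e. \<omega> \<in> space P \<Longrightarrow> e \<in> space M0 \<Longrightarrow> 0 \<le> W \<omega> e \<and> W \<omega> e \<le> w"
    and mean: "\<And>\<omega>. \<omega> \<in> space P \<Longrightarrow> c \<le> (\<integral>e. W \<omega> e \<partial>K \<omega>)"
    and w: "0 < w" and c: "0 < c" and ne: "A \<noteq> {}"
  shows "\<P>(\<omega> in P. (\<Sum>i\<in>A. W \<omega> (Z i \<omega>)) \<le> c / 2 * real (card A))
    \<le> exp (- real (card A) * c\<^sup>2 / (2 * w\<^sup>2))"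
proof -
  have m [measurable]: "(\<lambda>\<omega>. \<integral>e. W \<omega> e \<partial>K \<omega>) \<in> borel_measurable F"
    by (rule integral_K_measurable[OF W])
  have [measurable]: "(\<lambda>\<omega>. \<Sum>i\<in>A. (\<integral>e. W \<omega> e \<partial>K \<omega>) - W \<omega> (Z i \<omega>)) \<in> borel_measurable P"
    by (intro borel_measurable_sum borel_measurable_diff measurable_F_P[OF m] Z_pair_measurable[OF _ W])
  have "\<P>(\<omega> in P. (\<Sum>i\<in>A. W \<omega> (Z i \<omega>)) \<le> c / 2 * real (card A)) \<le>
      \<P>(\<omega> in P. c / 2 * real (card A) \<le> (\<Sum>i\<in>A. (\<integral>e. W \<omega> e \<partial>K \<omega>) - W \<omega> (Z i \<omega>)))"
  proof (intro finite_measure_mono subsetI CollectI conjI)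
    fix \<omega> assume a: "\<omega> \<in> {\<omega> \<in> space P. (\<Sum>i\<in>A. W \<omega> (Z i \<omega>)) \<le> c / 2 * real (card A)}"
    then have "c * real (card A) \<le> (\<integral>e. W \<omega> e \<partial>K \<omega>) * real (card A)"
      using mean by (intro mult_right_mono) auto
    then show "c / 2 * real (card A) \<le> (\<Sum>i\<in>A. (\<integral>e. W \<omega> e \<partial>K \<omega>) - W \<omega> (Z i \<omega>))"
      using a by (simp add: sum_subtractf mult.commute)
  qed auto
  also have "\<dots> \<le> exp (- 2 * real (card A) * (c / 2)\<^sup>2 / w\<^sup>2)"
  proof (rule cond_Hoeffding_ge[where lo = "\<lambda>\<omega>. (\<integral>e. W \<omega> e \<partial>K \<omega>) - w"])
    show "(\<integral>e. (\<integral>e. W \<omega> e \<partial>K \<omega>) - W \<omega> e \<partial>K \<omega>) = 0" if "\<omega> \<in> space P" for \<omega>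
    proof -
      interpret Kp: prob_space "K \<omega>" by (rule k_prob[OF that])
      show ?thesis
        using integrable_K_bounded[OF W that, of 0 w] W_bnd[OF that] Kp.prob_space
        by (subst Bochner_Integration.integral_diff) auto
    qed
  qed (use W_bnd w c ne in auto)
  also have "\<dots> = exp (- real (card A) * c\<^sup>2 / (2 * w\<^sup>2))"
    by (simp add: power2_eq_square field_simps)
  finally show ?thesis .
qed

text \<open>
  When the total weight is small, only the trivial bound \<open>d\<close> on the deviation is available; as
  \<open>\<delta> \<le> d\<close> may be assumed, that event costs no more than the fluctuation of the numerator.
\<close>

lemma self_normalised_deviation:
  fixes W f :: "'w \<Rightarrow> 'e \<Rightarrow> real" and R :: "'w \<Rightarrow> real" and c w d :: real
  defines "a \<equiv> (\<lambda>\<omega>. (\<integral>e. W \<omega> e * f \<omega> e \<partial>K \<omega>) / (\<integral>e. W \<omega> e \<partial>K \<omega>))"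
  assumes W [measurable]: "jointly_measurable W"
    and f [measurable]: "jointly_measurable f"
    and W_bnd: "\<And>\<omega> e. \<omega> \<in> space P \<Longrightarrow> e \<in> space M0 \<Longrightarrow> 0 \<le> W \<omega> e \<and> W \<omega> e \<le> w"
    and f_bnd: "\<And>\<omega> e. \<omega> \<in> space P \<Longrightarrow> e \<in> space M0 \<Longrightarrow> lo \<omega> \<le> f \<omega> e \<and> f \<omega> e \<le> lo \<omega> + d"
    and mean: "\<And>\<omega>. \<omega> \<in> space P \<Longrightarrow> c \<le> (\<integral>e. W \<omega> e \<partial>K \<omega>)"
    and R: "\<And>\<omega>. \<omega> \<in> space P \<Longrightarrow> 0 < (\<Sum>i\<in>A. W \<omega> (Z i \<omega>)) \<Longrightarrow>
      R \<omega> = (\<Sum>i\<in>A. W \<omega> (Z i \<omega>) * f \<omega> (Z i \<omega>)) / (\<Sum>i\<in>A. W \<omega> (Z i \<omega>))"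
    and R_bnd: "\<And>\<omega>. \<omega> \<in> space P \<Longrightarrow> lo \<omega> \<le> R \<omega> \<and> R \<omega> \<le> lo \<omega> + d"
    and w: "0 < w" and c: "0 < c" and d: "0 < d" and \<delta>: "0 < \<delta>" and ne: "A \<noteq> {}"
  shows "\<P>(\<omega> in P. \<delta> \<le> \<bar>R \<omega> - a \<omega>\<bar>) \<le> 3 * exp (- real (card A) * c\<^sup>2 * \<delta>\<^sup>2 / (8 * w\<^sup>2 * d\<^sup>2))"
    and "a \<in> borel_measurable F"
proof -
  define W1 where "W1 = (\<lambda>\<omega>. \<integral>e. W \<omega> e \<partial>K \<omega>)"
  have W1 [measurable]: "W1 \<in> borel_measurable F"
    unfolding W1_def by (rule integral_K_measurable[OF W])
  have Wf [measurable]: "(\<lambda>\<omega>. \<integral>e. W \<omega> e * f \<omega> e \<partial>K \<omega>) \<in> borel_measurable F"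
    by (rule integral_K_measurable) (simp add: split_beta')
  show a [measurable]: "a \<in> borel_measurable F"
    unfolding a_def using W1 by (simp add: W1_def)
  have W1c: "c \<le> W1 \<omega>" if "\<omega> \<in> space P" for \<omega>
    using mean[OF that] by (simp add: W1_def)
  have intW: "integrable (K \<omega>) (W \<omega>)" if "\<omega> \<in> space P" for \<omega>
    using integrable_K_bounded[OF W that, of 0 w] W_bnd[OF that] by auto
  have Wsec [measurable]: "W \<omega> \<in> borel_measurable M0" "f \<omega> \<in> borel_measurable M0" if "\<omega> \<in> space P" for \<omega>
    using measurable_Pair2[OF W, of \<omega>] measurable_Pair2[OF f, of \<omega>] that by (simp_all add: space_F)
  have intWf: "integrable (K \<omega>) (\<lambda>e. W \<omega> e * f \<omega> e)" if p: "\<omega> \<in> space P" for \<omega>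
  proof -
    interpret Kp: prob_space "K \<omega>" by (rule k_prob[OF p])
    show ?thesis
    proof (rule Kp.integrable_const_bound[where B = "w * (\<bar>lo \<omega>\<bar> + d)"])
      show "AE e in K \<omega>. norm (W \<omega> e * f \<omega> e) \<le> w * (\<bar>lo \<omega>\<bar> + d)"
      proof (rule AE_I2)
        fix e assume e: "e \<in> space (K \<omega>)"
        then have "\<bar>W \<omega> e\<bar> \<le> w" "\<bar>f \<omega> e\<bar> \<le> \<bar>lo \<omega>\<bar> + d"
          using W_bnd[OF p, of e] f_bnd[OF p, of e] by auto
        then show "norm (W \<omega> e * f \<omega> e) \<le> w * (\<bar>lo \<omega>\<bar> + d)"
          using w by (simp add: abs_mult mult_mono)
      qed
      show "(\<lambda>e. W \<omega> e * f \<omega> e) \<in> borel_measurable (K \<omega>)"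
        using Wsec[OF p] by simp
    qed
  qed
  have a_bnd: "lo \<omega> \<le> a \<omega> \<and> a \<omega> \<le> lo \<omega> + d" if p: "\<omega> \<in> space P" for \<omega>
  proof -
    have "lo \<omega> * W1 \<omega> = (\<integral>e. W \<omega> e * lo \<omega> \<partial>K \<omega>)" "(lo \<omega> + d) * W1 \<omega> = (\<integral>e. W \<omega> e * (lo \<omega> + d) \<partial>K \<omega>)"
      unfolding W1_def by (simp_all add: mult.commute)
    moreover have "(\<integral>e. W \<omega> e * lo \<omega> \<partial>K \<omega>) \<le> (\<integral>e. W \<omega> e * f \<omega> e \<partial>K \<omega>)"
      "(\<integral>e. W \<omega> e * f \<omega> e \<partial>K \<omega>) \<le> (\<integral>e. W \<omega> e * (lo \<omega> + d) \<partial>K \<omega>)"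
      by (rule integral_mono; use W_bnd[OF p] f_bnd[OF p] intWf[OF p] intW[OF p] in
          \<open>auto intro!: mult_left_mono\<close>)+
    moreover have "a \<omega> * W1 \<omega> = (\<integral>e. W \<omega> e * f \<omega> e \<partial>K \<omega>)" "0 < W1 \<omega>"
      using W1c[OF p] c by (simp_all add: a_def W1_def)
    ultimately show ?thesis by (metis mult_right_le_imp_le)
  qed
  \<comment> \<open>Centring the function at the ratio \<open>a\<close> before weighting gives
    conditional mean zero, and the sum of these terms is \<open>R - a\<close> times the total
    weight.\<close>
  define \<phi> where "\<phi> = (\<lambda>\<omega> e. W \<omega> e * (f \<omega> e - a \<omega>))"
  have \<phi> [measurable]: "jointly_measurable \<phi>"
    unfolding \<phi>_def by (simp add: split_beta')
  show "\<P>(\<omega> in P. \<delta> \<le> \<bar>R \<omega> - a \<omega>\<bar>) \<le> 3 * exp (- real (card A) * c\<^sup>2 * \<delta>\<^sup>2 / (8 * w\<^sup>2 * d\<^sup>2))"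
  proof (cases "\<delta> \<le> d")
    case False
    have "\<bar>R \<omega> - a \<omega>\<bar> \<le> d" if "\<omega> \<in> space P" for \<omega>
      using R_bnd[OF that] a_bnd[OF that] by auto
    then have "{\<omega> \<in> space P. \<delta> \<le> \<bar>R \<omega> - a \<omega>\<bar>} = {}" using False by fastforce
    then show ?thesis by (metis measure_empty exp_ge_zero mult_nonneg_nonneg zero_le_numeral)
  next
    case True
    \<comment> \<open>Off \<open>?E1\<close> the total weight exceeds \<open>c / 2 * card A\<close>,
      so a deviation \<delta> of the ratio pushes the centred sum past the threshold of
      \<open>?E2\<close>.\<close>
    let ?E1 = "{\<omega> \<in> space P. (\<Sum>i\<in>A. W \<omega> (Z i \<omega>)) \<le> c / 2 * real (card A)}"
    let ?E2 = "{\<omega> \<in> space P. (\<delta> * c / 2) * real (card A) \<le> \<bar>\<Sum>i\<in>A. \<phi> \<omega> (Z i \<omega>)\<bar>}"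
    have [measurable]: "(\<lambda>\<omega>. \<Sum>i\<in>A. W \<omega> (Z i \<omega>)) \<in> borel_measurable P"
      "(\<lambda>\<omega>. \<Sum>i\<in>A. \<phi> \<omega> (Z i \<omega>)) \<in> borel_measurable P"
      by (intro borel_measurable_sum Z_pair_measurable[OF _ W] Z_pair_measurable[OF _ \<phi>]; assumption)+
    have "{\<omega> \<in> space P. \<delta> \<le> \<bar>R \<omega> - a \<omega>\<bar>} \<subseteq> ?E1 \<union> ?E2"
    proof (rule subsetI, rule ccontr)
      fix \<omega> assume "\<omega> \<in> {\<omega> \<in> space P. \<delta> \<le> \<bar>R \<omega> - a \<omega>\<bar>}" "\<omega> \<notin> ?E1 \<union> ?E2"
      then have p: "\<omega> \<in> space P" and 1: "\<delta> \<le> \<bar>R \<omega> - a \<omega>\<bar>" and 2: "c / 2 * real (card A) < (\<Sum>i\<in>A. W \<omega> (Z i \<omega>))"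
        and 3: "\<bar>\<Sum>i\<in>A. \<phi> \<omega> (Z i \<omega>)\<bar> < (\<delta> * c / 2) * real (card A)" by auto
      have pos: "0 < (\<Sum>i\<in>A. W \<omega> (Z i \<omega>))"
        by (rule le_less_trans[OF _ 2]) (use c in auto)
      have "(\<Sum>i\<in>A. \<phi> \<omega> (Z i \<omega>)) = (R \<omega> - a \<omega>) * (\<Sum>i\<in>A. W \<omega> (Z i \<omega>))"
      proof -
        have "(\<Sum>i\<in>A. \<phi> \<omega> (Z i \<omega>)) =
            (\<Sum>i\<in>A. W \<omega> (Z i \<omega>) * f \<omega> (Z i \<omega>)) - a \<omega> * (\<Sum>i\<in>A. W \<omega> (Z i \<omega>))"
          by (simp add: \<phi>_def right_diff_distrib sum_subtractf sum_distrib_left mult.commute)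
        also have "(\<Sum>i\<in>A. W \<omega> (Z i \<omega>) * f \<omega> (Z i \<omega>)) = R \<omega> * (\<Sum>i\<in>A. W \<omega> (Z i \<omega>))"
          using pos R[OF p pos] by simp
        finally show ?thesis by (simp add: left_diff_distrib)
      qed
      then have "\<bar>\<Sum>i\<in>A. \<phi> \<omega> (Z i \<omega>)\<bar> = \<bar>R \<omega> - a \<omega>\<bar> * (\<Sum>i\<in>A. W \<omega> (Z i \<omega>))"
        using pos by (simp add: abs_mult)
      also have "\<dots> \<ge> \<delta> * (c / 2 * real (card A))"
        using 1 2 \<delta> c by (intro mult_mono) auto
      finally show False using 3 by simp
    qed
    then have "\<P>(\<omega> in P. \<delta> \<le> \<bar>R \<omega> - a \<omega>\<bar>) \<le> measure P (?E1 \<union> ?E2)"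
      by (intro finite_measure_mono) auto
    also have "\<dots> \<le> measure P ?E1 + measure P ?E2"
      by (intro measure_Un_le) auto
    also have "measure P ?E1 \<le> exp (- real (card A) * c\<^sup>2 / (2 * w\<^sup>2))"
      using W_bnd mean w c ne by (intro total_weight_small[OF W]) auto
    also have "exp (- real (card A) * c\<^sup>2 / (2 * w\<^sup>2)) \<le> exp (- real (card A) * c\<^sup>2 * \<delta>\<^sup>2 / (8 * w\<^sup>2 * d\<^sup>2))"
    proof -
      have "\<delta>\<^sup>2 \<le> d\<^sup>2" using True \<delta> by (intro power_mono) auto
      then have "\<delta>\<^sup>2 / d\<^sup>2 \<le> 1" using d by simp
      then have "real (card A) * c\<^sup>2 / (2 * w\<^sup>2) * (\<delta>\<^sup>2 / d\<^sup>2 / 4) \<le> real (card A) * c\<^sup>2 / (2 * w\<^sup>2) * 1"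
        by (intro mult_left_mono) auto
      then show ?thesis by (simp add: field_simps)
    qed
    \<comment> \<open>The centred terms lie between \<open>- w * d\<close> and \<open>w * d\<close>.
      The width \<open>2 * w * d\<close> and the deviation \<open>\<delta> * c / 2\<close> produce
      the 8 in the exponent.\<close>
    also have "measure P ?E2 \<le> 2 * exp (- 2 * real (card A) * (\<delta> * c / 2)\<^sup>2 / (2 * w * d)\<^sup>2)"
    proof (rule cond_Hoeffding_abs_ge[OF \<phi>, where lo = "\<lambda>_. - w * d"])
      show "- w * d \<le> \<phi> \<omega> e \<and> \<phi> \<omega> e \<le> - w * d + 2 * w * d" if p: "\<omega> \<in> space P" "e \<in> space M0" for \<omega> e
      proof -
        have "\<bar>f \<omega> e - a \<omega>\<bar> \<le> d" using f_bnd[OF p] a_bnd[OF p(1)] by auto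
        then have "\<bar>\<phi> \<omega> e\<bar> \<le> w * d"
          using W_bnd[OF p] w unfolding \<phi>_def abs_mult by (intro mult_mono) auto
        then show ?thesis by (auto simp: abs_le_iff algebra_simps)
      qed
      show "(\<integral>e. \<phi> \<omega> e \<partial>K \<omega>) = 0" if p: "\<omega> \<in> space P" for \<omega>
      proof -
        have "(\<integral>e. \<phi> \<omega> e \<partial>K \<omega>) = (\<integral>e. W \<omega> e * f \<omega> e \<partial>K \<omega>) - (\<integral>e. W \<omega> e * a \<omega> \<partial>K \<omega>)"
          unfolding \<phi>_def right_diff_distrib using intWf[OF p] intW[OF p]
          by (intro Bochner_Integration.integral_diff) auto
        also have "\<dots> = 0"
          using W1c[OF p] c by (simp add: a_def W1_def)
        finally show ?thesis .
      qed
    qed (use w d c \<delta> ne in auto)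
    also have "- 2 * real (card A) * (\<delta> * c / 2)\<^sup>2 / (2 * w * d)\<^sup>2 = - real (card A) * c\<^sup>2 * \<delta>\<^sup>2 / (8 * w\<^sup>2 * d\<^sup>2)"
      by (simp add: power2_eq_square field_simps)
    finally show ?thesis by simp
  qed
qed

end

subsection \<open>Contraction of oscillations\<close>

text \<open>An interval of width \<open>d\<close> containing the range is what both Hoeffding's
  lemma and Doeblin's argument consume. Unlike the supremum in \<open>osc\<close>, it says that the
  function is bounded and gives an upper bound that can be enlarged.\<close>

definition osc_le :: "('a \<Rightarrow> real) \<Rightarrow> real \<Rightarrow> bool" where
  "osc_le f d \<longleftrightarrow> (\<exists>lo. \<forall>x. lo \<le> f x \<and> f x \<le> lo + d)"

lemma osc_le_mono: "osc_le f d \<Longrightarrow> d \<le> d' \<Longrightarrow> osc_le f d'"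
  unfolding osc_le_def by (meson add_left_mono order_trans)

text \<open>
  Doeblin's argument: the normalised weight \<open>a\<close> dominates the multiple \<open>\<sigma>m / \<sigma>p\<close> of the normalised
  \<open>\<mu>\<close>, so the means for two such weights differ only through the remaining mass.
\<close>

lemma weighted_mean_bounds:
  fixes a f :: "'a \<Rightarrow> real"
  assumes \<mu>: "finite_measure \<mu>" "0 < measure \<mu> (space \<mu>)"
    and a [measurable]: "a \<in> borel_measurable \<mu>"
    and f [measurable]: "f \<in> borel_measurable \<mu>"
    and \<sigma>: "0 < \<sigma>m" and ab: "\<And>x. x \<in> space \<mu> \<Longrightarrow> \<sigma>m \<le> a x \<and> a x \<le> \<sigma>p"
    and fb: "\<And>x. x \<in> space \<mu> \<Longrightarrow> lo \<le> f x \<and> f x \<le> lo + d"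
  defines "F \<equiv> (\<integral>x. f x \<partial>\<mu>) / measure \<mu> (space \<mu>)"
    and "A \<equiv> (\<integral>x. a x * f x \<partial>\<mu>) / (\<integral>x. a x \<partial>\<mu>)"
  shows "\<sigma>m / \<sigma>p * F + (1 - \<sigma>m / \<sigma>p) * lo \<le> A"
    and "A \<le> \<sigma>m / \<sigma>p * F + (1 - \<sigma>m / \<sigma>p) * (lo + d)"
    and "lo \<le> A" and "A \<le> lo + d"
proof -
  interpret finite_measure \<mu> by fact
  define m where "m = measure \<mu> (space \<mu>)"
  have m: "0 < m" using \<mu>(2) by (simp add: m_def)
  then obtain x0 where x0: "x0 \<in> space \<mu>"
    by (metis m_def ex_in_conv less_irrefl measure_empty)
  have \<sigma>p: "0 < \<sigma>p" using ab[OF x0] \<sigma> by auto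
  have ia: "integrable \<mu> a"
    using ab \<sigma> by (intro integrable_const_bound[where B = \<sigma>p]) (auto intro!: AE_I2, smt (verit))
  have if': "integrable \<mu> f"
    using fb by (intro integrable_const_bound[where B = "\<bar>lo\<bar> + \<bar>lo + d\<bar>"]) (auto intro!: AE_I2, smt (verit))
  have iaf: "integrable \<mu> (\<lambda>x. a x * f x)"
  proof (rule integrable_const_bound[where B = "\<sigma>p * (\<bar>lo\<bar> + \<bar>lo + d\<bar>)"])
    show "AE x in \<mu>. norm (a x * f x) \<le> \<sigma>p * (\<bar>lo\<bar> + \<bar>lo + d\<bar>)"
    proof (rule AE_I2)
      fix x assume x: "x \<in> space \<mu>"
      have "\<bar>a x\<bar> \<le> \<sigma>p" "\<bar>f x\<bar> \<le> \<bar>lo\<bar> + \<bar>lo + d\<bar>"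
        using ab[OF x] fb[OF x] \<sigma> by auto
      then show "norm (a x * f x) \<le> \<sigma>p * (\<bar>lo\<bar> + \<bar>lo + d\<bar>)"
        using \<sigma>p by (simp add: abs_mult mult_mono)
    qed
  qed simp
  define Ia where "Ia = (\<integral>x. a x \<partial>\<mu>)"
  have "\<sigma>m * m = (\<integral>x. \<sigma>m \<partial>\<mu>)" by (simp add: m_def)
  also have "\<dots> \<le> Ia"
    unfolding Ia_def using ab by (intro integral_mono ia) auto
  finally have Ia1: "\<sigma>m * m \<le> Ia" .
  have "Ia \<le> (\<integral>x. \<sigma>p \<partial>\<mu>)"
    unfolding Ia_def using ab by (intro integral_mono ia) auto
  also have "\<dots> = \<sigma>p * m" by (simp add: m_def)
  finally have Ia2: "Ia \<le> \<sigma>p * m" .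
  have "0 < \<sigma>m * m" using \<sigma> m by simp
  then have Ia0: "0 < Ia" using Ia1 by simp
  define \<kappa> where "\<kappa> = \<sigma>m / \<sigma>p"
  have \<kappa>: "0 < \<kappa>" "\<kappa> \<le> 1" using \<sigma> \<sigma>p ab[OF x0] by (auto simp: \<kappa>_def)
  have dom: "\<kappa> / m \<le> a x / Ia" if x: "x \<in> space \<mu>" for x
  proof -
    have "\<kappa> / m = \<sigma>m / (\<sigma>p * m)" by (simp add: \<kappa>_def)
    also have "\<dots> \<le> a x / Ia"
      using ab[OF x] Ia2 Ia0 \<sigma> by (intro frac_le) auto
    finally show ?thesis .
  qed
  have F: "(\<integral>x. f x \<partial>\<mu>) = F * m" using m by (simp add: F_def m_def)
  have A: "(\<integral>x. a x * f x \<partial>\<mu>) = A * Ia" using Ia0 by (simp add: A_def Ia_def)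
  \<comment> \<open>The density \<open>a x / Ia - \<kappa> / m\<close> is nonnegative by
    \<open>dom\<close> and has integral \<open>1 - \<kappa>\<close>. With \<open>q\<close> an
    endpoint of the interval, \<open>f x - q\<close> has a constant sign, and each endpoint yields
    one of the two bounds.\<close>
  have eq: "(\<integral>x. (a x / Ia - \<kappa> / m) * (f x - q) \<partial>\<mu>) = A - q - \<kappa> * F + \<kappa> * q" for q
  proof -
    have "(\<integral>x. (a x / Ia - \<kappa> / m) * (f x - q) \<partial>\<mu>) =
        (\<integral>x. a x * f x / Ia - a x * (q / Ia) - f x * (\<kappa> / m) + \<kappa> * q / m \<partial>\<mu>)"
      by (intro Bochner_Integration.integral_cong) (simp_all add: divide_inverse algebra_simps)
    also have "\<dots> = A * Ia / Ia - Ia * (q / Ia) - F * m * (\<kappa> / m) + \<kappa> * q / m * m"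
      using ia if' iaf by (simp add: F A Ia_def[symmetric] m_def[symmetric])
    also have "\<dots> = A - q - \<kappa> * F + \<kappa> * q"
      using Ia0 m by simp
    finally show ?thesis .
  qed
  have "0 \<le> (\<integral>x. (a x / Ia - \<kappa> / m) * (f x - lo) \<partial>\<mu>)"
    using dom fb by (intro integral_nonneg_AE AE_I2 mult_nonneg_nonneg) auto
  then show 1: "\<sigma>m / \<sigma>p * F + (1 - \<sigma>m / \<sigma>p) * lo \<le> A"
    unfolding eq by (simp add: \<kappa>_def algebra_simps)
  have "(\<integral>x. (a x / Ia - \<kappa> / m) * (f x - (lo + d)) \<partial>\<mu>) \<le> (\<integral>x. 0 \<partial>\<mu>)"
  proof (rule integral_mono)
    show "integrable \<mu> (\<lambda>x. (a x / Ia - \<kappa> / m) * (f x - (lo + d)))"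
      using ia if' iaf by (simp add: algebra_simps)
    show "(a x / Ia - \<kappa> / m) * (f x - (lo + d)) \<le> 0" if "x \<in> space \<mu>" for x
      using dom[OF that] fb[OF that] by (intro mult_nonneg_nonpos) auto
  qed simp
  then show 2: "A \<le> \<sigma>m / \<sigma>p * F + (1 - \<sigma>m / \<sigma>p) * (lo + d)"
    unfolding eq by (simp add: \<kappa>_def algebra_simps)
  have "lo * m = (\<integral>x. lo \<partial>\<mu>)" "(lo + d) * m = (\<integral>x. lo + d \<partial>\<mu>)" by (simp_all add: m_def)
  moreover have "(\<integral>x. lo \<partial>\<mu>) \<le> (\<integral>x. f x \<partial>\<mu>)" "(\<integral>x. f x \<partial>\<mu>) \<le> (\<integral>x. lo + d \<partial>\<mu>)"
    by (rule integral_mono; use fb if' in auto)+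
  ultimately have Fb: "lo \<le> F" "F \<le> lo + d"
    using m unfolding F by (metis mult_right_le_imp_le)+
  have "lo = \<kappa> * lo + (1 - \<kappa>) * lo" by (simp add: algebra_simps)
  also have "\<dots> \<le> \<kappa> * F + (1 - \<kappa>) * lo" using Fb \<kappa> by (simp add: mult_left_mono)
  finally show "lo \<le> A" using 1 by (simp add: \<kappa>_def)
  have "A \<le> \<kappa> * F + (1 - \<kappa>) * (lo + d)" using 2 by (simp add: \<kappa>_def)
  also have "\<dots> \<le> \<kappa> * (lo + d) + (1 - \<kappa>) * (lo + d)" using Fb \<kappa> by (simp add: mult_left_mono)
  finally show "A \<le> lo + d" by (simp add: algebra_simps)
qed

text \<open>The common part in the Doeblin bounds is the unweighted mean of \<open>f\<close>, which
  does not depend on \<open>y\<close>; hence one interval of width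
  \<open>(1 - \<sigma>m / \<sigma>p) * d\<close> contains the means for all
  \<open>y\<close>.\<close>

lemma osc_le_weighted_mean:
  fixes a :: "'b \<Rightarrow> 'a \<Rightarrow> real" and f :: "'a \<Rightarrow> real"
  assumes \<mu>: "finite_measure \<mu>" "0 < measure \<mu> (space \<mu>)"
    and a: "\<And>y. a y \<in> borel_measurable \<mu>"
    and f: "f \<in> borel_measurable \<mu>"
    and \<sigma>: "0 < \<sigma>m" and ab: "\<And>x y. x \<in> space \<mu> \<Longrightarrow> \<sigma>m \<le> a y x \<and> a y x \<le> \<sigma>p"
    and fd: "osc_le f d"
  shows "osc_le (\<lambda>y. (\<integral>x. a y x * f x \<partial>\<mu>) / (\<integral>x. a y x \<partial>\<mu>)) ((1 - \<sigma>m / \<sigma>p) * d)"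
proof -
  obtain lo where lo: "\<And>x. lo \<le> f x \<and> f x \<le> lo + d" using fd by (auto simp: osc_le_def)
  note * = weighted_mean_bounds[OF \<mu> a f \<sigma> ab lo]
  show ?thesis
    unfolding osc_le_def
    by (rule exI[of _ "\<sigma>m / \<sigma>p * ((\<integral>x. f x \<partial>\<mu>) / measure \<mu> (space \<mu>)) + (1 - \<sigma>m / \<sigma>p) * lo"])
      (use *(1,2) in \<open>simp add: distrib_left add.assoc\<close>)
qed

lemma Fb_osc:
  assumes "h \<in> Fb"
  shows "h \<in> borel_measurable borel" "0 \<le> osc h" "osc_le h (osc h)"
proof -
  show "h \<in> borel_measurable borel" using assms by (simp add: Fb_def)
  obtain b where b: "\<And>x. \<bar>h x\<bar> \<le> b"
    using assms by (auto simp: Fb_def bounded_iff)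
  have bdd: "bdd_above (range (\<lambda>(x, x'). \<bar>h x - h x'\<bar>))"
  proof (rule bdd_aboveI)
    fix z assume "z \<in> range (\<lambda>(x, x'). \<bar>h x - h x'\<bar>)"
    then obtain x x' where z: "z = \<bar>h x - h x'\<bar>" by auto
    show "z \<le> 2 * b" unfolding z using b[of x] b[of x'] by auto
  qed
  have 1: "\<bar>h x - h y\<bar> \<le> osc h" for x y
    unfolding osc_def using cSUP_upper[OF _ bdd, of "(x, y)"] by simp
  show "0 \<le> osc h" using 1[of undefined undefined] by simp
  have bb: "bdd_below (range h)" using b by (intro bdd_belowI[of _ "-b"]) (auto simp: abs_le_iff, smt (verit))
  have "Inf (range h) \<le> h x \<and> h x \<le> Inf (range h) + osc h" for x
  proof
    show "Inf (range h) \<le> h x" using bb by (intro cInf_lower) auto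
    have "h x - osc h \<le> Inf (range h)"
    proof (rule cInf_greatest)
      fix z assume "z \<in> range h"
      then obtain y where "z = h y" by auto
      then show "h x - osc h \<le> z" using 1[of x y] by auto
    qed auto
    then show "h x \<le> Inf (range h) + osc h" by simp
  qed
  then show "osc_le h (osc h)" by (auto simp: osc_le_def)
qed

subsection \<open>Normalised weights\<close>

lemma nweight_nonneg: "(\<And>j. j \<in> {1..N} \<Longrightarrow> 0 \<le> w j) \<Longrightarrow> i \<in> {1..N} \<Longrightarrow> 0 \<le> nweight N w i"
  by (auto simp: nweight_def intro!: divide_nonneg_nonneg sum_nonneg)

lemma sum_nweight: "1 \<le> N \<Longrightarrow> (\<Sum>i=1..N. nweight N w i) = 1"
  by (cases "(\<Sum>j=1..N. w j) = 0") (simp_all add: nweight_def sum_divide_distrib[symmetric] del: One_nat_def)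

text \<open>The normalising constant cancels; the hypothesis rules out the uniform fallback in
  \<open>nweight\<close>.\<close>

lemma ratio_nweight:
  assumes "(\<Sum>j=1..N. w j) \<noteq> 0"
  shows "(\<Sum>i=1..N. nweight N w i * u i) / (\<Sum>i=1..N. nweight N w i * v i) =
    (\<Sum>i=1..N. w i * u i) / (\<Sum>i=1..N. w i * v i)"
  using assms by (simp add: nweight_def sum_divide_distrib[symmetric])

subsection \<open>Mixing models\<close>

text \<open>With the suprema replaced by fixed numbers, the later constants visibly depend on the
  model only. Taking \<open>th\<close> at least 1 is a normalisation that makes
  \<open>c1 \<le> c\<close>, so that initial sample and mutation steps share one lower
  bound.\<close>

locale mixing_smc =
  fixes S :: "('x::polish_space, 'y::polish_space) smc" and gmax th wmax \<sigma>m \<sigma>p c :: real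
  assumes model: "smc_model S"
    and g_pos: "\<And>t x. 0 < gt S t x" and g_le: "\<And>t x. gt S t x \<le> gmax"
    and th1: "1 \<le> th" and theta_le: "\<And>t x. 1 \<le> t \<Longrightarrow> theta S t x \<le> th"
    and weight0_le: "\<And>x. weight0 S x \<le> wmax"
    and weight_le: "\<And>t x x'. 1 \<le> t \<Longrightarrow> weight S t x x' \<le> wmax"
    and \<sigma>m: "0 < \<sigma>m" and mdens_bounds: "\<And>x x'. \<sigma>m \<le> mdens S x x' \<and> mdens S x x' \<le> \<sigma>p"
    and c: "0 < c" and c0: "c \<le> (\<integral>x. gt S 0 x \<partial>chi S)"
    and c_le: "\<And>t x. 1 \<le> t \<Longrightarrow> c \<le> (\<integral>x'. gt S t x' \<partial>Mker S x)"
begin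

abbreviation "\<kappa> \<equiv> \<sigma>m / \<sigma>p"

lemma \<kappa>_bounds: "0 < \<sigma>p" "0 < \<kappa>" "\<kappa> \<le> 1"
  using mdens_bounds[of undefined undefined] \<sigma>m by auto

lemma sets_nu [measurable_cong, simp]: "sets (nu S) = sets borel"
  and sets_chi [measurable_cong, simp]: "sets (chi S) = sets borel"
  and sets_rho0 [measurable_cong, simp]: "sets (rho0 S) = sets borel"
  and prob_chi: "prob_space (chi S)" and prob_rho0: "prob_space (rho0 S)"
  and mdens_measurable [measurable]: "(\<lambda>(x, x'). mdens S x x') \<in> borel_measurable (borel \<Otimes>\<^sub>M borel)"
  and prob_Mker: "prob_space (Mker S x)"
  and dchi_measurable [measurable]: "dchi S \<in> borel_measurable borel"
  and dchi_nonneg: "0 \<le> dchi S x"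
  and chi_eq: "chi S = density (rho0 S) (\<lambda>x. ennreal (dchi S x))"
  and theta_measurable [measurable]: "1 \<le> t \<Longrightarrow> theta S t \<in> borel_measurable borel"
  and theta_pos: "1 \<le> t \<Longrightarrow> 0 < theta S t x"
  and pdens_measurable [measurable]: "1 \<le> t \<Longrightarrow> (\<lambda>(x, x'). pdens S t x x') \<in> borel_measurable (borel \<Otimes>\<^sub>M borel)"
  and prob_Pker: "1 \<le> t \<Longrightarrow> prob_space (Pker S t x)"
  using model unfolding smc_model_def by blast+

text \<open>Positive transition density and likelihood make the support condition on the proposal
  apply everywhere, so the quotient in \<open>weight\<close> never divides by zero.\<close>

lemma pdens_pos: "1 \<le> t \<Longrightarrow> 0 < pdens S t x x'"
proof -
  assume t: "1 \<le> t"
  have "0 < mdens S x x' * gt S t x'"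
    using mdens_bounds[of x x'] \<sigma>m g_pos[of t x'] by (intro mult_pos_pos) auto
  then show ?thesis using model t unfolding smc_model_def by blast
qed

lemma space_nu [simp]: "space (nu S) = UNIV" and space_chi [simp]: "space (chi S) = UNIV"
  and space_rho0 [simp]: "space (rho0 S) = UNIV"
  using sets_eq_imp_space_eq[OF sets_nu] sets_eq_imp_space_eq[OF sets_chi]
    sets_eq_imp_space_eq[OF sets_rho0] by simp_all

lemma gt_measurable [measurable]: "gt S t \<in> borel_measurable borel"
proof -
  have "(\<lambda>(x, y). lik S x y) \<in> borel_measurable (borel \<Otimes>\<^sub>M borel)"
    using model unfolding smc_model_def by blast
  from measurable_Pair1[OF this, of "obs S t"] show ?thesis
    by (simp add: gt_def[abs_def])
qed

lemma mdens_measurable1 [measurable]: "mdens S x \<in> borel_measurable borel"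
  and mdens_measurable2 [measurable]: "(\<lambda>x'. mdens S x' x) \<in> borel_measurable borel"
  using measurable_Pair2[OF mdens_measurable, of x] measurable_Pair1[OF mdens_measurable, of x] by simp_all

lemma mdens_nonneg: "0 \<le> mdens S x x'"
  using mdens_bounds[of x x'] \<sigma>m by linarith

lemma sets_Mker [simp, measurable_cong]: "sets (Mker S x) = sets borel"
  by (simp add: Mker_def)

lemma space_Mker [simp]: "space (Mker S x) = UNIV"
  by (simp add: Mker_def)

text \<open>The lower bound \<sigma>m on a probability density leaves \<open>nu\<close> a mass of at
  most 1 / \<sigma>m.\<close>

lemma nu_finite: "finite_measure (nu S)"
proof
  have "ennreal \<sigma>m * emeasure (nu S) UNIV = (\<integral>\<^sup>+x'. ennreal \<sigma>m \<partial>nu S)"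
    by simp
  also have "\<dots> \<le> (\<integral>\<^sup>+x'. ennreal (mdens S undefined x') \<partial>nu S)"
    using mdens_bounds by (intro nn_integral_mono ennreal_leI) auto
  also have "\<dots> = emeasure (Mker S undefined) UNIV"
    by (simp add: Mker_def emeasure_density)
  also have "\<dots> = 1"
    using prob_space.emeasure_space_1[OF prob_Mker] by simp
  finally show "emeasure (nu S) (space (nu S)) \<noteq> \<infinity>"
    using \<sigma>m by (auto simp: ennreal_mult_top ennreal_one_neq_top top_unique)
qed

lemma integral_Mker:
  fixes f :: "'x \<Rightarrow> real"
  shows "f \<in> borel_measurable borel \<Longrightarrow> (\<integral>x'. f x' \<partial>Mker S x) = (\<integral>x'. mdens S x x' * f x' \<partial>nu S)"
  unfolding Mker_def by (subst integral_density) (auto simp: mdens_nonneg)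

lemma Mker_integral_measurable:
  fixes f :: "'x \<Rightarrow> real"
  assumes [measurable]: "f \<in> borel_measurable borel"
  shows "(\<lambda>x. \<integral>x'. f x' \<partial>Mker S x) \<in> borel_measurable borel"
proof -
  interpret finite_measure "nu S" by (rule nu_finite)
  have "(\<lambda>x. \<integral>x'. mdens S x x' * f x' \<partial>nu S) \<in> borel_measurable borel"
    by measurable
  then show ?thesis by (simp add: integral_Mker)
qed

text \<open>
  \<open>lh k t x\<close> is the likelihood of the observations at times \<open>t + 1, \<dots>, t + k\<close> given the state \<open>x\<close>
  at time \<open>t\<close>, and \<open>hs h s k t x\<close>, for \<open>t \<le> s \<le> t + k\<close>, is the conditional expectation of \<open>h\<close> at
  time \<open>s\<close> given in addition these observations.
\<close>

primrec lh :: "nat \<Rightarrow> nat \<Rightarrow> 'x \<Rightarrow> real" where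
  "lh 0 t x = 1"
| "lh (Suc k) t x = (\<integral>x'. gt S (Suc t) x' * lh k (Suc t) x' \<partial>Mker S x)"

primrec hs :: "('x \<Rightarrow> real) \<Rightarrow> nat \<Rightarrow> nat \<Rightarrow> nat \<Rightarrow> 'x \<Rightarrow> real" where
  "hs h s 0 t x = h x"
| "hs h s (Suc k) t x = (if s \<le> t then h x else
     (\<integral>x'. gt S (Suc t) x' * lh k (Suc t) x' * hs h s k (Suc t) x' \<partial>Mker S x) / lh (Suc k) t x)"

lemma lh_measurable [measurable]: "lh k t \<in> borel_measurable borel"
proof (induction k arbitrary: t)
  case 0
  have "lh 0 t = (\<lambda>_. 1)" by (rule ext) simp
  then show ?case by simp
next
  case (Suc k)
  note [measurable] = Suc
  have "(\<lambda>x. \<integral>x'. gt S (Suc t) x' * lh k (Suc t) x' \<partial>Mker S x) \<in> borel_measurable borel"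
    by (rule Mker_integral_measurable) measurable
  then show ?case by simp
qed

lemma hs_measurable [measurable]: "h \<in> borel_measurable borel \<Longrightarrow> hs h s k t \<in> borel_measurable borel"
proof (induction k arbitrary: t)
  case 0
  moreover have "hs h s 0 t = h" by (rule ext) simp
  ultimately show ?case by simp
next
  case (Suc k)
  note [measurable] = Suc.prems Suc.IH[OF Suc.prems]
  have "(\<lambda>x. \<integral>x'. gt S (Suc t) x' * lh k (Suc t) x' * hs h s k (Suc t) x' \<partial>Mker S x) \<in> borel_measurable borel"
    by (rule Mker_integral_measurable) measurable
  then have "(\<lambda>x. if s \<le> t then h x else
     (\<integral>x'. gt S (Suc t) x' * lh k (Suc t) x' * hs h s k (Suc t) x' \<partial>Mker S x) / lh (Suc k) t x) \<in> borel_measurable borel"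
    by (intro measurable_If borel_measurable_divide lh_measurable Suc) auto
  then show ?case by simp
qed

lemma gmax_pos: "0 < gmax" by (rule less_le_trans[OF g_pos g_le])

lemma Mker_integrable_bounded:
  fixes f :: "'x \<Rightarrow> real"
  assumes "f \<in> borel_measurable borel" "\<And>x. \<bar>f x\<bar> \<le> b"
  shows "integrable (Mker S y) f"
proof -
  interpret prob_space "Mker S y" by (rule prob_Mker)
  show ?thesis using assms by (intro integrable_const_bound[where B = b]) auto
qed

text \<open>These bounds degenerate geometrically in \<open>k\<close>. They provide positivity and
  integrability and enter none of the final constants; the uniform control is
  \<open>lh_ratio\<close>.\<close>

lemma lh_bounds: "c ^ k \<le> lh k t x" "lh k t x \<le> gmax ^ k"
proof (induction k arbitrary: t x)
  case (Suc k)
  have pos: "0 \<le> lh k t' y" for t' y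
    using c by (intro order_trans[OF _ Suc(1)]) simp
  have b: "gt S (Suc t) x' * lh k (Suc t) x' \<le> gmax ^ Suc k" "0 \<le> gt S (Suc t) x' * lh k (Suc t) x'" for t x'
  proof -
    show "0 \<le> gt S (Suc t) x' * lh k (Suc t) x'"
      using g_pos[of "Suc t" x'] pos by simp
    have "gt S (Suc t) x' * lh k (Suc t) x' \<le> gmax * gmax ^ k"
      by (rule mult_mono[OF g_le Suc(2) less_imp_le[OF gmax_pos] pos])
    then show "gt S (Suc t) x' * lh k (Suc t) x' \<le> gmax ^ Suc k" by simp
  qed
  have i: "integrable (Mker S x) (\<lambda>x'. gt S (Suc t) x' * lh k (Suc t) x')" for t x
    using b by (intro Mker_integrable_bounded[where b = "gmax ^ Suc k"]) auto
  have ig: "integrable (Mker S x) (\<lambda>x'. gt S (Suc t) x')" for t x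
    using g_le g_pos by (intro Mker_integrable_bounded[where b = "gmax"]) (auto simp: abs_of_pos)
  { case 1
    interpret prob_space "Mker S x" by (rule prob_Mker)
    have "c ^ Suc k \<le> (\<integral>x'. gt S (Suc t) x' \<partial>Mker S x) * c ^ k"
      using c_le[of "Suc t" x] c by (simp add: mult_right_mono)
    also have "\<dots> = (\<integral>x'. gt S (Suc t) x' * c ^ k \<partial>Mker S x)"
      by simp
    also have "\<dots> \<le> lh (Suc k) t x"
      unfolding lh.simps
    proof (rule integral_mono)
      show "integrable (Mker S x) (\<lambda>x'. gt S (Suc t) x' * c ^ k)" using ig by simp
      show "gt S (Suc t) x' * c ^ k \<le> gt S (Suc t) x' * lh k (Suc t) x'" for x'
        by (rule mult_left_mono[OF Suc(1) less_imp_le[OF g_pos]])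
    qed (fact i)
    finally show ?case .
  next
    case 2
    interpret prob_space "Mker S x" by (rule prob_Mker)
    show ?case unfolding lh.simps using i b(1) by (intro integral_le_const AE_I2) auto }
qed simp_all

lemma lh_pos: "0 < lh k t x"
  using c by (intro less_le_trans[OF _ lh_bounds(1)]) simp

section \<open>Forgetting of the exact dynamics\<close>

text \<open>Everything in \<open>lh\<close> and \<open>hs\<close> after the first transition, as a
  measure on the state at time \<open>t + 1\<close>. The current state then enters only through the
  weight \<open>mdens S x\<close>, which brings conditional expectations into the form of Doeblin's
  argument.\<close>

definition fut :: "nat \<Rightarrow> nat \<Rightarrow> 'x measure" where
  "fut k t = density (nu S) (\<lambda>x'. ennreal (gt S (Suc t) x' * lh k (Suc t) x'))"

lemma sets_fut [simp, measurable_cong]: "sets (fut k t) = sets borel"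
  and space_fut [simp]: "space (fut k t) = UNIV"
  by (simp_all add: fut_def)

lemma fut_weight_nonneg: "0 \<le> gt S (Suc t) x' * lh k (Suc t) x'"
  using g_pos[of "Suc t" x'] lh_pos[of k "Suc t" x'] by auto

lemma fut_finite: "finite_measure (fut k t)"
proof
  have "emeasure (fut k t) UNIV \<le> (\<integral>\<^sup>+x. ennreal (gmax * gmax ^ k) \<partial>nu S)"
    unfolding fut_def using g_le lh_bounds(2) gmax_pos lh_pos[THEN less_imp_le]
    by (simp add: emeasure_density del: nn_integral_const) (intro nn_integral_mono ennreal_leI mult_mono, auto)
  also have "\<dots> < \<infinity>"
    using finite_measure.emeasure_finite[OF nu_finite, of UNIV] by (simp add: ennreal_mult_less_top less_top)
  finally show "emeasure (fut k t) (space (fut k t)) \<noteq> \<infinity>" by simp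
qed

lemma integral_fut:
  fixes f :: "'x \<Rightarrow> real"
  assumes [measurable]: "f \<in> borel_measurable borel"
  shows "(\<integral>x'. mdens S x x' * f x' \<partial>fut k t) = (\<integral>x'. gt S (Suc t) x' * lh k (Suc t) x' * f x' \<partial>Mker S x)"
  unfolding fut_def using fut_weight_nonneg
  by (subst integral_density) (auto simp: integral_Mker mult_ac)

lemma fut_pos: "0 < measure (fut k t) UNIV"
proof -
  interpret finite_measure "fut k t" by (rule fut_finite)
  have "0 < lh (Suc k) t undefined" by (rule lh_pos)
  also have "lh (Suc k) t undefined = (\<integral>x'. mdens S undefined x' * 1 \<partial>fut k t)"
    by (subst integral_fut) simp_all
  also have "\<dots> \<le> (\<integral>x'. \<sigma>p \<partial>fut k t)"
    using mdens_bounds mdens_nonneg \<kappa>_bounds(1)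
    by (intro integral_mono integrable_const_bound[where B = \<sigma>p] AE_I2) auto
  also have "\<dots> = measure (fut k t) UNIV * \<sigma>p" by simp
  finally show ?thesis using \<kappa>_bounds(1) by (simp add: zero_less_mult_iff)
qed

lemma lh_Suc_eq: "lh (Suc k) t x = (\<integral>x'. mdens S x x' \<partial>fut k t)"
  using integral_fut[of "\<lambda>_. 1" k t x] by simp

lemma hs_Suc_eq:
  assumes "h \<in> borel_measurable borel" "t < s"
  shows "hs h s (Suc k) t x = (\<integral>x'. mdens S x x' * hs h s k (Suc t) x' \<partial>fut k t) / (\<integral>x'. mdens S x x' \<partial>fut k t)"
  using assms by (simp add: integral_fut lh_Suc_eq[symmetric])

text \<open>For \<open>k > 0\<close> both likelihoods are integrals of the transition density
  against the same measure \<open>fut\<close>, hence lie between \<sigma>m and \<sigma>p times its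
  mass, and the mass cancels.\<close>

lemma lh_ratio: "\<kappa> * lh k t y \<le> lh k t x"
proof (cases k)
  case 0
  then show ?thesis using \<kappa>_bounds by simp
next
  case (Suc j)
  interpret finite_measure "fut j t" by (rule fut_finite)
  have i: "integrable (fut j t) (mdens S x)" for x
    using mdens_bounds mdens_nonneg by (intro integrable_const_bound[where B = \<sigma>p]) auto
  have "lh k t y \<le> (\<integral>x'. \<sigma>p \<partial>fut j t)"
    unfolding Suc lh_Suc_eq using mdens_bounds by (intro integral_mono i) auto
  then have "\<sigma>m * lh k t y \<le> \<sigma>m * (\<sigma>p * measure (fut j t) UNIV)"
    using \<sigma>m by (intro mult_left_mono) (simp_all add: mult.commute)
  moreover have "(\<integral>x'. \<sigma>m \<partial>fut j t) \<le> lh k t x"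
    unfolding Suc lh_Suc_eq using mdens_bounds by (intro integral_mono i) auto
  then have "\<sigma>m * measure (fut j t) UNIV \<le> lh k t x" by (simp add: mult.commute)
  then have "\<sigma>p * (\<sigma>m * measure (fut j t) UNIV) \<le> \<sigma>p * lh k t x"
    using \<kappa>_bounds(1) by (intro mult_left_mono) auto
  ultimately have "\<sigma>m * lh k t y \<le> \<sigma>p * lh k t x" by (simp add: mult_ac)
  then show ?thesis using \<kappa>_bounds(1) by (simp add: field_simps)
qed

lemma hs_bounds:
  assumes h: "h \<in> borel_measurable borel" and lo: "\<And>x. lo \<le> h x \<and> h x \<le> lo + d"
  shows "lo \<le> hs h s k t x \<and> hs h s k t x \<le> lo + d"
proof (induction k arbitrary: t x)
  case (Suc k)
  show ?case
  proof (cases "s \<le> t")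
    case True
    then show ?thesis using lo by simp
  next
    case False
    then have ts: "t < s" by simp
    show ?thesis
      unfolding hs_Suc_eq[OF h ts]
      using weighted_mean_bounds(3,4)[OF fut_finite, of k t "mdens S x" "hs h s k (Suc t)" \<sigma>m \<sigma>p lo d]
        fut_pos h \<sigma>m mdens_bounds Suc by auto
  qed
qed (use lo in simp)

text \<open>Each of the \<open>s - t\<close> transitions between \<open>t\<close> and
  \<open>s\<close> is a weighted mean against \<open>fut\<close> and contributes a factor
  \<open>1 - \<kappa>\<close>. At time \<open>s\<close> the state is known and \<open>hs\<close> is
  \<open>h\<close> itself, which ends the recursion.\<close>

lemma hs_osc:
  assumes h: "h \<in> borel_measurable borel" and hd: "osc_le h d"
  shows "t \<le> s \<Longrightarrow> s \<le> t + k \<Longrightarrow> osc_le (hs h s k t) ((1 - \<kappa>) ^ (s - t) * d)"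
proof (induction k arbitrary: t)
  case 0
  moreover have "hs h s 0 t = h" by (rule ext) simp
  ultimately show ?case using hd by simp
next
  case (Suc k)
  show ?case
  proof (cases "s = t")
    case True
    moreover have "hs h s (Suc k) t = h" using True by (intro ext) simp
    ultimately show ?thesis using hd by simp
  next
    case False
    then have ts: "t < s" using Suc.prems by simp
    have "osc_le (hs h s k (Suc t)) ((1 - \<kappa>) ^ (s - Suc t) * d)"
      using Suc.prems ts by (intro Suc.IH) auto
    then have "osc_le (hs h s (Suc k) t) ((1 - \<kappa>) * ((1 - \<kappa>) ^ (s - Suc t) * d))"
      unfolding hs_Suc_eq[OF h ts, abs_def]
      using fut_finite fut_pos h \<sigma>m mdens_bounds by (intro osc_le_weighted_mean) auto
    moreover have "s - t = Suc (s - Suc t)" using ts by simp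
    ultimately show ?thesis by (simp add: mult.assoc del: hs.simps)
  qed
qed

section \<open>The smoothing distribution through future likelihoods\<close>

lemma path_int_one: "path_int S (\<lambda>_. 1) k t x = gt S t (x t) * lh k t (x t)"
  by (induction k arbitrary: t x) simp_all

lemma path_int_past: "s \<le> t \<Longrightarrow> path_int S (\<lambda>x. h (x s)) k t x = gt S t (x t) * lh k t (x t) * h (x s)"
proof (induction k arbitrary: t x)
  case (Suc k)
  have "path_int S (\<lambda>x. h (x s)) (Suc k) t x =
      gt S t (x t) * (\<integral>x'. gt S (Suc t) x' * lh k (Suc t) x' * h (x s) \<partial>Mker S (x t))"
    using Suc.prems by (simp add: Suc.IH)
  then show ?case by simp
qed simp

text \<open>Multiplication by \<open>lh\<close> clears the denominator of \<open>hs\<close>, and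
  what is left obeys the recursion of \<open>path_int\<close>. From time \<open>s\<close> on,
  \<open>h (x s)\<close> is a constant that leaves the integrals
  (\<open>path_int_past\<close>).\<close>

lemma path_int_hs:
  "t \<le> s \<Longrightarrow> s \<le> t + k \<Longrightarrow>
    path_int S (\<lambda>x. h (x s)) k t x = gt S t (x t) * (lh k t (x t) * hs h s k t (x t))"
proof (induction k arbitrary: t x)
  case (Suc k)
  show ?case
  proof (cases "s = t")
    case True
    then show ?thesis by (subst path_int_past) simp_all
  next
    case False
    then have ts: "t < s" using Suc.prems by simp
    have "path_int S (\<lambda>x. h (x s)) (Suc k) t x =
        gt S t (x t) * (\<integral>x'. gt S (Suc t) x' * lh k (Suc t) x' * hs h s k (Suc t) x' \<partial>Mker S (x t))"
      using ts Suc.prems by (simp add: Suc.IH mult.assoc)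
    then show ?thesis
      using ts lh_pos[of "Suc k" t "x t"] by simp
  qed
qed simp

lemma marg_smooth_eq:
  assumes "s \<le> T"
  shows "marg_smooth S s T h =
    (\<integral>x. gt S 0 x * (lh T 0 x * hs h s T 0 x) \<partial>chi S) / (\<integral>x. gt S 0 x * lh T 0 x \<partial>chi S)"
  using assms
  by (simp add: marg_smooth_def joint_smooth_def smooth_unnorm_def path_int_hs path_int_one)

text \<open>Normalised at a fixed reference point, so that both bounds depend on \<open>\<kappa>\<close> only.\<close>

definition bt :: "nat \<Rightarrow> nat \<Rightarrow> 'x \<Rightarrow> real" where
  "bt T t x = lh (T - t) t x / lh (T - t) t undefined"

lemma bt_measurable [measurable]: "bt T t \<in> borel_measurable borel"
  unfolding bt_def[abs_def] by measurable

lemma bt_bounds: "\<kappa> \<le> bt T t x" "bt T t x \<le> 1 / \<kappa>" "0 < bt T t x"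
proof -
  show "\<kappa> \<le> bt T t x"
    using lh_ratio[of "T - t" t undefined x] lh_pos[of "T - t" t undefined]
    unfolding bt_def by (simp add: pos_le_divide_eq)
  then show "0 < bt T t x" using \<kappa>_bounds(2) by linarith
  show "bt T t x \<le> 1 / \<kappa>"
    using lh_ratio[of "T - t" t x undefined] lh_pos[of "T - t" t undefined] \<kappa>_bounds
    unfolding bt_def by (simp add: field_simps)
qed

lemma bt_T: "bt T T x = 1" by (simp add: bt_def)

lemma weight_pos: "1 \<le> t \<Longrightarrow> 0 < weight S t x x'"
  using mdens_bounds[of x x'] \<sigma>m g_pos[of t x'] theta_pos[of t x] pdens_pos[of t x x']
  by (auto simp: weight_def intro!: divide_pos_pos mult_pos_pos)

lemma weight0_nonneg: "0 \<le> weight0 S x"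
  using dchi_nonneg g_pos[of 0 x] by (simp add: weight0_def)

lemma wmax_pos: "0 < wmax"
  using weight_pos[of 1 undefined undefined] weight_le[of 1 undefined undefined] by simp

text \<open>Bounds for the weight that is averaged, the importance weight times \<open>bt\<close>.
  Its conditional mean is at least \<open>c1\<close>: the factor \<kappa> bounds \<open>bt\<close>
  from below, \<open>c\<close> the mean likelihood, and \<open>th\<close> the division by
  \<open>theta\<close>. Its values are at most \<open>w1\<close>, with 1 / \<kappa> from
  \<open>bt\<close>.\<close>

abbreviation "c1 \<equiv> \<kappa> * c / th"
abbreviation "w1 \<equiv> wmax / \<kappa>"

lemma c1_bounds: "0 < c1" "c1 \<le> c" "c1 \<le> \<kappa> * c"
proof -
  show "0 < c1" using th1 by (intro divide_pos_pos mult_pos_pos \<kappa>_bounds(2) c) simp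
  have "\<kappa> * c * 1 \<le> \<kappa> * c * th" using mult_pos_pos[OF \<kappa>_bounds(2) c] th1 by (intro mult_left_mono) linarith+
  moreover have "0 < th" using th1 by simp
  ultimately show 1: "c1 \<le> \<kappa> * c" by (simp only: pos_divide_le_eq mult_1_right)
  have "\<kappa> * c \<le> 1 * c" using \<kappa>_bounds(3) c by (intro mult_right_mono) auto
  then show "c1 \<le> c" using 1 by linarith
qed

lemma w1_bounds: "0 < w1" "wmax \<le> w1"
proof -
  show "0 < w1" by (rule divide_pos_pos[OF wmax_pos \<kappa>_bounds(2)])
  have "wmax * \<kappa> \<le> wmax * 1" using wmax_pos \<kappa>_bounds(3) by (intro mult_left_mono) auto
  then show "wmax \<le> w1" using \<kappa>_bounds(2) by (simp only: pos_le_divide_eq mult_1_right)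
qed

text \<open>
  Oscillations decay like \<open>rr ^ (2 * \<bar>t - s\<bar>)\<close>, while only the part \<open>\<kappa>0 * rr ^ \<bar>t - s\<bar> * \<epsilon>\<close> of the deviation
  is allotted to time \<open>t\<close>; these parts add up to at most \<open>\<epsilon>\<close>.
\<close>

abbreviation "rr \<equiv> 1 - \<kappa> / 2"
abbreviation "\<kappa>0 \<equiv> (1 - rr) / 2"
text \<open>Put the allotment \<open>\<kappa>0 * rr ^ n * \<epsilon>\<close> and the oscillation
  \<open>rr ^ (2 * n) * d\<close> at lag \<open>n\<close> into the exponent of the one-step bound:
  the result is \<open>C0\<close> times \<open>N * \<epsilon>\<^sup>2 / d\<^sup>2\<close> times
  \<open>(1 / rr\<^sup>2) ^ n\<close>. In \<open>B0\<close>, \<open>exp 1\<close> covers exponents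
  below 1, the summand 1 the vanishing initial weights, and 6 is 3 from the one-step bound times 2
  from the lags on both sides of \<open>s\<close>.\<close>

abbreviation "C0 \<equiv> c1\<^sup>2 * \<kappa>0\<^sup>2 / (8 * w1\<^sup>2)"
abbreviation "B0 \<equiv> exp 1 + 1 + 6 / (1 - exp (1 - 1 / rr\<^sup>2))"

lemma rr_bounds: "0 < rr" "rr < 1" "1 - \<kappa> \<le> rr\<^sup>2"
proof -
  have gen: "0 < 1 - k / 2 \<and> 1 - k / 2 < 1 \<and> 1 - k \<le> (1 - k / 2)\<^sup>2" if "0 < k" "k \<le> 1" for k :: real
    using that by (simp add: power2_diff)
  from gen[OF \<kappa>_bounds(2,3)] show "0 < rr" "rr < 1" "1 - \<kappa> \<le> rr\<^sup>2" by blast+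
qed

lemma \<kappa>0_bounds: "0 < \<kappa>0" "\<kappa>0 \<le> 1"
proof -
  have gen: "0 < (1 - (1 - k / 2)) / 2 \<and> (1 - (1 - k / 2)) / 2 \<le> 1" if "0 < k" "k \<le> 1" for k :: real
    using that by simp
  from gen[OF \<kappa>_bounds(2,3)] show "0 < \<kappa>0" "\<kappa>0 \<le> 1" by blast+
qed

lemma C0_pos: "0 < C0"
  by (rule divide_pos_pos[OF mult_pos_pos[OF zero_less_power[OF c1_bounds(1)] zero_less_power[OF \<kappa>0_bounds(1)]]
        mult_pos_pos[OF _ zero_less_power[OF w1_bounds(1)]]]) simp

lemma B0_bounds: "1 \<le> B0" "exp 1 \<le> B0" "1 + 6 / (1 - exp (1 - 1 / rr\<^sup>2)) \<le> B0"
proof -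
  have r2: "0 < rr\<^sup>2" "rr\<^sup>2 < 1" using rr_bounds by (auto simp: power_less_one_iff)
  then have "1 < 1 / rr\<^sup>2" by (simp only: less_divide_eq_1_pos)
  then have "exp (1 - 1 / rr\<^sup>2) < 1" by simp
  then have "0 < 6 / (1 - exp (1 - 1 / rr\<^sup>2))" by (intro divide_pos_pos) linarith+
  then show "1 \<le> B0" "exp 1 \<le> B0" "1 + 6 / (1 - exp (1 - 1 / rr\<^sup>2)) \<le> B0"
    using exp_gt_zero[of 1] by linarith+
qed

text \<open>For FFBSi the deviation is halved: this turns \<open>C0\<close> into
  \<open>C0 / 4\<close> and gives Hoeffding's exponent the factor 1 / 2. The additional 3 is 1 for
  vanishing initial weights plus 2 for the two-sided Hoeffding bound.\<close>

abbreviation "C1 \<equiv> min (C0 / 4) (1 / 2)"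
abbreviation "B1 \<equiv> B0 + 3"

lemma C1_bounds: "0 < C1" "C1 \<le> C0" "C1 \<le> C0 / 4" "C1 \<le> 1 / 2"
proof -
  have gen: "0 < min (x / 4) (1 / 2) \<and> min (x / 4) (1 / 2) \<le> x" if "0 < x" for x :: real
    using that by (simp add: min_le_iff_disj)
  from gen[OF C0_pos] show "0 < C1" "C1 \<le> C0" by blast+
qed (rule min.cobounded1 min.cobounded2)+

end

subsection \<open>Structure of the particle filter\<close>

text \<open>The null set in \<open>cond_iid\<close> may depend on the sets \<open>D\<close>.
  Integration over an event of \<open>F\<close> removes it, and this integrated form is the axiom
  \<open>law\<close> of the abstract setting.\<close>

lemma cond_iid_emeasure:
  assumes "prob_space P" and sub: "subalgebra P F" and A: "finite A" and ci: "cond_iid P F A E Z K"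
    and K: "\<And>\<omega>. \<omega> \<in> space P \<Longrightarrow> prob_space (K \<omega>)"
    and G: "G \<in> sets F" and D: "\<And>i. i \<in> A \<Longrightarrow> D i \<in> sets E"
  shows "emeasure P {\<omega> \<in> G. \<forall>i\<in>A. Z i \<omega> \<in> D i} =
      (\<integral>\<^sup>+\<omega>. indicator G \<omega> * (\<Prod>i\<in>A. emeasure (K \<omega>) (D i)) \<partial>P)"
proof -
  interpret P: prob_space P by fact
  interpret finite_measure_subalgebra P F by unfold_locales (rule sub)
  define B where "B = {\<omega> \<in> space P. \<forall>i\<in>A. Z i \<omega> \<in> D i}"
  have Zm [measurable]: "Z i \<in> measurable P E" if "i \<in> A" for i
    using ci that by (simp add: cond_iid_def)
  note [measurable] = D
  have B [measurable]: "B \<in> sets P"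
    unfolding B_def using A by measurable
  have GP [measurable]: "G \<in> sets P" using G sub by (auto simp: subalgebra_def)
  have iB: "integrable P (indicator B :: _ \<Rightarrow> real)"
    using B by (intro integrable_real_indicator) (simp_all add: P.emeasure_eq_measure)
  have ae: "AE \<omega> in P. real_cond_exp P F (indicator B) \<omega> = (\<Prod>i\<in>A. measure (K \<omega>) (D i))"
    using ci D unfolding cond_iid_def B_def by blast
  have "{\<omega> \<in> G. \<forall>i\<in>A. Z i \<omega> \<in> D i} = G \<inter> B"
    using sets.sets_into_space[OF GP] by (auto simp: B_def)
  then have "emeasure P {\<omega> \<in> G. \<forall>i\<in>A. Z i \<omega> \<in> D i} = ennreal (measure P (G \<inter> B))"
    by (simp add: P.emeasure_eq_measure)
  also have "measure P (G \<inter> B) = (\<integral>\<omega>\<in>G. indicator B \<omega> \<partial>P)"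
    by (simp add: set_lebesgue_integral_def indicator_inter_arith[symmetric] Int_commute)
  also have "\<dots> = (\<integral>\<omega>\<in>G. real_cond_exp P F (indicator B) \<omega> \<partial>P)"
    by (rule real_cond_exp_intA[OF iB G])
  also have "ennreal \<dots> = (\<integral>\<^sup>+\<omega>. ennreal (indicator G \<omega> * real_cond_exp P F (indicator B) \<omega>) \<partial>P)"
    unfolding set_lebesgue_integral_def real_scaleR_def
  proof (rule nn_integral_eq_integral[symmetric])
    show "integrable P (\<lambda>\<omega>. indicator G \<omega> * real_cond_exp P F (indicator B) \<omega>)"
      using integrable_mult_indicator[OF GP real_cond_exp_int(1)[OF iB]] by simp
    show "AE \<omega> in P. 0 \<le> indicator G \<omega> * real_cond_exp P F (indicator B) \<omega>"
      using ae by eventually_elim (auto intro!: mult_nonneg_nonneg prod_nonneg)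
  qed
  also have "\<dots> = (\<integral>\<^sup>+\<omega>. indicator G \<omega> * (\<Prod>i\<in>A. emeasure (K \<omega>) (D i)) \<partial>P)"
  proof (rule nn_integral_cong_AE)
    show "AE \<omega> in P. ennreal (indicator G \<omega> * real_cond_exp P F (indicator B) \<omega>) =
        indicator G \<omega> * (\<Prod>i\<in>A. emeasure (K \<omega>) (D i))"
      using ae AE_space
    proof eventually_elim
      case (elim \<omega>)
      interpret Kw: prob_space "K \<omega>" by (rule K[OF elim(2)])
      show ?case
        using elim by (auto simp: Kw.emeasure_eq_measure prod_ennreal indicator_def)
    qed
  qed
  finally show ?thesis .
qed

lemma measurable_count_pair:
  fixes f :: "nat \<Rightarrow> 'w \<Rightarrow> 'x \<Rightarrow> real"
  assumes f: "\<And>j. j \<in> J \<Longrightarrow> (\<lambda>(\<omega>, x). f j \<omega> x) \<in> borel_measurable (F \<Otimes>\<^sub>M M)" and J: "countable J"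
  shows "(\<lambda>(\<omega>, p). f (fst p) \<omega> (snd p)) \<in> borel_measurable (F \<Otimes>\<^sub>M (count_space J \<Otimes>\<^sub>M M))"
proof -
  have "(\<lambda>q. f j (fst q) (snd (snd q))) \<in> borel_measurable (F \<Otimes>\<^sub>M (count_space J \<Otimes>\<^sub>M M))" if "j \<in> J" for j
  proof -
    have "(\<lambda>q. (fst q, snd (snd q))) \<in> measurable (F \<Otimes>\<^sub>M (count_space J \<Otimes>\<^sub>M M)) (F \<Otimes>\<^sub>M M)"
      by measurable
    from measurable_compose[OF this f[OF that]] show ?thesis by simp
  qed
  note 1 = this
  have 2: "(\<lambda>q. fst (snd q)) \<in> measurable (F \<Otimes>\<^sub>M (count_space J \<Otimes>\<^sub>M M)) (count_space J)"
    by measurable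
  from measurable_compose_countable'[where f = "\<lambda>j q. f j (fst q) (snd (snd q))", OF 1 2 J]
  show ?thesis by (simp add: split_beta')
qed

locale mixing_filter = mixing_smc S gmax th wmax \<sigma>m \<sigma>p c
  for S :: "('x::polish_space, 'y::polish_space) smc" and gmax th wmax \<sigma>m \<sigma>p c :: real +
  fixes N :: nat and P :: "'w measure" and \<xi> :: "nat \<Rightarrow> nat \<Rightarrow> 'w \<Rightarrow> 'x" and I :: "nat \<Rightarrow> nat \<Rightarrow> 'w \<Rightarrow> nat"
  assumes N1: "1 \<le> N" and filter: "particle_filter S N P \<xi> I"
begin

sublocale prob_space P
  using filter by (simp add: particle_filter_def)

abbreviation "\<phi>N \<equiv> filter_measure S N \<xi> I"
abbreviation "pw \<equiv> pweight S \<xi> I"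
abbreviation "F \<equiv> history S N P \<xi> I"
abbreviation "nwt t i \<omega> \<equiv> nweight N (\<lambda>k. pw t k \<omega>) i"

lemma pw_nonneg: "0 \<le> pw t i \<omega>"
  using weight_pos[of t] weight0_nonneg by (auto simp: pweight_def intro: less_imp_le)

lemma nwt_nonneg: "i \<in> {1..N} \<Longrightarrow> 0 \<le> nwt t i \<omega>"
  by (rule nweight_nonneg) (simp_all add: pw_nonneg)

lemma pdens_measurable_raw [measurable (raw)]:
  "1 \<le> t \<Longrightarrow> a \<in> measurable M borel \<Longrightarrow> b \<in> measurable M borel \<Longrightarrow>
    (\<lambda>p. pdens S t (a p) (b p)) \<in> borel_measurable M"
  using measurable_compose[OF measurable_Pair[of a M borel b borel] pdens_measurable[of t]] by simp

lemma mdens_measurable_raw [measurable (raw)]: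
  "a \<in> measurable M borel \<Longrightarrow> b \<in> measurable M borel \<Longrightarrow>
    (\<lambda>p. mdens S (a p) (b p)) \<in> borel_measurable M"
  using measurable_compose[OF measurable_Pair[of a M borel b borel] mdens_measurable] by simp

lemma weight_measurable_raw [measurable (raw)]:
  assumes t: "1 \<le> t" and [measurable]: "a \<in> measurable M borel" "b \<in> measurable M borel"
  shows "(\<lambda>p. weight S t (a p) (b p)) \<in> borel_measurable M"
  using t theta_measurable[OF t]
  unfolding weight_def by measurable

lemma weight0_measurable [measurable]: "weight0 S \<in> borel_measurable borel"
  unfolding weight0_def[abs_def] by measurable

lemma mutation_measurable:
  assumes "1 \<le> t" "i \<in> {1..N}"
  shows "\<xi> t i \<in> measurable P borel" "I t i \<in> measurable P (count_space {1..N})"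
proof -
  have "(\<lambda>\<omega>. (I t i \<omega>, \<xi> t i \<omega>)) \<in> measurable P (count_space {1..N} \<Otimes>\<^sub>M borel)"
    using filter assms unfolding particle_filter_def cond_iid_def by blast
  from measurable_compose[OF this measurable_snd] measurable_compose[OF this measurable_fst]
  show "\<xi> t i \<in> measurable P borel" "I t i \<in> measurable P (count_space {1..N})" by simp_all
qed

lemma xi_measurable [measurable]: "i \<in> {1..N} \<Longrightarrow> \<xi> t i \<in> measurable P borel"
proof (cases "t = 0")
  case True
  assume "i \<in> {1..N}"
  then show ?thesis
    using filter True unfolding particle_filter_def by (auto simp: indep_vars_def)
qed (use mutation_measurable in auto)

lemma pw_measurable [measurable]:
  assumes i: "i \<in> {1..N}" shows "pw t i \<in> borel_measurable P"
proof (cases "t = 0")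
  case True
  then have "pw t i = (\<lambda>\<omega>. weight0 S (\<xi> 0 i \<omega>))" by (simp add: pweight_def[abs_def])
  then show ?thesis using i by simp
next
  case False
  then have t: "1 \<le> t" by simp
  have "(\<lambda>\<omega>. \<xi> (t - 1) (I t i \<omega>) \<omega>) \<in> measurable P borel"
    by (rule measurable_compose_countable'[where f = "\<xi> (t - 1)" and I = "{1..N}",
          OF xi_measurable mutation_measurable(2)[OF t i]]) simp_all
  then have "(\<lambda>\<omega>. weight S t (\<xi> (t - 1) (I t i \<omega>) \<omega>) (\<xi> t i \<omega>)) \<in> borel_measurable P"
    using t i by measurable
  then show ?thesis using False by (simp add: pweight_def[abs_def])
qed

lemma history_map_measurable:
  "(\<lambda>\<omega>. \<lambda>(u, i)\<in>{..t} \<times> {1..N}. (\<xi> u i \<omega>, pw u i \<omega>))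
    \<in> measurable P (PiM ({..t} \<times> {1..N}) (\<lambda>_. borel \<Otimes>\<^sub>M borel))"
  by (rule measurable_restrict) auto

lemma sub_history: "subalgebra P (F t)"
  unfolding subalgebra_def
proof
  show "space (F t) = space P" by (simp add: history_def)
  show "sets (F t) \<subseteq> sets P"
    unfolding history_def
    using measurable_space[OF history_map_measurable] measurable_sets[OF history_map_measurable]
    by (subst sets_vimage_algebra2) auto
qed

lemma history_measurable:
  assumes "u \<le> t" "i \<in> {1..N}"
  shows "\<xi> u i \<in> measurable (F t) borel" "pw u i \<in> borel_measurable (F t)"
proof -
  let ?h = "\<lambda>\<omega>. \<lambda>(u, i)\<in>{..t} \<times> {1..N}. (\<xi> u i \<omega>, pw u i \<omega>)"
  have ui: "(u, i) \<in> {..t} \<times> {1..N}" using assms by auto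
  have "?h \<in> measurable (F t) (PiM ({..t} \<times> {1..N}) (\<lambda>_. borel \<Otimes>\<^sub>M borel))"
    unfolding history_def
    by (rule measurable_vimage_algebra1) (use measurable_space[OF history_map_measurable] in blast)
  from measurable_compose[OF this measurable_component_singleton[OF ui]]
  have "(\<lambda>\<omega>. (\<xi> u i \<omega>, pw u i \<omega>)) \<in> measurable (F t) (borel \<Otimes>\<^sub>M borel)"
    using ui by simp
  from measurable_compose[OF this measurable_fst] measurable_compose[OF this measurable_snd]
  show "\<xi> u i \<in> measurable (F t) borel" "pw u i \<in> borel_measurable (F t)" by simp_all
qed

lemma nweight_measurable:
  assumes w: "\<And>k. k \<in> {1..N} \<Longrightarrow> (\<lambda>\<omega>. w \<omega> k) \<in> borel_measurable M" and i: "i \<in> {1..N}"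
  shows "(\<lambda>\<omega>. nweight N (w \<omega>) i) \<in> borel_measurable M"
proof -
  have [measurable]: "(\<lambda>\<omega>. \<Sum>j=1..N. w \<omega> j) \<in> borel_measurable M"
    using w by (intro borel_measurable_sum) auto
  have [measurable]: "(\<lambda>\<omega>. w \<omega> i) \<in> borel_measurable M" using w i by auto
  show ?thesis unfolding nweight_def by measurable
qed

lemma filter_measure_facts:
  shows sets_filter [simp, measurable_cong]: "sets (\<phi>N t \<omega>) = sets borel"
    and space_filter [simp]: "space (\<phi>N t \<omega>) = UNIV"
    and prob_filter: "prob_space (\<phi>N t \<omega>)"
proof -
  show "sets (\<phi>N t \<omega>) = sets borel" "space (\<phi>N t \<omega>) = UNIV"
    by (simp_all add: filter_measure_def)
  let ?p = "point_measure {1..N} (\<lambda>i. ennreal (nwt t i \<omega>))"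
  have "prob_space ?p"
  proof
    have "emeasure ?p (space ?p) = (\<Sum>i=1..N. ennreal (nwt t i \<omega>))"
      unfolding space_point_measure by (subst emeasure_point_measure_finite) auto
    also have "\<dots> = ennreal (\<Sum>i=1..N. nwt t i \<omega>)"
      using nwt_nonneg by (intro sum_ennreal) auto
    finally show "emeasure ?p (space ?p) = 1"
      using N1 by (simp only: sum_nweight ennreal_1)
  qed
  then show "prob_space (\<phi>N t \<omega>)"
    unfolding filter_measure_def
    by (rule prob_space.prob_space_distr) (simp add: measurable_def space_point_measure sets_point_measure)
qed

lemma integral_filter:
  fixes f :: "'x \<Rightarrow> real"
  assumes "f \<in> borel_measurable borel"
  shows "(\<integral>x. f x \<partial>\<phi>N t \<omega>) = (\<Sum>i=1..N. nwt t i \<omega> * f (\<xi> t i \<omega>))"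
proof -
  have "(\<lambda>i. \<xi> t i \<omega>) \<in> measurable (point_measure {1..N} (\<lambda>i. ennreal (nwt t i \<omega>))) borel"
    by (simp add: measurable_def space_point_measure sets_point_measure)
  then show ?thesis
    unfolding filter_measure_def
    by (subst integral_distr[OF _ assms], assumption, subst lebesgue_integral_point_measure_finite)
      (auto simp del: atLeastAtMost_iff intro: nwt_nonneg)
qed

subsection \<open>Backward kernels of the filter\<close>

abbreviation "bk s k h \<omega> \<equiv> backward S (\<lambda>t. \<phi>N t \<omega>) s k h"

lemma bk_measurable_section [measurable]:
  "h \<in> borel_measurable borel \<Longrightarrow> bk s k h \<omega> \<in> borel_measurable borel"
proof (induction k)
  case 0
  moreover have "bk s 0 h \<omega> = h" by (rule ext) simp
  ultimately show ?case by simp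
next
  case (Suc k)
  note [measurable] = Suc.IH[OF Suc.prems]
  interpret \<eta>: prob_space "\<phi>N (s + k) \<omega>" by (rule prob_filter)
  have "bk s (Suc k) h \<omega> = (\<lambda>x. (\<integral>x'. mdens S x' x * bk s k h \<omega> x' \<partial>\<phi>N (s + k) \<omega>)
      / (\<integral>x'. mdens S x' x \<partial>\<phi>N (s + k) \<omega>))"
    by (rule ext) (simp add: Bker_def)
  also have "\<dots> \<in> borel_measurable borel" by measurable
  finally show ?case .
qed

lemma bk_Suc:
  assumes "h \<in> borel_measurable borel"
  shows "bk s (Suc k) h \<omega> x =
    (\<Sum>i=1..N. nwt (s + k) i \<omega> * (mdens S (\<xi> (s + k) i \<omega>) x * bk s k h \<omega> (\<xi> (s + k) i \<omega>))) /
    (\<Sum>i=1..N. nwt (s + k) i \<omega> * mdens S (\<xi> (s + k) i \<omega>) x)"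
  using assms by (simp add: Bker_def integral_filter)

text \<open>The \<open>k\<close> backward steps down to \<open>s\<close> use the filters at times
  \<open>s\<close> to \<open>s + k - 1\<close> only. The function averaged at time
  \<open>t + 1\<close> is therefore determined by the history up to \<open>t\<close>, which makes
  conditional Hoeffding bounds applicable to it.\<close>

lemma bk_measurable:
  assumes h: "h \<in> borel_measurable borel"
  shows "(\<And>u i. u < s + k \<Longrightarrow> i \<in> {1..N} \<Longrightarrow> \<xi> u i \<in> measurable M borel \<and> pw u i \<in> borel_measurable M) \<Longrightarrow>
    (\<lambda>(\<omega>, x). bk s k h \<omega> x) \<in> borel_measurable (M \<Otimes>\<^sub>M borel)"
proof (induction k)
  case 0
  then show ?case using h by (simp add: split_beta')
next
  case (Suc k)
  have IH: "(\<lambda>(\<omega>, x). bk s k h \<omega> x) \<in> borel_measurable (M \<Otimes>\<^sub>M borel)"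
    using Suc by simp
  have [measurable]: "\<xi> (s + k) i \<in> measurable M borel" if "i \<in> {1..N}" for i
    using Suc.prems[of "s + k" i] that by simp
  have [measurable]: "(\<lambda>\<omega>. nwt (s + k) i \<omega>) \<in> borel_measurable M" if "i \<in> {1..N}" for i
    using Suc.prems[of "s + k"] that by (intro nweight_measurable) auto
  have "(\<lambda>\<omega>. bk s k h \<omega> (\<xi> (s + k) i \<omega>)) \<in> borel_measurable M" if "i \<in> {1..N}" for i
    using measurable_compose[OF measurable_Pair[OF measurable_ident_sets[OF refl]] IH, of "\<xi> (s + k) i"] that by simp
  note [measurable] = this
  show ?case
    unfolding bk_Suc[OF h] split_beta' by measurable
qed

lemma bk_bounds:
  assumes h: "h \<in> borel_measurable borel" and lo: "\<And>x. lo \<le> h x \<and> h x \<le> lo + d"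
  shows "lo \<le> bk s k h \<omega> x \<and> bk s k h \<omega> x \<le> lo + d"
proof (induction k arbitrary: x)
  case (Suc k)
  interpret \<eta>: prob_space "\<phi>N (s + k) \<omega>" by (rule prob_filter)
  show ?case
    using weighted_mean_bounds(3,4)[OF \<eta>.finite_measure_axioms, of "\<lambda>x'. mdens S x' x" "bk s k h \<omega>" \<sigma>m \<sigma>p lo d]
      \<eta>.prob_space h \<sigma>m mdens_bounds Suc by (simp add: Bker_def)
qed (use lo in simp)

text \<open>Valid for every realisation: \<open>filter_measure\<close> is always a probability
  measure, and a backward step is a weighted mean whose weights are bounded by \<sigma>m and
  \<sigma>p.\<close>

lemma bk_osc:
  assumes h: "h \<in> borel_measurable borel" and hd: "osc_le h d"
  shows "osc_le (bk s k h \<omega>) ((1 - \<kappa>) ^ k * d)"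
proof (induction k)
  case 0
  moreover have "bk s 0 h \<omega> = h" by (rule ext) simp
  ultimately show ?case using hd by simp
next
  case (Suc k)
  interpret \<eta>: prob_space "\<phi>N (s + k) \<omega>" by (rule prob_filter)
  have "osc_le (\<lambda>x. (\<integral>x'. mdens S x' x * bk s k h \<omega> x' \<partial>\<phi>N (s + k) \<omega>)
      / (\<integral>x'. mdens S x' x \<partial>\<phi>N (s + k) \<omega>)) ((1 - \<kappa>) * ((1 - \<kappa>) ^ k * d))"
    using \<eta>.prob_space h \<sigma>m mdens_bounds Suc
    by (intro osc_le_weighted_mean \<eta>.finite_measure_axioms) auto
  moreover have "bk s (Suc k) h \<omega> = (\<lambda>x. (\<integral>x'. mdens S x' x * bk s k h \<omega> x' \<partial>\<phi>N (s + k) \<omega>)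
      / (\<integral>x'. mdens S x' x \<partial>\<phi>N (s + k) \<omega>))"
    by (rule ext) (simp add: Bker_def)
  ultimately show ?case by (simp add: mult.assoc del: backward.simps)
qed

declare One_nat_def [simp del]

subsection \<open>One step of the filter\<close>

abbreviation "nwth t j \<omega> \<equiv> nweight N (\<lambda>k. pw t k \<omega> * theta S (Suc t) (\<xi> t k \<omega>)) j"

text \<open>Against the fixed measure \<open>E0\<close> all randomness of the mutation law sits in
  the density.\<close>

definition mut_dens :: "nat \<Rightarrow> 'w \<Rightarrow> nat \<times> 'x \<Rightarrow> real" where
  "mut_dens t \<omega> e = nwth t (fst e) \<omega> * pdens S (Suc t) (\<xi> t (fst e) \<omega>) (snd e)"

abbreviation "E0 \<equiv> count_space {1..N} \<Otimes>\<^sub>M nu S"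
abbreviation "Kmut t \<omega> \<equiv> density E0 (\<lambda>e. ennreal (mut_dens t \<omega> e))"

lemma sets_E0: "sets E0 = sets (count_space {1..N} \<Otimes>\<^sub>M borel)"
  by (intro sets_pair_measure_cong) simp_all

lemma mutation_law_eq: "mutation_law S N \<xi> I (Suc t) \<omega> = Kmut t \<omega>"
  by (simp add: mutation_law_def mut_dens_def split_beta')

lemma nwth_nonneg: "j \<in> {1..N} \<Longrightarrow> 0 \<le> nwth t j \<omega>"
  by (rule nweight_nonneg) (simp_all add: pw_nonneg theta_pos less_imp_le)

lemma nwth_measurable: "j \<in> {1..N} \<Longrightarrow> (\<lambda>\<omega>. nwth t j \<omega>) \<in> borel_measurable (F t)"
proof (rule nweight_measurable)
  fix k assume "k \<in> {1..N}"
  note [measurable] = history_measurable[OF order_refl this] theta_measurable[of "Suc t"]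
  show "(\<lambda>\<omega>. pw t k \<omega> * theta S (Suc t) (\<xi> t k \<omega>)) \<in> borel_measurable (F t)" by simp
qed

lemma mut_dens_nonneg: "e \<in> space E0 \<Longrightarrow> 0 \<le> mut_dens t \<omega> e"
  unfolding mut_dens_def using pdens_pos[of "Suc t", THEN less_imp_le]
  by (intro mult_nonneg_nonneg nwth_nonneg) (auto simp: space_pair_measure)

lemma measurable_history_section:
  fixes f :: "nat \<Rightarrow> 'w \<Rightarrow> 'x \<Rightarrow> real"
  assumes "\<And>j. j \<in> {1..N} \<Longrightarrow> (\<lambda>(\<omega>, x). f j \<omega> x) \<in> borel_measurable (F t \<Otimes>\<^sub>M borel)"
  shows "(\<lambda>(\<omega>, e). f (fst e) \<omega> (snd e)) \<in> borel_measurable (F t \<Otimes>\<^sub>M E0)"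
proof (rule measurable_count_pair)
  have "sets (F t \<Otimes>\<^sub>M nu S) = sets (F t \<Otimes>\<^sub>M (borel :: 'x measure))"
    by (intro sets_pair_measure_cong) simp_all
  then show "(\<lambda>(\<omega>, x). f j \<omega> x) \<in> borel_measurable (F t \<Otimes>\<^sub>M nu S)" if "j \<in> {1..N}" for j
    using assms[OF that] by (simp cong: measurable_cong_sets)
qed simp

lemma mut_dens_measurable: "(\<lambda>(\<omega>, e). mut_dens t \<omega> e) \<in> borel_measurable (F t \<Otimes>\<^sub>M E0)"
  unfolding mut_dens_def
proof (rule measurable_history_section)
  fix j assume j: "j \<in> {1..N}"
  note [measurable] = history_measurable(1)[OF order_refl j] nwth_measurable[OF j]
  show "(\<lambda>(\<omega>, x). nwth t j \<omega> * pdens S (Suc t) (\<xi> t j \<omega>) x) \<in> borel_measurable (F t \<Otimes>\<^sub>M borel)"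
    by (simp add: split_beta')
qed

lemma space_history: "space (F t) = space P"
  using sub_history[of t] by (simp add: subalgebra_def)

lemma mut_dens_section [measurable]: "\<omega> \<in> space P \<Longrightarrow> mut_dens t \<omega> \<in> borel_measurable E0"
  using measurable_Pair2[OF mut_dens_measurable, of \<omega> t] by (simp add: space_history)

lemma prob_Kmut:
  assumes w: "\<omega> \<in> space P"
  shows "prob_space (Kmut t \<omega>)"
proof
  interpret nu: finite_measure "nu S" by (rule nu_finite)
  have [measurable]: "mut_dens t \<omega> \<in> borel_measurable E0" by (rule mut_dens_section[OF w])
  have "emeasure (Kmut t \<omega>) (space (Kmut t \<omega>)) =
      (\<integral>\<^sup>+e. ennreal (mut_dens t \<omega> e) * indicator (space E0) e \<partial>E0)"
    by (subst emeasure_density) simp_all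
  also have "\<dots> = (\<integral>\<^sup>+e. ennreal (mut_dens t \<omega> e) \<partial>E0)"
    by (intro nn_integral_cong) simp
  also have "\<dots> = (\<integral>\<^sup>+j. \<integral>\<^sup>+x. ennreal (mut_dens t \<omega> (j, x)) \<partial>nu S \<partial>count_space {1..N})"
    by (rule nu.nn_integral_fst[symmetric]) simp
  also have "\<dots> = (\<Sum>j=1..N. \<integral>\<^sup>+x. ennreal (mut_dens t \<omega> (j, x)) \<partial>nu S)"
    by (rule nn_integral_count_space_finite) simp
  also have "\<dots> = (\<Sum>j=1..N. ennreal (nwth t j \<omega>))"
  proof (rule sum.cong)
    fix j assume j: "j \<in> {1..N}"
    have "(\<integral>\<^sup>+x. ennreal (mut_dens t \<omega> (j, x)) \<partial>nu S) =
        ennreal (nwth t j \<omega>) * (\<integral>\<^sup>+x. ennreal (pdens S (Suc t) (\<xi> t j \<omega>) x) \<partial>nu S)"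
      using nwth_nonneg[OF j] by (simp add: mut_dens_def ennreal_mult' nn_integral_cmult)
    also have "(\<integral>\<^sup>+x. ennreal (pdens S (Suc t) (\<xi> t j \<omega>) x) \<partial>nu S) = emeasure (Pker S (Suc t) (\<xi> t j \<omega>)) UNIV"
      by (simp add: Pker_def emeasure_density)
    also have "\<dots> = 1"
      using prob_space.emeasure_space_1[OF prob_Pker, of "Suc t" "\<xi> t j \<omega>"] by (simp add: Pker_def)
    finally show "(\<integral>\<^sup>+x. ennreal (mut_dens t \<omega> (j, x)) \<partial>nu S) = ennreal (nwth t j \<omega>)" by simp
  qed simp
  also have "\<dots> = ennreal (\<Sum>j=1..N. nwth t j \<omega>)"
    using nwth_nonneg by (intro sum_ennreal) auto
  also have "\<dots> = 1"
    using N1 by (simp only: sum_nweight ennreal_1)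
  finally show "emeasure (Kmut t \<omega>) (space (Kmut t \<omega>)) = 1" .
qed

lemma mutation_cond_iid:
  "cond_iid_density P (F t) E0 (mut_dens t) {1..N} (\<lambda>i \<omega>. (I (Suc t) i \<omega>, \<xi> (Suc t) i \<omega>))"
proof -
  interpret nu: finite_measure "nu S" by (rule nu_finite)
  interpret cs: sigma_finite_measure "count_space {1..N}"
    by (rule sigma_finite_measure_count_space_finite) simp
  interpret E: pair_sigma_finite "count_space {1..N}" "nu S" ..
  have ci: "cond_iid P (F t) {1..N} (count_space {1..N} \<Otimes>\<^sub>M borel)
        (\<lambda>i \<omega>. (I (Suc t) i \<omega>, \<xi> (Suc t) i \<omega>)) (mutation_law S N \<xi> I (Suc t))"
  proof -
    have "\<forall>t\<ge>1. cond_iid P (F (t - 1)) {1..N} (count_space {1..N} \<Otimes>\<^sub>M borel)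
        (\<lambda>i \<omega>. (I t i \<omega>, \<xi> t i \<omega>)) (mutation_law S N \<xi> I t)"
      using filter unfolding particle_filter_def by blast
    from this[rule_format, of "Suc t"] show ?thesis by simp
  qed
  show ?thesis
  proof (intro cond_iid_density.intro cond_iid_density_axioms.intro)
    show "(\<lambda>\<omega>. (I (Suc t) i \<omega>, \<xi> (Suc t) i \<omega>)) \<in> measurable P E0" if "i \<in> {1..N}" for i
      using ci that unfolding cond_iid_def by (simp cong: measurable_cong_sets add: sets_E0)
    show "emeasure P {\<omega> \<in> G. \<forall>i\<in>{1..N}. (I (Suc t) i \<omega>, \<xi> (Suc t) i \<omega>) \<in> D i} =
        (\<integral>\<^sup>+\<omega>. indicator G \<omega> * (\<Prod>i=1..N. emeasure (Kmut t \<omega>) (D i)) \<partial>P)"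
      if "G \<in> sets (F t)" "\<And>i. i \<in> {1..N} \<Longrightarrow> D i \<in> sets E0" for G D
      unfolding mutation_law_eq[symmetric]
      by (rule cond_iid_emeasure[OF prob_space_axioms sub_history _ ci _ that(1)])
        (use prob_Kmut that(2) in \<open>auto simp: mutation_law_eq sets_E0 simp del: atLeastAtMost_iff\<close>)
  qed (use prob_space_axioms E.sigma_finite_measure_axioms sub_history mut_dens_measurable prob_Kmut mut_dens_nonneg in auto)
qed

lemma mutation_integral:
  fixes u :: "nat \<times> 'x \<Rightarrow> real"
  assumes w: "\<omega> \<in> space P" and u: "u \<in> borel_measurable E0" and b: "\<And>e. \<bar>u e\<bar> \<le> b"
  shows "(\<integral>e. u e \<partial>Kmut t \<omega>) =
    (\<Sum>j=1..N. nwth t j \<omega> * (\<integral>x. pdens S (Suc t) (\<xi> t j \<omega>) x * u (j, x) \<partial>nu S))"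
proof -
  interpret nu: finite_measure "nu S" by (rule nu_finite)
  interpret cs: sigma_finite_measure "count_space {1..N}"
    by (rule sigma_finite_measure_count_space_finite) simp
  interpret E: pair_sigma_finite "count_space {1..N}" "nu S" ..
  interpret Kp: prob_space "Kmut t \<omega>" by (rule prob_Kmut[OF w])
  note [measurable] = mut_dens_section[OF w, of t] u
  have "integrable (Kmut t \<omega>) u"
    using b by (intro Kp.integrable_const_bound[where B = b]) auto
  then have i: "integrable E0 (\<lambda>e. mut_dens t \<omega> e * u e)"
    using mut_dens_nonneg by (subst (asm) integrable_density) auto
  have "(\<integral>e. u e \<partial>Kmut t \<omega>) = (\<integral>e. mut_dens t \<omega> e * u e \<partial>E0)"
    using mut_dens_nonneg by (subst integral_density) auto
  also have "\<dots> = (\<integral>j. \<integral>x. mut_dens t \<omega> (j, x) * u (j, x) \<partial>nu S \<partial>count_space {1..N})"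
    by (rule E.integral_fst'[OF i, symmetric])
  also have "\<dots> = (\<Sum>j=1..N. \<integral>x. mut_dens t \<omega> (j, x) * u (j, x) \<partial>nu S)"
    by (rule lebesgue_integral_count_space_finite) simp
  also have "\<dots> = (\<Sum>j=1..N. nwth t j \<omega> * (\<integral>x. pdens S (Suc t) (\<xi> t j \<omega>) x * u (j, x) \<partial>nu S))"
    by (simp add: mut_dens_def mult.assoc)
  finally show ?thesis .
qed

text \<open>\<open>Wt\<close> is the weight of a new particle times its normalised future
  likelihood, as a function of history and of the pair (ancestor, position). Dividing the selection
  probability by \<open>theta\<close> in \<open>vv\<close> undoes the tilting of the
  ancestors.\<close>

abbreviation "Wt T t \<omega> e \<equiv> weight S (Suc t) (\<xi> t (fst e) \<omega>) (snd e) * bt T (Suc t) (snd e)"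
abbreviation "vv t j \<omega> \<equiv> nwth t j \<omega> / theta S (Suc t) (\<xi> t j \<omega>)"

lemma Wt_bounds: "0 \<le> Wt T t \<omega> e" "Wt T t \<omega> e \<le> wmax / \<kappa>"
proof -
  show "0 \<le> Wt T t \<omega> e"
    using weight_pos[of "Suc t"] bt_bounds(3) by (intro mult_nonneg_nonneg less_imp_le) auto
  have "Wt T t \<omega> e \<le> wmax * (1 / \<kappa>)"
    using weight_le[of "Suc t"] bt_bounds(2) bt_bounds(3)[THEN less_imp_le] wmax_pos
    by (intro mult_mono) auto
  then show "Wt T t \<omega> e \<le> wmax / \<kappa>" by simp
qed

lemma Wt_measurable: "(\<lambda>(\<omega>, e). Wt T t \<omega> e) \<in> borel_measurable (F t \<Otimes>\<^sub>M E0)"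
proof (rule measurable_history_section)
  fix j assume j: "j \<in> {1..N}"
  note [measurable] = history_measurable(1)[OF order_refl j]
  show "(\<lambda>(\<omega>, x). weight S (Suc t) (\<xi> t j \<omega>) x * bt T (Suc t) x) \<in> borel_measurable (F t \<Otimes>\<^sub>M borel)"
    by (simp add: split_beta')
qed

text \<open>The proposal density cancels against the denominator of the weight, leaving transition
  density times likelihood over \<open>theta\<close>: importance sampling is unbiased up to
  normalisation.\<close>

lemma Wt_mean:
  fixes \<phi> :: "'x \<Rightarrow> real"
  assumes w: "\<omega> \<in> space P" and \<phi> [measurable]: "\<phi> \<in> borel_measurable borel" and b: "\<And>x. \<bar>\<phi> x\<bar> \<le> b"
  shows "(\<integral>e. Wt T t \<omega> e * \<phi> (snd e) \<partial>Kmut t \<omega>) =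
    (\<Sum>j=1..N. vv t j \<omega> * (\<integral>x. gt S (Suc t) x * bt T (Suc t) x * \<phi> x \<partial>Mker S (\<xi> t j \<omega>)))"
proof -
  have Wm: "(\<lambda>e. Wt T t \<omega> e) \<in> borel_measurable E0"
    using measurable_Pair2[OF Wt_measurable, of \<omega> t T] w by (simp add: space_history)
  have [measurable]: "\<phi> \<in> borel_measurable (nu S)" by simp
  have "(\<integral>e. Wt T t \<omega> e * \<phi> (snd e) \<partial>Kmut t \<omega>) =
      (\<Sum>j=1..N. nwth t j \<omega> * (\<integral>x. pdens S (Suc t) (\<xi> t j \<omega>) x * (Wt T t \<omega> (j, x) * \<phi> x) \<partial>nu S))"
  proof (subst mutation_integral[OF w, where b = "wmax / \<kappa> * b"])
    show "(\<lambda>e. Wt T t \<omega> e * \<phi> (snd e)) \<in> borel_measurable E0"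
    proof (rule borel_measurable_times[OF Wm])
      show "(\<lambda>e. \<phi> (snd e)) \<in> borel_measurable E0"
        by (rule measurable_compose[OF measurable_snd]) simp
    qed
    show "\<bar>Wt T t \<omega> e * \<phi> (snd e)\<bar> \<le> wmax / \<kappa> * b" for e
    proof -
      have "\<bar>Wt T t \<omega> e\<bar> \<le> wmax / \<kappa>" using Wt_bounds[where T = T and t = t and \<omega> = \<omega> and e = e] by linarith
      then show ?thesis
        unfolding abs_mult[of "Wt T t \<omega> e"] using b[of "snd e"] wmax_pos \<kappa>_bounds(2) by (intro mult_mono) auto
    qed
  qed simp
  also have "\<dots> = (\<Sum>j=1..N. vv t j \<omega> * (\<integral>x. gt S (Suc t) x * bt T (Suc t) x * \<phi> x \<partial>Mker S (\<xi> t j \<omega>)))"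
  proof (rule sum.cong[OF refl])
    fix j
    have "(\<integral>x. pdens S (Suc t) (\<xi> t j \<omega>) x * (Wt T t \<omega> (j, x) * \<phi> x) \<partial>nu S) =
        (\<integral>x. (mdens S (\<xi> t j \<omega>) x * (gt S (Suc t) x * bt T (Suc t) x * \<phi> x)) / theta S (Suc t) (\<xi> t j \<omega>) \<partial>nu S)"
    proof (rule Bochner_Integration.integral_cong[OF refl])
      fix x
      have "pdens S (Suc t) (\<xi> t j \<omega>) x \<noteq> 0" using pdens_pos[of "Suc t" "\<xi> t j \<omega>" x] by simp
      then show "pdens S (Suc t) (\<xi> t j \<omega>) x * (Wt T t \<omega> (j, x) * \<phi> x) =
          (mdens S (\<xi> t j \<omega>) x * (gt S (Suc t) x * bt T (Suc t) x * \<phi> x)) / theta S (Suc t) (\<xi> t j \<omega>)"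
        by (simp add: weight_def)
    qed
    also have "\<dots> = (\<integral>x. gt S (Suc t) x * bt T (Suc t) x * \<phi> x \<partial>Mker S (\<xi> t j \<omega>)) / theta S (Suc t) (\<xi> t j \<omega>)"
      by (simp add: integral_Mker)
    finally show "nwth t j \<omega> * (\<integral>x. pdens S (Suc t) (\<xi> t j \<omega>) x * (Wt T t \<omega> (j, x) * \<phi> x) \<partial>nu S) =
        vv t j \<omega> * (\<integral>x. gt S (Suc t) x * bt T (Suc t) x * \<phi> x \<partial>Mker S (\<xi> t j \<omega>))" by simp
  qed
  finally show ?thesis .
qed

text \<open>The quotient of the reference values used by \<open>bt\<close> at consecutive times. It
  appears in numerator and denominator alike and drops out of every ratio.\<close>

definition qq :: "nat \<Rightarrow> nat \<Rightarrow> real" where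
  "qq T t = lh (T - t) t undefined / lh (T - Suc t) (Suc t) undefined"

lemma qq_pos: "0 < qq T t"
  by (simp add: qq_def lh_pos)

lemma Mker_bt_hs:
  assumes "t < T" "Suc t \<le> s"
  shows "(\<integral>x. gt S (Suc t) x * bt T (Suc t) x * hs h s (T - Suc t) (Suc t) x \<partial>Mker S y) =
    qq T t * (bt T t y * hs h s (T - t) t y)"
proof -
  have T: "T - t = Suc (T - Suc t)" using assms by simp
  note pos = lh_pos[of "T - t" t undefined] lh_pos[of "T - t" t y] lh_pos[of "T - Suc t" "Suc t" undefined]
  have "(\<integral>x. gt S (Suc t) x * bt T (Suc t) x * hs h s (T - Suc t) (Suc t) x \<partial>Mker S y) =
      (\<integral>x. gt S (Suc t) x * lh (T - Suc t) (Suc t) x * hs h s (T - Suc t) (Suc t) x \<partial>Mker S y) /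
        lh (T - Suc t) (Suc t) undefined"
    by (simp add: bt_def)
  also have "(\<integral>x. gt S (Suc t) x * lh (T - Suc t) (Suc t) x * hs h s (T - Suc t) (Suc t) x \<partial>Mker S y) =
      lh (T - t) t y * hs h s (T - t) t y"
    using assms pos unfolding T by (simp add: lh_pos)
  finally show ?thesis using pos by (simp add: qq_def bt_def)
qed

lemma Mker_bt:
  assumes "t < T"
  shows "(\<integral>x. gt S (Suc t) x * bt T (Suc t) x \<partial>Mker S y) = qq T t * bt T t y"
proof -
  have T: "T - t = Suc (T - Suc t)" using assms by simp
  have "(\<integral>x. gt S (Suc t) x * bt T (Suc t) x \<partial>Mker S y) = lh (T - t) t y / lh (T - Suc t) (Suc t) undefined"
    unfolding T by (simp add: bt_def)
  then show ?thesis using lh_pos[of "T - t" t undefined] by (simp add: qq_def bt_def)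
qed

lemma sum_nwt_bt_pos:
  assumes "\<And>i. i \<in> {1..N} \<Longrightarrow> 0 \<le> w i" "(\<Sum>i=1..N. w i) = 1" "\<And>i. 0 < v i"
  shows "0 < (\<Sum>i=1..N. w i * v i :: real)"
proof -
  obtain i where i: "i \<in> {1..N}" "w i \<noteq> 0"
    using assms(2) by (metis sum.neutral zero_neq_one)
  have "0 < w i * v i" using i assms(1)[OF i(1)] assms(3)[of i] by (simp add: less_le)
  also have "\<dots> \<le> (\<Sum>i=1..N. w i * v i)"
    using i assms(1) assms(3)[THEN less_imp_le] by (intro member_le_sum) auto
  finally show ?thesis .
qed

subsection \<open>The interpolating estimators\<close>

text \<open>\<open>interp s T h t\<close> is the \<open>R\<^sub>t\<close> of the introduction, and \<open>fs s T h t\<close> the function averaged by it.\<close>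

definition fs :: "nat \<Rightarrow> nat \<Rightarrow> ('x \<Rightarrow> real) \<Rightarrow> nat \<Rightarrow> 'w \<Rightarrow> 'x \<Rightarrow> real" where
  "fs s T h t \<omega> x = (if t \<le> s then hs h s (T - t) t x else bk s (t - s) h \<omega> x)"

definition interp :: "nat \<Rightarrow> nat \<Rightarrow> ('x \<Rightarrow> real) \<Rightarrow> nat \<Rightarrow> 'w \<Rightarrow> real" where
  "interp s T h t \<omega> = (\<Sum>i=1..N. nwt t i \<omega> * (bt T t (\<xi> t i \<omega>) * fs s T h t \<omega> (\<xi> t i \<omega>))) /
    (\<Sum>i=1..N. nwt t i \<omega> * bt T t (\<xi> t i \<omega>))"

text \<open>At \<open>t = s\<close> the two branches of \<open>fs\<close> agree, both being
  \<open>h\<close>; this joins the exact regime to the backward regime.\<close>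

lemma hs_now: "s \<le> t \<Longrightarrow> hs h s k t x = h x"
  by (cases k) auto

lemma fs_bounds:
  assumes "h \<in> borel_measurable borel" "\<And>x. lo \<le> h x \<and> h x \<le> lo + d"
  shows "lo \<le> fs s T h t \<omega> x \<and> fs s T h t \<omega> x \<le> lo + d"
  using hs_bounds[OF assms] bk_bounds[OF assms] by (simp add: fs_def)

text \<open>With truncated subtraction, \<open>(t - s) + (s - t)\<close> is the distance of
  \<open>t\<close> and \<open>s\<close>; it is the number of contractions by
  \<open>1 - \<kappa>\<close>, which come from \<open>hs\<close> on one side of \<open>s\<close> and
  from \<open>bk\<close> on the other.\<close>

lemma fs_osc:
  assumes h: "h \<in> borel_measurable borel" "osc_le h d" and d: "0 < d" and r: "1 - \<kappa> \<le> r\<^sup>2" and t: "t \<le> T" "s \<le> T"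
  shows "osc_le (fs s T h t \<omega>) (r ^ (2 * ((t - s) + (s - t))) * d)"
proof -
  define n where "n = (t - s) + (s - t)"
  have "osc_le (fs s T h t \<omega>) ((1 - \<kappa>) ^ n * d)"
  proof (cases "t \<le> s")
    case True
    then have "fs s T h t \<omega> = hs h s (T - t) t" by (intro ext) (simp add: fs_def)
    then show ?thesis using hs_osc[OF h True, of "T - t"] True t by (simp add: n_def)
  next
    case False
    then have "fs s T h t \<omega> = bk s (t - s) h \<omega>" by (intro ext) (simp add: fs_def)
    then show ?thesis using bk_osc[OF h, where s = s and k = "t - s" and \<omega> = \<omega>] False by (simp add: n_def)
  qed
  moreover have "(1 - \<kappa>) ^ n \<le> (r\<^sup>2) ^ n"
    using r \<kappa>_bounds(3) by (intro power_mono) auto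
  then have "(1 - \<kappa>) ^ n * d \<le> r ^ (2 * n) * d"
    using d by (simp add: power_mult)
  ultimately show ?thesis unfolding n_def by (rule osc_le_mono)
qed

lemma fs_section [measurable]: "h \<in> borel_measurable borel \<Longrightarrow> fs s T h t \<omega> \<in> borel_measurable borel"
  unfolding fs_def[abs_def] by (cases "t \<le> s") simp_all

lemma fs_measurable:
  assumes h: "h \<in> borel_measurable borel"
    and M: "\<And>u i. u < t \<Longrightarrow> i \<in> {1..N} \<Longrightarrow> \<xi> u i \<in> measurable M borel \<and> pw u i \<in> borel_measurable M"
  shows "(\<lambda>(\<omega>, x). fs s T h t \<omega> x) \<in> borel_measurable (M \<Otimes>\<^sub>M borel)"
proof (cases "t \<le> s")
  case True
  then show ?thesis using h by (simp add: fs_def split_beta')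
next
  case False
  then have "(\<lambda>(\<omega>, x). bk s (t - s) h \<omega> x) \<in> borel_measurable (M \<Otimes>\<^sub>M borel)"
    using M by (intro bk_measurable[OF h]) simp
  then show ?thesis using False by (simp add: fs_def)
qed

lemma interp_bounds:
  assumes "\<And>x. lo \<le> fs s T h t \<omega> x \<and> fs s T h t \<omega> x \<le> lo + d"
  shows "lo \<le> interp s T h t \<omega> \<and> interp s T h t \<omega> \<le> lo + d"
proof -
  let ?D = "\<Sum>i=1..N. nwt t i \<omega> * bt T t (\<xi> t i \<omega>)"
  have D: "0 < ?D"
    by (rule sum_nwt_bt_pos[OF nwt_nonneg sum_nweight[OF N1] bt_bounds(3)])
  have wn: "0 \<le> nwt t i \<omega> * bt T t (\<xi> t i \<omega>)" if "i \<in> {1..N}" for i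
    using nwt_nonneg[OF that] bt_bounds(3)[THEN less_imp_le] by simp
  have "?D * lo = (\<Sum>i=1..N. nwt t i \<omega> * bt T t (\<xi> t i \<omega>) * lo)" by (rule sum_distrib_right)
  also have "\<dots> \<le> (\<Sum>i=1..N. nwt t i \<omega> * bt T t (\<xi> t i \<omega>) * fs s T h t \<omega> (\<xi> t i \<omega>))"
    using wn assms by (intro sum_mono mult_left_mono) auto
  finally have 1: "?D * lo \<le> (\<Sum>i=1..N. nwt t i \<omega> * (bt T t (\<xi> t i \<omega>) * fs s T h t \<omega> (\<xi> t i \<omega>)))"
    by (simp add: mult.assoc)
  have "(\<Sum>i=1..N. nwt t i \<omega> * bt T t (\<xi> t i \<omega>) * fs s T h t \<omega> (\<xi> t i \<omega>)) \<le>
      (\<Sum>i=1..N. nwt t i \<omega> * bt T t (\<xi> t i \<omega>) * (lo + d))"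
    using wn assms by (intro sum_mono mult_left_mono) auto
  also have "\<dots> = ?D * (lo + d)" by (rule sum_distrib_right[symmetric])
  finally have 2: "(\<Sum>i=1..N. nwt t i \<omega> * (bt T t (\<xi> t i \<omega>) * fs s T h t \<omega> (\<xi> t i \<omega>))) \<le> ?D * (lo + d)"
    by (simp add: mult.assoc)
  show ?thesis
    unfolding interp_def using 1 2 D by (simp add: pos_le_divide_eq pos_divide_le_eq mult.commute)
qed

lemma interp_measurable:
  assumes h: "h \<in> borel_measurable borel"
  shows "interp s T h t \<in> borel_measurable P"
proof -
  have fsm: "(\<lambda>(\<omega>, x). fs s T h t \<omega> x) \<in> borel_measurable (P \<Otimes>\<^sub>M borel)"
    by (rule fs_measurable[OF h]) auto
  have [measurable]: "(\<lambda>\<omega>. fs s T h t \<omega> (\<xi> t i \<omega>)) \<in> borel_measurable P" if "i \<in> {1..N}" for i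
    using measurable_compose[OF measurable_Pair[OF measurable_ident_sets[OF refl] xi_measurable[OF that]] fsm] by simp
  have [measurable]: "(\<lambda>\<omega>. nwt t i \<omega>) \<in> borel_measurable P" if "i \<in> {1..N}" for i
    using that by (intro nweight_measurable) auto
  show ?thesis unfolding interp_def[abs_def] by measurable
qed

text \<open>At time \<open>T\<close> no observation is left, so \<open>bt\<close> is 1 and the
  denominator of \<open>interp\<close> is the total of the normalised weights.\<close>

lemma ffbs_eq:
  assumes "h \<in> borel_measurable borel" "s \<le> T"
  shows "ffbs S N \<xi> I s T h \<omega> = interp s T h T \<omega>"
proof -
  have f: "fs s T h T \<omega> x = bk s (T - s) h \<omega> x" for x
    using assms by (cases "T = s") (auto simp: fs_def hs_now)
  show ?thesis
    unfolding ffbs_def interp_def f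
    using assms sum_nweight[OF N1, of "\<lambda>k. pw T k \<omega>"] by (simp add: integral_filter bt_T del: One_nat_def)
qed

text \<open>After time 0 each weight is a quotient of positive quantities, even if the ancestors
  were chosen uniformly because all initial weights vanished. Degeneracy is thus confined to time
  0.\<close>

lemma pw_sum_pos: "0 < (\<Sum>i=1..N. pw (Suc t) i \<omega>)"
  using N1 weight_pos[of "Suc t"] by (intro sum_pos) (auto simp: pweight_def)

lemma interp_ratio:
  assumes "0 < (\<Sum>i=1..N. pw t i \<omega>)"
  shows "interp s T h t \<omega> = (\<Sum>i=1..N. pw t i \<omega> * bt T t (\<xi> t i \<omega>) * fs s T h t \<omega> (\<xi> t i \<omega>)) /
    (\<Sum>i=1..N. pw t i \<omega> * bt T t (\<xi> t i \<omega>))"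
  unfolding interp_def using assms by (subst ratio_nweight) (simp_all add: mult.assoc)

text \<open>Numerator and denominator are those of \<open>interp\<close> at time \<open>t\<close>
  times the same factor \<open>\<rho> * qq T t\<close>. Before \<open>s\<close> this is the
  recursion of \<open>hs\<close>; from \<open>s\<close> on it expresses that the particle backward
  kernel reverses the particle approximation of the transition.\<close>

lemma conditional_mean_ratio:
  assumes h: "h \<in> borel_measurable borel" and t: "t < T" and w: "\<omega> \<in> space P"
    and pos: "0 < (\<Sum>i=1..N. pw t i \<omega>)" and lo: "\<And>x. lo \<le> h x \<and> h x \<le> lo + d"
  shows "(\<integral>e. Wt T t \<omega> e * fs s T h (Suc t) \<omega> (snd e) \<partial>Kmut t \<omega>) /
    (\<integral>e. Wt T t \<omega> e \<partial>Kmut t \<omega>) = interp s T h t \<omega>"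
proof -
  define \<rho> where "\<rho> = (\<Sum>i=1..N. pw t i \<omega>) / (\<Sum>i=1..N. pw t i \<omega> * theta S (Suc t) (\<xi> t i \<omega>))"
  have th_pos: "0 < (\<Sum>i=1..N. pw t i \<omega> * theta S (Suc t) (\<xi> t i \<omega>))"
  proof -
    obtain i where i: "i \<in> {1..N}" "pw t i \<omega> \<noteq> 0"
      using pos by (metis sum.neutral less_irrefl)
    have "0 < pw t i \<omega> * theta S (Suc t) (\<xi> t i \<omega>)"
      using i pw_nonneg[of t i \<omega>] theta_pos[of "Suc t"] by (simp add: less_le)
    also have "\<dots> \<le> (\<Sum>i=1..N. pw t i \<omega> * theta S (Suc t) (\<xi> t i \<omega>))"
      using i pw_nonneg theta_pos[of "Suc t", THEN less_imp_le] by (intro member_le_sum) auto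
    finally show ?thesis .
  qed
  have \<rho>: "0 < \<rho>" using pos th_pos by (simp add: \<rho>_def)
  \<comment> \<open>Selection and filter weights are proportional here because both totals are
    positive. With all weights zero both laws would be uniform, and the division by
    \<open>theta\<close> would remain on one side.\<close>
  have vv: "vv t j \<omega> = \<rho> * nwt t j \<omega>" for j
    using pos th_pos theta_pos[of "Suc t" "\<xi> t j \<omega>"] by (simp add: nweight_def \<rho>_def)
  have fsb: "\<bar>fs s T h (Suc t) \<omega> x\<bar> \<le> \<bar>lo\<bar> + \<bar>lo + d\<bar>" for x
    using fs_bounds[OF h lo, of s T "Suc t" \<omega> x] by auto
  have num: "(\<integral>e. Wt T t \<omega> e * fs s T h (Suc t) \<omega> (snd e) \<partial>Kmut t \<omega>) =
    \<rho> * qq T t * (\<Sum>j=1..N. nwt t j \<omega> * (bt T t (\<xi> t j \<omega>) * fs s T h t \<omega> (\<xi> t j \<omega>)))"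
  proof (cases "Suc t \<le> s")
    case True
    then have "fs s T h (Suc t) \<omega> x = hs h s (T - Suc t) (Suc t) x" "fs s T h t \<omega> x = hs h s (T - t) t x" for x
      by (simp_all add: fs_def)
    then show ?thesis
      using fsb h by (subst Wt_mean[OF w])
        (auto simp: Mker_bt_hs[OF t True] vv sum_distrib_left intro!: sum.cong)
  next
    case False
    define k where "k = t - s"
    have st: "s + k = t" "Suc t - s = Suc k" using False by (auto simp: k_def)
    have f1: "fs s T h (Suc t) \<omega> = bk s (Suc k) h \<omega>" and f0: "fs s T h t \<omega> = bk s k h \<omega>"
      using False st by (auto simp: fs_def hs_now k_def intro!: ext simp del: backward.simps(2))
    interpret nu: finite_measure "nu S" by (rule nu_finite)
    define G where "G = (\<lambda>x. gt S (Suc t) x * bt T (Suc t) x)"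
    define B where "B = bk s (Suc k) h \<omega>"
    have [measurable]: "G \<in> borel_measurable borel" "B \<in> borel_measurable borel"
      using h by (auto simp: G_def B_def simp del: backward.simps(2))
    have Gb: "\<bar>G x\<bar> \<le> gmax * (1 / \<kappa>)" for x
      unfolding G_def abs_mult
      using g_le[of "Suc t" x] g_pos[of "Suc t" x] bt_bounds(2,3)[of T "Suc t" x] gmax_pos by (intro mult_mono) auto
    have Bb: "\<bar>B x\<bar> \<le> \<bar>lo\<bar> + \<bar>lo + d\<bar>" for x
      using fsb[of x] by (simp add: f1 B_def del: backward.simps(2))
    have mb: "\<bar>mdens S y x\<bar> \<le> \<sigma>p" for y x
      using mdens_bounds[of y x] mdens_nonneg[of y x] by auto
    have i1: "integrable (nu S) (\<lambda>x. mdens S y x * (G x * B x))" for y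
      using mb Gb Bb \<kappa>_bounds gmax_pos \<sigma>m
      by (intro nu.integrable_const_bound[where B = "\<sigma>p * (gmax * (1 / \<kappa>) * (\<bar>lo\<bar> + \<bar>lo + d\<bar>))"] AE_I2)
        (auto simp only: real_norm_def abs_mult intro!: mult_mono mult_nonneg_nonneg abs_ge_zero, auto)
    have i2: "integrable (nu S) (\<lambda>x. mdens S y x * G x)" for y
      using mb Gb \<kappa>_bounds gmax_pos \<sigma>m
      by (intro nu.integrable_const_bound[where B = "\<sigma>p * (gmax * (1 / \<kappa>))"] AE_I2)
        (auto simp only: real_norm_def abs_mult intro!: mult_mono mult_nonneg_nonneg abs_ge_zero, auto)
    \<comment> \<open>Bayes' rule: the mixture density at the new state times the backward mean
      equals the mixture in which each component is multiplied by the old value of its own particle.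
      Integrating the new state out then leaves those old values with weight
      \<open>qq T t * bt T t\<close>.\<close>
    have key: "(\<Sum>j=1..N. nwt t j \<omega> * mdens S (\<xi> t j \<omega>) x) * B x =
        (\<Sum>j=1..N. nwt t j \<omega> * (mdens S (\<xi> t j \<omega>) x * bk s k h \<omega> (\<xi> t j \<omega>)))" for x
    proof -
      have "0 < (\<Sum>j=1..N. nwt t j \<omega> * mdens S (\<xi> t j \<omega>) x)"
        by (rule sum_nwt_bt_pos[OF nwt_nonneg sum_nweight[OF N1]])
          (use mdens_bounds \<sigma>m in \<open>auto intro: less_le_trans\<close>)
      then show ?thesis unfolding B_def bk_Suc[OF h] st(1) by simp
    qed
    have "(\<Sum>j=1..N. vv t j \<omega> * (\<integral>x. G x * B x \<partial>Mker S (\<xi> t j \<omega>))) =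
        \<rho> * (\<Sum>j=1..N. nwt t j \<omega> * (\<integral>x. mdens S (\<xi> t j \<omega>) x * (G x * B x) \<partial>nu S))"
      by (simp add: vv integral_Mker sum_distrib_left mult_ac)
    also have "(\<Sum>j=1..N. nwt t j \<omega> * (\<integral>x. mdens S (\<xi> t j \<omega>) x * (G x * B x) \<partial>nu S)) =
        (\<integral>x. (\<Sum>j=1..N. nwt t j \<omega> * (mdens S (\<xi> t j \<omega>) x * (G x * B x))) \<partial>nu S)"
      using i1 by (subst Bochner_Integration.integral_sum) auto
    also have "\<dots> = (\<integral>x. (\<Sum>j=1..N. nwt t j \<omega> * bk s k h \<omega> (\<xi> t j \<omega>) * (mdens S (\<xi> t j \<omega>) x * G x)) \<partial>nu S)"
    proof (rule Bochner_Integration.integral_cong[OF refl])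
      fix x
      have "(\<Sum>j=1..N. nwt t j \<omega> * (mdens S (\<xi> t j \<omega>) x * (G x * B x))) =
          ((\<Sum>j=1..N. nwt t j \<omega> * mdens S (\<xi> t j \<omega>) x) * B x) * G x"
        by (simp add: sum_distrib_left sum_distrib_right mult_ac)
      also have "\<dots> = (\<Sum>j=1..N. nwt t j \<omega> * bk s k h \<omega> (\<xi> t j \<omega>) * (mdens S (\<xi> t j \<omega>) x * G x))"
        unfolding key by (simp add: sum_distrib_left sum_distrib_right mult_ac)
      finally show "(\<Sum>j=1..N. nwt t j \<omega> * (mdens S (\<xi> t j \<omega>) x * (G x * B x))) =
        (\<Sum>j=1..N. nwt t j \<omega> * bk s k h \<omega> (\<xi> t j \<omega>) * (mdens S (\<xi> t j \<omega>) x * G x))" .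
    qed
    also have "\<dots> = (\<Sum>j=1..N. nwt t j \<omega> * bk s k h \<omega> (\<xi> t j \<omega>) * (\<integral>x. mdens S (\<xi> t j \<omega>) x * G x \<partial>nu S))"
      using i2 by (subst Bochner_Integration.integral_sum) auto
    also have "\<dots> = qq T t * (\<Sum>j=1..N. nwt t j \<omega> * (bt T t (\<xi> t j \<omega>) * bk s k h \<omega> (\<xi> t j \<omega>)))"
    proof -
      have "(\<integral>x. mdens S y x * G x \<partial>nu S) = qq T t * bt T t y" for y
        unfolding Mker_bt[OF t, symmetric] by (simp add: integral_Mker G_def)
      then show ?thesis by (simp add: sum_distrib_left mult_ac)
    qed
    finally have "(\<Sum>j=1..N. vv t j \<omega> * (\<integral>x. G x * B x \<partial>Mker S (\<xi> t j \<omega>))) =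
      \<rho> * (qq T t * (\<Sum>j=1..N. nwt t j \<omega> * (bt T t (\<xi> t j \<omega>) * bk s k h \<omega> (\<xi> t j \<omega>))))" .
    then show ?thesis
      using fsb h by (subst Wt_mean[OF w]) (auto simp: f1 f0 G_def B_def mult.assoc simp del: backward.simps(2))
  qed
  have "(\<integral>e. Wt T t \<omega> e * 1 \<partial>Kmut t \<omega>) =
    \<rho> * qq T t * (\<Sum>j=1..N. nwt t j \<omega> * bt T t (\<xi> t j \<omega>))"
    by (subst Wt_mean[OF w, of "\<lambda>_. 1" 1]) (auto simp: Mker_bt[OF t] vv sum_distrib_left mult_ac)
  then show ?thesis
    using num \<rho> qq_pos[of T t] by (simp add: interp_def)
qed

text \<open>The tail bound compares with the ratio \<open>a\<close> of conditional means on the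
  whole space, whereas \<open>a\<close> is the previous interpolating estimator only where the
  weights do not all vanish; hence \<open>a\<close> is kept as a separate variable. It is
  measurable, so the deviation events are events.\<close>

lemma one_step_deviation:
  assumes h: "h \<in> borel_measurable borel" and ho: "osc_le h d" and d: "0 < d"
    and r: "0 < r" "1 - \<kappa> \<le> r\<^sup>2" and t: "t < T" and sT: "s \<le> T"
  defines "dd \<equiv> r ^ (2 * ((Suc t - s) + (s - Suc t))) * d"
  shows "\<exists>a\<in>borel_measurable P. (\<forall>\<omega>\<in>space P. 0 < (\<Sum>i=1..N. pw t i \<omega>) \<longrightarrow> a \<omega> = interp s T h t \<omega>) \<and>
    (\<forall>\<delta>>0. \<P>(\<omega> in P. \<delta> \<le> \<bar>interp s T h (Suc t) \<omega> - a \<omega>\<bar>) \<le>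
      3 * exp (- real N * c1\<^sup>2 * \<delta>\<^sup>2 / (8 * w1\<^sup>2 * dd\<^sup>2)))"
proof -
  interpret D: cond_iid_density P "F t" E0 "mut_dens t" "{1..N}" "\<lambda>i \<omega>. (I (Suc t) i \<omega>, \<xi> (Suc t) i \<omega>)"
    by (rule mutation_cond_iid)
  obtain l where l: "\<And>x. l \<le> h x \<and> h x \<le> l + d" using ho by (auto simp: osc_le_def)
  have "\<forall>\<omega>. osc_le (fs s T h (Suc t) \<omega>) dd"
    unfolding dd_def using t sT by (intro allI fs_osc[OF h ho d r(2)]) auto
  then have "\<forall>\<omega>. \<exists>lo. \<forall>x. lo \<le> fs s T h (Suc t) \<omega> x \<and> fs s T h (Suc t) \<omega> x \<le> lo + dd"
    by (simp add: osc_le_def)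
  \<comment> \<open>The averaged function is random, so the interval is chosen for each outcome;
    only its width is deterministic.\<close>
  then obtain lo where lo: "\<And>\<omega> x. lo \<omega> \<le> fs s T h (Suc t) \<omega> x \<and> fs s T h (Suc t) \<omega> x \<le> lo \<omega> + dd"
    by metis
  define a where "a = (\<lambda>\<omega>. (\<integral>e. Wt T t \<omega> e * fs s T h (Suc t) \<omega> (snd e) \<partial>Kmut t \<omega>) /
    (\<integral>e. Wt T t \<omega> e \<partial>Kmut t \<omega>))"
  have fm: "(\<lambda>(\<omega>, e). fs s T h (Suc t) \<omega> (snd e)) \<in> borel_measurable (F t \<Otimes>\<^sub>M E0)"
    using measurable_history_section[of "\<lambda>j. fs s T h (Suc t)" t] history_measurable
    by (simp add: fs_measurable[OF h])
  have Wpw: "Wt T t \<omega> (I (Suc t) i \<omega>, \<xi> (Suc t) i \<omega>) = pw (Suc t) i \<omega> * bt T (Suc t) (\<xi> (Suc t) i \<omega>)" for i \<omega>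
    by (simp add: pweight_def)
  \<comment> \<open>From every ancestor the mean of likelihood times \<open>bt\<close> is at least
    \<open>\<kappa> * c\<close>; averaging over ancestors with weights \<open>vv\<close>, each at
    least the selection probability over \<open>th\<close>, gives \<open>c1\<close>.\<close>
  have mean: "c1 \<le> (\<integral>e. Wt T t \<omega> e \<partial>Kmut t \<omega>)" if w: "\<omega> \<in> space P" for \<omega>
  proof -
    have M: "\<kappa> * c \<le> (\<integral>x. gt S (Suc t) x * bt T (Suc t) x * 1 \<partial>Mker S y)" for y
    proof -
      have "\<kappa> * c \<le> \<kappa> * (\<integral>x. gt S (Suc t) x \<partial>Mker S y)"
        using c_le[of "Suc t" y] \<kappa>_bounds(2) by (intro mult_left_mono) auto
      also have "\<dots> = (\<integral>x. gt S (Suc t) x * \<kappa> \<partial>Mker S y)" by simp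
      also have "\<dots> \<le> (\<integral>x. gt S (Suc t) x * bt T (Suc t) x * 1 \<partial>Mker S y)"
      proof (rule integral_mono)
        have gb: "\<bar>gt S (Suc t) x\<bar> \<le> gmax" for x
          using g_le[of "Suc t" x] g_pos[of "Suc t" x] by simp
        then show "integrable (Mker S y) (\<lambda>x. gt S (Suc t) x * \<kappa>)"
          by (intro integrable_mult_left Mker_integrable_bounded[where b = gmax]) auto
        have "\<bar>gt S (Suc t) x * bt T (Suc t) x * 1\<bar> \<le> gmax * (1 / \<kappa>)" for x
        proof -
          have "\<bar>bt T (Suc t) x\<bar> \<le> 1 / \<kappa>"
            using bt_bounds(2,3)[of T "Suc t" x] by simp
          from mult_mono[OF gb[of x] this less_imp_le[OF gmax_pos] abs_ge_zero]
          show ?thesis by (simp only: abs_mult mult_1_right)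
        qed
        then show "integrable (Mker S y) (\<lambda>x. gt S (Suc t) x * bt T (Suc t) x * 1)"
          by (intro Mker_integrable_bounded[where b = "gmax * (1 / \<kappa>)"]) auto
        show "gt S (Suc t) x * \<kappa> \<le> gt S (Suc t) x * bt T (Suc t) x * 1" for x
          unfolding mult_1_right by (rule mult_left_mono[OF bt_bounds(1) less_imp_le[OF g_pos]])
      qed
      finally show ?thesis .
    qed
    have "c1 = (\<Sum>j=1..N. nwth t j \<omega>) * c1"
      using sum_nweight[OF N1] by simp
    also have "\<dots> = (\<Sum>j=1..N. (nwth t j \<omega> / th) * (\<kappa> * c))"
      unfolding sum_distrib_right by (intro sum.cong) simp_all
    also have "\<dots> \<le> (\<Sum>j=1..N. vv t j \<omega> * (\<integral>x. gt S (Suc t) x * bt T (Suc t) x * 1 \<partial>Mker S (\<xi> t j \<omega>)))"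
    proof (rule sum_mono, rule mult_mono)
      fix j assume j: "j \<in> {1..N}"
      show "nwth t j \<omega> / th \<le> vv t j \<omega>"
        using nwth_nonneg[OF j] theta_le[of "Suc t"] theta_pos[of "Suc t"] th1
        by (intro divide_left_mono mult_pos_pos) auto
      show "0 \<le> vv t j \<omega>"
        using nwth_nonneg[OF j] theta_pos[of "Suc t", THEN less_imp_le] by (intro divide_nonneg_nonneg) auto
      show "0 \<le> \<kappa> * c" using mult_pos_pos[OF \<kappa>_bounds(2) c] by (rule less_imp_le)
    qed (rule M)
    also have "\<dots> = (\<integral>e. Wt T t \<omega> e * 1 \<partial>Kmut t \<omega>)"
      by (rule Wt_mean[OF w, of "\<lambda>_. 1" 1, symmetric]) simp_all
    finally show ?thesis by simp
  qed
  have Rlo: "lo \<omega> \<le> interp s T h (Suc t) \<omega> \<and> interp s T h (Suc t) \<omega> \<le> lo \<omega> + dd" for \<omega>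
    by (rule interp_bounds[OF lo])
  have RW: "interp s T h (Suc t) \<omega> =
      (\<Sum>i=1..N. Wt T t \<omega> (I (Suc t) i \<omega>, \<xi> (Suc t) i \<omega>) *
        fs s T h (Suc t) \<omega> (snd (I (Suc t) i \<omega>, \<xi> (Suc t) i \<omega>))) /
      (\<Sum>i=1..N. Wt T t \<omega> (I (Suc t) i \<omega>, \<xi> (Suc t) i \<omega>))" for \<omega>
    unfolding Wpw using interp_ratio[OF pw_sum_pos, of s T h t \<omega>] by simp
  have dd: "0 < dd" using d r by (simp add: dd_def)
  have ne: "{1..N} \<noteq> {}" using N1 by simp
  note dev = D.self_normalised_deviation[OF Wt_measurable fm conjI[OF Wt_bounds] lo mean RW Rlo w1_bounds(1) c1_bounds(1) dd _ ne,
      folded a_def]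
  have card: "card {1..N} = N" by simp
  have "a \<in> borel_measurable P"
    by (rule D.measurable_F_P, rule dev(2)[OF _ zero_less_one])
  moreover have "a \<omega> = interp s T h t \<omega>" if "\<omega> \<in> space P" "0 < (\<Sum>i=1..N. pw t i \<omega>)" for \<omega>
    unfolding a_def by (rule conditional_mean_ratio[OF h t that l])
  moreover have "\<P>(\<omega> in P. \<delta> \<le> \<bar>interp s T h (Suc t) \<omega> - a \<omega>\<bar>) \<le>
      3 * exp (- real N * c1\<^sup>2 * \<delta>\<^sup>2 / (8 * w1\<^sup>2 * dd\<^sup>2))" if "0 < \<delta>" for \<delta>
    using that unfolding a_def by (intro dev(1)[unfolded card])
  ultimately show ?thesis by blast
qed

section \<open>The initial sample\<close>

text \<open>With the trivial sigma-algebra as history and the constant density 1 against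
  \<open>rho0\<close>, independent initial particles become a case of the conditional
  setting.\<close>

lemma initial_cond_iid:
  "cond_iid_density P (sigma (space P) {}) (rho0 S) (\<lambda>_ _. 1) {1..N} (\<xi> 0)"
proof (intro cond_iid_density.intro cond_iid_density_axioms.intro)
  interpret R: prob_space "rho0 S" by (rule prob_rho0)
  show "sigma_finite_measure (rho0 S)" by (rule R.sigma_finite_measure_axioms)
  show "subalgebra P (sigma (space P) {})"
    by (auto simp: subalgebra_def sigma_sets_empty_eq)
  have d1: "density (rho0 S) (\<lambda>e. ennreal 1) = rho0 S" by (simp add: density_1)
  show "prob_space (density (rho0 S) (\<lambda>e. ennreal 1))" unfolding d1 by (rule prob_rho0)
  have \<xi>0: "indep_vars (\<lambda>_. borel) (\<xi> 0) {1..N}" "\<And>i. i \<in> {1..N} \<Longrightarrow> distr P borel (\<xi> 0 i) = rho0 S"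
    using filter by (auto simp: particle_filter_def)
  show "emeasure P {\<omega> \<in> G. \<forall>i\<in>{1..N}. \<xi> 0 i \<omega> \<in> D i} =
      (\<integral>\<^sup>+\<omega>. indicator G \<omega> * (\<Prod>i=1..N. emeasure (density (rho0 S) (\<lambda>e. ennreal 1)) (D i)) \<partial>P)"
    if G: "G \<in> sets (sigma (space P) {})" and D: "\<And>i. i \<in> {1..N} \<Longrightarrow> D i \<in> sets (rho0 S)" for G D
  proof -
    have eq: "{\<omega> \<in> space P. \<forall>i\<in>{1..N}. \<xi> 0 i \<omega> \<in> D i} = (\<Inter>i\<in>{1..N}. \<xi> 0 i -` D i \<inter> space P)"
      using N1 by auto
    have "prob (\<Inter>i\<in>{1..N}. \<xi> 0 i -` D i \<inter> space P) = (\<Prod>i=1..N. prob (\<xi> 0 i -` D i \<inter> space P))"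
      using N1 D by (intro indep_varsD[OF \<xi>0(1)]) auto
    also have "\<dots> = (\<Prod>i=1..N. measure (rho0 S) (D i))"
      using D by (intro prod.cong) (auto simp: \<xi>0(2)[symmetric] measure_distr)
    finally have "emeasure P {\<omega> \<in> space P. \<forall>i\<in>{1..N}. \<xi> 0 i \<omega> \<in> D i} = (\<Prod>i=1..N. emeasure (rho0 S) (D i))"
      unfolding eq emeasure_eq_measure R.emeasure_eq_measure by (simp add: prod_ennreal)
    moreover have "G = {} \<or> G = space P" using G by (auto simp: sigma_sets_empty_eq)
    ultimately show ?thesis
      unfolding d1 by (auto simp: emeasure_space_1 nn_integral_multc)
  qed
qed (use prob_space_axioms N1 in auto)

lemma weight0_integral:
  fixes f :: "'x \<Rightarrow> real"
  assumes [measurable]: "f \<in> borel_measurable borel"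
  shows "(\<integral>x. weight0 S x * f x \<partial>rho0 S) = (\<integral>x. gt S 0 x * f x \<partial>chi S)"
  unfolding chi_eq by (subst integral_density) (auto simp: dchi_nonneg weight0_def mult_ac)

lemma chi_integrable:
  fixes f :: "'x \<Rightarrow> real"
  assumes [measurable]: "f \<in> borel_measurable borel" and b: "\<And>x. \<bar>f x\<bar> \<le> b"
  shows "integrable (chi S) (\<lambda>x. gt S 0 x * f x)"
proof -
  interpret chi: prob_space "chi S" by (rule prob_chi)
  show ?thesis
  proof (rule chi.integrable_const_bound[where B = "gmax * b"])
    show "AE x in chi S. norm (gt S 0 x * f x) \<le> gmax * b"
      using b g_le[of 0] g_pos[of 0] gmax_pos
      by (auto simp: abs_mult less_imp_le intro!: AE_I2 mult_mono)
  qed simp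
qed

lemma initial_mean: "\<kappa> * c \<le> (\<integral>x. weight0 S x * bt T 0 x \<partial>rho0 S)"
proof -
  have "\<kappa> * c \<le> \<kappa> * (\<integral>x. gt S 0 x \<partial>chi S)"
    using c0 \<kappa>_bounds(2) by (intro mult_left_mono) auto
  also have "\<dots> = (\<integral>x. gt S 0 x * \<kappa> \<partial>chi S)" by simp
  also have "\<dots> \<le> (\<integral>x. gt S 0 x * bt T 0 x \<partial>chi S)"
  proof (rule integral_mono)
    show "integrable (chi S) (\<lambda>x. gt S 0 x * \<kappa>)"
      by (rule chi_integrable[where b = "\<bar>\<kappa>\<bar>"]) auto
    show "integrable (chi S) (\<lambda>x. gt S 0 x * bt T 0 x)"
      using bt_bounds(2,3)[of T 0] by (intro chi_integrable[where b = "1 / \<kappa>"]) (auto simp: less_imp_le)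
    show "gt S 0 x * \<kappa> \<le> gt S 0 x * bt T 0 x" for x
      by (rule mult_left_mono[OF bt_bounds(1) less_imp_le[OF g_pos]])
  qed
  finally show ?thesis by (simp add: weight0_integral)
qed

text \<open>The factor \<open>dchi\<close> in the initial weight changes \<open>rho0\<close> into
  \<open>chi\<close>, and the reference value in \<open>bt\<close> cancels, so the ratio of means is
  exactly the smoothing expectation.\<close>

lemma initial_ratio:
  assumes h: "h \<in> borel_measurable borel" and sT: "s \<le> T"
  shows "(\<integral>x. weight0 S x * bt T 0 x * hs h s T 0 x \<partial>rho0 S) / (\<integral>x. weight0 S x * bt T 0 x \<partial>rho0 S) =
    marg_smooth S s T h"
proof -
  define L where "L = lh T 0 undefined"
  have L: "0 < L" by (simp add: L_def lh_pos)
  have b: "bt T 0 x = lh T 0 x / L" for x by (simp add: bt_def L_def)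
  have "(\<integral>x. weight0 S x * bt T 0 x * hs h s T 0 x \<partial>rho0 S) = (\<integral>x. gt S 0 x * (lh T 0 x * hs h s T 0 x) \<partial>chi S) / L"
    using h weight0_integral[of "\<lambda>x. bt T 0 x * hs h s T 0 x"] by (simp add: b mult.assoc)
  moreover have "(\<integral>x. weight0 S x * bt T 0 x \<partial>rho0 S) = (\<integral>x. gt S 0 x * lh T 0 x \<partial>chi S) / L"
    using weight0_integral[of "bt T 0"] by (simp add: b)
  ultimately show ?thesis using L by (simp add: marg_smooth_eq[OF sT])
qed

text \<open>The smoothing expectation is a weighted mean of \<open>hs\<close>, with weight
  \<open>lh T 0\<close> against \<open>chi\<close> tilted by the first likelihood. Only the
  enclosing interval is taken from it, so bounds on the weight that degenerate with \<open>T\<close>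
  do no harm.\<close>

lemma marg_smooth_bounds:
  assumes h: "h \<in> borel_measurable borel" and lo: "\<And>x. lo \<le> h x \<and> h x \<le> lo + d" and sT: "s \<le> T"
  shows "lo \<le> marg_smooth S s T h \<and> marg_smooth S s T h \<le> lo + d"
proof -
  define \<mu> where "\<mu> = density (chi S) (\<lambda>x. ennreal (gt S 0 x))"
  have sets [measurable_cong]: "sets \<mu> = sets borel" and sp: "space \<mu> = UNIV" by (simp_all add: \<mu>_def)
  have int: "(\<integral>x. f x \<partial>\<mu>) = (\<integral>x. gt S 0 x * f x \<partial>chi S)" if [measurable]: "f \<in> borel_measurable borel" for f :: "'x \<Rightarrow> real"
    unfolding \<mu>_def by (subst integral_density) (auto simp: less_imp_le[OF g_pos])
  interpret chi: prob_space "chi S" by (rule prob_chi)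
  interpret finite_measure \<mu>
  proof
    have "emeasure \<mu> UNIV \<le> (\<integral>\<^sup>+x. ennreal gmax \<partial>chi S)"
      unfolding \<mu>_def using g_le by (simp add: emeasure_density del: nn_integral_const) (intro nn_integral_mono ennreal_leI)
    then show "emeasure \<mu> (space \<mu>) \<noteq> \<infinity>" using chi.emeasure_space_1 by (auto simp: sp top_unique)
  qed
  have pos: "0 < measure \<mu> (space \<mu>)"
    using int[of "\<lambda>_. 1"] c c0 by (simp add: sp)
  have "0 < c ^ T" using c by simp
  from weighted_mean_bounds(3,4)[OF finite_measure_axioms pos _ _ this, of "lh T 0" "hs h s T 0" "gmax ^ T" lo d]
  show ?thesis
    using h lh_bounds[of T 0] hs_bounds[OF h lo, of s T 0] by (simp add: int marg_smooth_eq[OF sT])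
qed

lemma initial_deviation:
  assumes h: "h \<in> borel_measurable borel" and ho: "osc_le h d" and d: "0 < d"
    and r: "0 < r" "1 - \<kappa> \<le> r\<^sup>2" and sT: "s \<le> T" and \<delta>: "0 < \<delta>"
  defines "dd \<equiv> r ^ (2 * ((0 - s) + (s - 0))) * d"
  shows "\<P>(\<omega> in P. \<delta> \<le> \<bar>interp s T h 0 \<omega> - marg_smooth S s T h\<bar>) \<le>
      3 * exp (- real N * c1\<^sup>2 * \<delta>\<^sup>2 / (8 * w1\<^sup>2 * dd\<^sup>2))"
proof -
  interpret D: cond_iid_density P "sigma (space P) {}" "rho0 S" "\<lambda>_ _. 1" "{1..N}" "\<xi> 0"
    by (rule initial_cond_iid)
  have K: "density (rho0 S) (\<lambda>e. ennreal 1) = rho0 S" by (simp add: density_1)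
  have f0: "fs s T h 0 \<omega> = hs h s T 0" for \<omega> by (rule ext) (simp add: fs_def)
  have "osc_le (hs h s T 0) dd"
    unfolding f0[of undefined, symmetric] dd_def using sT by (intro fs_osc[OF h ho d r(2)]) auto
  then obtain lo where lo: "\<And>x. lo \<le> hs h s T 0 x \<and> hs h s T 0 x \<le> lo + dd"
    by (auto simp: osc_le_def)
  have Wb: "0 \<le> weight0 S x * bt T 0 x \<and> weight0 S x * bt T 0 x \<le> w1" for x
  proof
    show "0 \<le> weight0 S x * bt T 0 x"
      by (rule mult_nonneg_nonneg[OF weight0_nonneg less_imp_le[OF bt_bounds(3)]])
    have "weight0 S x * bt T 0 x \<le> wmax * (1 / \<kappa>)"
      using weight0_le weight0_nonneg bt_bounds(2) bt_bounds(3)[THEN less_imp_le] wmax_pos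
      by (intro mult_mono) auto
    then show "weight0 S x * bt T 0 x \<le> w1" by simp
  qed
  have dd: "0 < dd" using d r by (simp add: dd_def)
  have ne: "{1..N} \<noteq> {}" using N1 by simp
  have Wm: "(\<lambda>(\<omega>, x). weight0 S x * bt T 0 x) \<in> borel_measurable (sigma (space P) {} \<Otimes>\<^sub>M rho0 S)"
    by (simp add: split_beta')
  have fm: "(\<lambda>(\<omega>, x). hs h s T 0 x) \<in> borel_measurable (sigma (space P) {} \<Otimes>\<^sub>M rho0 S)"
    using h by (simp add: split_beta')
  have "\<P>(\<omega> in P. \<delta> \<le> \<bar>interp s T h 0 \<omega> -
      (\<integral>x. weight0 S x * bt T 0 x * hs h s T 0 x \<partial>density (rho0 S) (\<lambda>e. ennreal 1)) /
      (\<integral>x. weight0 S x * bt T 0 x \<partial>density (rho0 S) (\<lambda>e. ennreal 1))\<bar>) \<le>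
      3 * exp (- real (card {1..N}) * c1\<^sup>2 * \<delta>\<^sup>2 / (8 * w1\<^sup>2 * dd\<^sup>2))"
  proof (rule D.self_normalised_deviation(1)[OF Wm fm Wb lo _ _ _ w1_bounds(1) c1_bounds(1) dd \<delta> ne])
    show "c1 \<le> (\<integral>x. weight0 S x * bt T 0 x \<partial>density (rho0 S) (\<lambda>e. ennreal 1))"
      unfolding K using initial_mean[of T] c1_bounds(3) by linarith
    show "lo \<le> interp s T h 0 \<omega> \<and> interp s T h 0 \<omega> \<le> lo + dd" for \<omega>
      by (rule interp_bounds) (simp add: f0 lo)
    show "interp s T h 0 \<omega> = (\<Sum>i=1..N. weight0 S (\<xi> 0 i \<omega>) * bt T 0 (\<xi> 0 i \<omega>) * hs h s T 0 (\<xi> 0 i \<omega>)) /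
        (\<Sum>i=1..N. weight0 S (\<xi> 0 i \<omega>) * bt T 0 (\<xi> 0 i \<omega>))"
      if "0 < (\<Sum>i=1..N. weight0 S (\<xi> 0 i \<omega>) * bt T 0 (\<xi> 0 i \<omega>))" for \<omega>
    proof -
      \<comment> \<open>A positive total of weights times \<open>bt\<close> excludes the uniform
        fallback, so \<open>interp\<close> at time 0 is here the plain importance sampling
        ratio.\<close>
      have "\<exists>i\<in>{1..N}. pw 0 i \<omega> \<noteq> 0"
      proof (rule ccontr)
        assume "\<not> ?thesis"
        then have "weight0 S (\<xi> 0 i \<omega>) = 0" if "i \<in> {1..N}" for i
          using that by (simp add: pweight_def)
        then show False using that by simp
      qed
      then have "(\<Sum>i=1..N. pw 0 i \<omega>) \<noteq> 0"
        using pw_nonneg by (subst sum_nonneg_eq_0_iff) auto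
      then have "0 < (\<Sum>i=1..N. pw 0 i \<omega>)"
        using pw_nonneg by (simp add: less_le sum_nonneg)
      then show ?thesis
        by (subst interp_ratio) (simp_all add: pweight_def f0)
    qed
  qed
  then show ?thesis unfolding K initial_ratio[OF h sT] by simp
qed

text \<open>Vanishing of all initial weights is an extreme case of a total below half its mean.
  Using \<open>c1\<close> and \<open>w1\<close> as bounds keeps the exponent comparable with the
  other terms of the union bound.\<close>

lemma zero_weights_prob:
  "\<P>(\<omega> in P. (\<Sum>i=1..N. pw 0 i \<omega>) \<le> 0) \<le> exp (- real N * c1\<^sup>2 / (2 * w1\<^sup>2))"
proof -
  interpret D: cond_iid_density P "sigma (space P) {}" "rho0 S" "\<lambda>_ _. 1" "{1..N}" "\<xi> 0"
    by (rule initial_cond_iid)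
  have K: "density (rho0 S) (\<lambda>e. ennreal 1) = rho0 S" by (simp add: density_1)
  have Wm: "(\<lambda>(\<omega>, x). weight0 S x) \<in> borel_measurable (sigma (space P) {} \<Otimes>\<^sub>M rho0 S)"
    by (simp add: split_beta')
  have ne: "{1..N} \<noteq> {}" using N1 by simp
  have "\<P>(\<omega> in P. (\<Sum>i=1..N. pw 0 i \<omega>) \<le> 0) \<le>
      \<P>(\<omega> in P. (\<Sum>i=1..N. weight0 S (\<xi> 0 i \<omega>)) \<le> c1 / 2 * real (card {1..N}))"
  proof (rule finite_measure_mono)
    show "{\<omega> \<in> space P. (\<Sum>i=1..N. weight0 S (\<xi> 0 i \<omega>)) \<le> c1 / 2 * real (card {1..N})} \<in> events"
      by measurable
    have "0 \<le> c1 / 2 * real (card {1..N})"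
      using c1_bounds(1)[THEN less_imp_le] by (intro mult_nonneg_nonneg[OF divide_nonneg_pos]) simp_all
    then show "{\<omega> \<in> space P. (\<Sum>i=1..N. pw 0 i \<omega>) \<le> 0} \<subseteq>
        {\<omega> \<in> space P. (\<Sum>i=1..N. weight0 S (\<xi> 0 i \<omega>)) \<le> c1 / 2 * real (card {1..N})}"
      by (auto simp: pweight_def simp del: card_atLeastAtMost)
  qed
  also have "\<dots> \<le> exp (- real (card {1..N}) * c1\<^sup>2 / (2 * w1\<^sup>2))"
  proof (rule D.total_weight_small[OF Wm _ _ w1_bounds(1) c1_bounds(1) ne])
    show "0 \<le> weight0 S x \<and> weight0 S x \<le> w1" for x
      using weight0_nonneg[of x] weight0_le[of x] w1_bounds(2) by linarith
    have "(\<integral>x. weight0 S x \<partial>rho0 S) = (\<integral>x. gt S 0 x \<partial>chi S)"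
      using weight0_integral[of "\<lambda>_. 1"] by simp
    then show "c1 \<le> (\<integral>x. weight0 S x \<partial>density (rho0 S) (\<lambda>e. ennreal 1))"
      unfolding K using c0 c1_bounds(2) by linarith
  qed
  finally show ?thesis by simp
qed

end

subsection \<open>Sums over the time lag\<close>

lemma sum_geometric_le:
  fixes q :: real
  assumes "0 \<le> q" "q < 1"
  shows "(\<Sum>k\<le>n. q ^ k) \<le> 1 / (1 - q)"
  using assms by (simp add: sum_gp0 divide_right_mono)

text \<open>Split at \<open>s\<close>: each side is dominated by a geometric series in the lag, and
  lag 0 is counted twice.\<close>

lemma sum_lag_le:
  fixes q :: real
  assumes q: "0 \<le> q" "q < 1"
  shows "(\<Sum>t\<le>T. q ^ ((t - s) + (s - t))) \<le> 2 / (1 - q)"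
proof -
  have "(\<Sum>t\<le>T. q ^ ((t - s) + (s - t))) \<le> (\<Sum>t\<in>{..s} \<union> {s..s+T}. q ^ ((t - s) + (s - t)))"
    using q by (intro sum_mono2) auto
  also have "\<dots> \<le> (\<Sum>t\<le>s. q ^ ((t - s) + (s - t))) + (\<Sum>t\<in>{s..s+T}. q ^ ((t - s) + (s - t)))"
    using q by (subst sum_Un) (auto intro!: sum_nonneg)
  also have "(\<Sum>t\<le>s. q ^ ((t - s) + (s - t))) = (\<Sum>t\<le>s. q ^ t)"
    by (rule sum.reindex_bij_witness[of _ "\<lambda>t. s - t" "\<lambda>t. s - t"]) auto
  also have "(\<Sum>t\<in>{s..s+T}. q ^ ((t - s) + (s - t))) = (\<Sum>t\<le>T. q ^ t)"
    by (rule sum.reindex_bij_witness[of _ "\<lambda>t. s + t" "\<lambda>t. t - s"]) auto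
  also have "(\<Sum>t\<le>s. q ^ t) + (\<Sum>t\<le>T. q ^ t) \<le> 1 / (1 - q) + 1 / (1 - q)"
    by (intro add_mono sum_geometric_le q)
  finally show ?thesis by simp
qed

text \<open>Bernoulli's inequality bounds the growing power from below by a linear function of the
  lag, which turns doubly exponential decay into geometric decay. The assumption
  \<open>1 \<le> X\<close> lets the linear part shed its factor \<open>X\<close>, so that the ratio
  of the series is independent of \<open>X\<close>.\<close>

lemma sum_exp_lag_le:
  fixes r X :: real
  assumes r: "0 < r" "r < 1" and X: "1 \<le> X"
  shows "(\<Sum>t\<le>T. exp (- X * (1 / r\<^sup>2) ^ ((t - s) + (s - t)))) \<le> exp (- X) * (2 / (1 - exp (1 - 1 / r\<^sup>2)))"
proof -
  define \<eta> where "\<eta> = 1 / r\<^sup>2 - 1"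
  have r2: "0 < r\<^sup>2" "r\<^sup>2 < 1" using r by (auto simp: power_less_one_iff)
  then have \<eta>: "0 < \<eta>" by (simp add: \<eta>_def)
  have "exp (- X * (1 / r\<^sup>2) ^ k) \<le> exp (- X) * exp (- \<eta>) ^ k" for k
  proof -
    have "1 + real k * \<eta> \<le> (1 + \<eta>) ^ k" using \<eta> by (intro Bernoulli_inequality) simp
    then have "1 + real k * \<eta> \<le> (1 / r\<^sup>2) ^ k" by (simp add: \<eta>_def)
    then have "X * (1 + real k * \<eta>) \<le> X * (1 / r\<^sup>2) ^ k" using X by (intro mult_left_mono) auto
    moreover have "1 * (real k * \<eta>) \<le> X * (real k * \<eta>)" using X \<eta> by (intro mult_right_mono) auto
    ultimately have "X + real k * \<eta> \<le> X * (1 / r\<^sup>2) ^ k" by (simp add: algebra_simps)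
    then have "exp (- X * (1 / r\<^sup>2) ^ k) \<le> exp (- X + real k * (- \<eta>))" by simp
    then show ?thesis by (simp only: exp_add exp_of_nat_mult)
  qed
  then have "(\<Sum>t\<le>T. exp (- X * (1 / r\<^sup>2) ^ ((t - s) + (s - t)))) \<le>
      (\<Sum>t\<le>T. exp (- X) * exp (- \<eta>) ^ ((t - s) + (s - t)))"
    by (intro sum_mono)
  also have "\<dots> = exp (- X) * (\<Sum>t\<le>T. exp (- \<eta>) ^ ((t - s) + (s - t)))"
    by (simp add: sum_distrib_left)
  also have "\<dots> \<le> exp (- X) * (2 / (1 - exp (- \<eta>)))"
    using \<eta> by (intro mult_left_mono sum_lag_le) auto
  finally show ?thesis by (simp add: \<eta>_def)
qed

section \<open>Union bound over time for the FFBS estimator\<close>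

context mixing_filter
begin

lemma ffbs_bounds:
  assumes h: "h \<in> borel_measurable borel" and lo: "\<And>x. lo \<le> h x \<and> h x \<le> lo + d" and sT: "s \<le> T"
  shows "lo \<le> ffbs S N \<xi> I s T h \<omega> \<and> ffbs S N \<xi> I s T h \<omega> \<le> lo + d"
  unfolding ffbs_eq[OF h sT] by (rule interp_bounds[OF fs_bounds[OF h lo]])

text \<open>\<open>C0\<close> is \<open>c1\<^sup>2 / (2 * w1\<^sup>2)\<close> times
  \<open>\<kappa>0\<^sup>2 / 4\<close>; since this last factor and
  \<open>\<epsilon>\<^sup>2 / d\<^sup>2\<close> are at most 1, the exponent can only shrink in
  absolute value.\<close>

lemma zero_weights_bound:
  assumes "0 < \<epsilon>" "\<epsilon> \<le> d"
  shows "\<P>(\<omega> in P. (\<Sum>i=1..N. pw 0 i \<omega>) \<le> 0) \<le> exp (- (C0 * real N * \<epsilon>\<^sup>2 / d\<^sup>2))"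
proof -
  have "\<epsilon>\<^sup>2 / d\<^sup>2 \<le> 1" using assms by (simp add: power_mono)
  moreover have "\<kappa>0\<^sup>2 \<le> 1\<^sup>2" using \<kappa>0_bounds by (intro power_mono) auto
  ultimately have "\<kappa>0\<^sup>2 / 4 * (\<epsilon>\<^sup>2 / d\<^sup>2) \<le> 1 * 1" by (intro mult_mono) (simp_all add: power_one)
  then have "real N * c1\<^sup>2 / (2 * w1\<^sup>2) * (\<kappa>0\<^sup>2 / 4 * (\<epsilon>\<^sup>2 / d\<^sup>2)) \<le> real N * c1\<^sup>2 / (2 * w1\<^sup>2) * 1"
    by (intro mult_left_mono) auto
  also have "real N * c1\<^sup>2 / (2 * w1\<^sup>2) * (\<kappa>0\<^sup>2 / 4 * (\<epsilon>\<^sup>2 / d\<^sup>2)) = C0 * real N * \<epsilon>\<^sup>2 / d\<^sup>2"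
    by (simp only: times_divide_times_eq times_divide_eq_right times_divide_eq_left divide_divide_eq_left)
      (simp add: mult_ac)
  finally have "exp (- real N * c1\<^sup>2 / (2 * w1\<^sup>2)) \<le> exp (- (C0 * real N * \<epsilon>\<^sup>2 / d\<^sup>2))"
    by simp
  then show ?thesis using zero_weights_prob by (rule order_trans[rotated])
qed

lemma zero_weights_events: "{\<omega> \<in> space P. (\<Sum>i=1..N. pw 0 i \<omega>) \<le> 0} \<in> events"
proof -
  have [measurable]: "(\<lambda>\<omega>. \<Sum>i=1..N. pw 0 i \<omega>) \<in> borel_measurable P"
    by (intro borel_measurable_sum pw_measurable)
  show ?thesis by measurable
qed

text \<open>For \<open>d < \<epsilon>\<close> the event is empty, as estimator and target lie in the
  same interval of width \<open>d\<close>. For \<open>X < 1\<close> the claimed bound exceeds 1. The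
  union bound is left for \<open>1 \<le> X\<close>, where the series over the lag is summable
  uniformly.\<close>

lemma ffbs_deviation:
  assumes h: "h \<in> borel_measurable borel" and ho: "osc_le h d" and d: "0 < d" and sT: "s \<le> T" and \<epsilon>: "0 < \<epsilon>"
  shows "\<P>(\<omega> in P. \<epsilon> \<le> \<bar>ffbs S N \<xi> I s T h \<omega> - marg_smooth S s T h\<bar>) \<le>
    B0 * exp (- (C0 * real N * \<epsilon>\<^sup>2 / d\<^sup>2))" (is "measure P ?E \<le> _")
proof -
  define X where "X = C0 * real N * \<epsilon>\<^sup>2 / d\<^sup>2"
  obtain l where l: "\<And>x. l \<le> h x \<and> h x \<le> l + d" using ho by (auto simp: osc_le_def)
  consider "d < \<epsilon>" | "\<epsilon> \<le> d" "X < 1" | "\<epsilon> \<le> d" "1 \<le> X" by linarith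
  then have "measure P ?E \<le> B0 * exp (- X)"
  proof cases
    case 1
    have "\<bar>ffbs S N \<xi> I s T h \<omega> - marg_smooth S s T h\<bar> \<le> d" for \<omega>
      using ffbs_bounds[OF h l sT, of \<omega>] marg_smooth_bounds[OF h l sT] by auto
    then have "?E = {}" using 1 by (auto simp: not_le intro: le_less_trans)
    moreover have "0 \<le> B0 * exp (- X)" using B0_bounds(1) by (intro mult_nonneg_nonneg) auto
    ultimately show ?thesis by (simp only: measure_empty)
  next
    case 2
    have "1 \<le> exp 1 * exp (- X)" using 2 by (simp flip: exp_add)
    also have "\<dots> \<le> B0 * exp (- X)" using B0_bounds(2) by (intro mult_right_mono) auto
    finally show ?thesis using prob_le_1[of ?E] by linarith
  next
    case 3
    define lag where "lag = (\<lambda>t. (t - s) + (s - t))"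
    define Q where "Q = (\<lambda>t a. a \<in> borel_measurable P \<and>
        (\<forall>\<omega>\<in>space P. 0 < (\<Sum>i=1..N. pw t i \<omega>) \<longrightarrow> a \<omega> = interp s T h t \<omega>) \<and>
        (\<forall>\<delta>>0. \<P>(\<omega> in P. \<delta> \<le> \<bar>interp s T h (Suc t) \<omega> - a \<omega>\<bar>) \<le>
          3 * exp (- real N * c1\<^sup>2 * \<delta>\<^sup>2 / (8 * w1\<^sup>2 * (rr ^ (2 * lag (Suc t)) * d)\<^sup>2))))"
    have "\<forall>t. \<exists>a. t < T \<longrightarrow> Q t a"
      using one_step_deviation[OF h ho d rr_bounds(1,3) _ sT] unfolding Q_def lag_def Bex_def by blast
    from choice[OF this] obtain a' where "\<forall>t. t < T \<longrightarrow> Q t (a' t)"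
      by (rule exE)
    note a' = this[rule_format, unfolded Q_def, THEN conjunct1]
      this[rule_format, unfolded Q_def, THEN conjunct2, THEN conjunct1, rule_format]
      this[rule_format, unfolded Q_def, THEN conjunct2, THEN conjunct2, rule_format]
    \<comment> \<open>At time 0 the comparison value is the exact smoothing expectation, at time
      \<open>Suc t\<close> the ratio of conditional means given the history up to
      \<open>t\<close>.\<close>
    define a where "a = (\<lambda>t \<omega>. case t of 0 \<Rightarrow> marg_smooth S s T h | Suc t \<Rightarrow> a' t \<omega>)"
    have am: "a t \<in> borel_measurable P" if "t \<le> T" for t
      using a'(1) that by (cases t) (auto simp: a_def)
    have dev: "\<P>(\<omega> in P. \<delta> \<le> \<bar>interp s T h t \<omega> - a t \<omega>\<bar>) \<le>
          3 * exp (- real N * c1\<^sup>2 * \<delta>\<^sup>2 / (8 * w1\<^sup>2 * (rr ^ (2 * lag t) * d)\<^sup>2))" if "t \<le> T" "0 < \<delta>" for t \<delta>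
    proof (cases t)
      case 0
      then show ?thesis
        using initial_deviation[OF h ho d rr_bounds(1,3) sT that(2)] by (simp add: a_def lag_def)
    next
      case (Suc u)
      then show ?thesis using a'(3)[of u \<delta>] that by (simp add: a_def)
    qed
    define \<delta> where "\<delta> = (\<lambda>t. \<kappa>0 * rr ^ lag t * \<epsilon>)"
    have \<delta>_pos: "0 < \<delta> t" for t
      unfolding \<delta>_def by (rule mult_pos_pos[OF mult_pos_pos[OF \<kappa>0_bounds(1) zero_less_power[OF rr_bounds(1)]] \<epsilon>])
    let ?Z = "{\<omega> \<in> space P. (\<Sum>i=1..N. pw 0 i \<omega>) \<le> 0}"
    let ?D = "\<lambda>t. {\<omega> \<in> space P. \<delta> t \<le> \<bar>interp s T h t \<omega> - a t \<omega>\<bar>}"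
    have Dm: "?D t \<in> events" if "t \<le> T" for t
    proof -
      note [measurable] = am[OF that] interp_measurable[OF h, of s T t]
      show ?thesis by measurable
    qed
    have sub: "?E \<subseteq> ?Z \<union> (\<Union>t\<le>T. ?D t)"
    proof (rule subsetI, rule ccontr)
      fix \<omega> assume E: "\<omega> \<in> ?E" and n: "\<omega> \<notin> ?Z \<union> (\<Union>t\<le>T. ?D t)"
      then have w: "\<omega> \<in> space P" and z: "0 < (\<Sum>i=1..N. pw 0 i \<omega>)"
        and small: "\<And>t. t \<le> T \<Longrightarrow> \<bar>interp s T h t \<omega> - a t \<omega>\<bar> < \<delta> t" by (auto simp: not_le)
      have pos: "0 < (\<Sum>i=1..N. pw t i \<omega>)" for t
        using z pw_sum_pos[of _ \<omega>] by (cases t) auto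
      \<comment> \<open>Outside the event of vanishing initial weights every comparison value is the
        preceding estimator, so the sum telescopes.\<close>
      have tele: "interp s T h n \<omega> - marg_smooth S s T h = (\<Sum>t\<le>n. interp s T h t \<omega> - a t \<omega>)" if "n \<le> T" for n
        using that
      proof (induction n)
        case (Suc n)
        have "a (Suc n) \<omega> = interp s T h n \<omega>" using a'(2)[OF _ w pos] Suc.prems by (simp add: a_def)
        then show ?case using Suc by simp
      qed (simp add: a_def)
      have "\<bar>ffbs S N \<xi> I s T h \<omega> - marg_smooth S s T h\<bar> \<le> (\<Sum>t\<le>T. \<bar>interp s T h t \<omega> - a t \<omega>\<bar>)"
        unfolding ffbs_eq[OF h sT] tele[OF order_refl] by (rule sum_abs)
      also have "\<dots> < (\<Sum>t\<le>T. \<delta> t)"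
        using small by (intro sum_strict_mono) auto
      also have "\<dots> = \<kappa>0 * \<epsilon> * (\<Sum>t\<le>T. rr ^ lag t)"
        unfolding \<delta>_def sum_distrib_left by (intro sum.cong) (simp_all only: mult_ac)
      also have "\<dots> \<le> \<kappa>0 * \<epsilon> * (2 / (1 - rr))"
        unfolding lag_def using \<kappa>0_bounds(1)[THEN less_imp_le] \<epsilon> rr_bounds(1,2)
        by (intro mult_left_mono sum_lag_le mult_nonneg_nonneg) linarith+
      also have "\<dots> = \<epsilon>"
      proof -
        have gen: "(1 - r) / 2 * e * (2 / (1 - r)) = e" if "0 < (1 - r) / 2" for r e :: real
          using that by simp
        from gen[OF \<kappa>0_bounds(1)] show ?thesis .
      qed
      finally show False using E by simp
    qed
    have "measure P ?E \<le> measure P (?Z \<union> (\<Union>t\<le>T. ?D t))"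
      using Dm zero_weights_events by (intro finite_measure_mono sub sets.Un sets.finite_UN) auto
    also have "\<dots> \<le> measure P ?Z + measure P (\<Union>t\<le>T. ?D t)"
      using Dm zero_weights_events by (intro measure_Un_le sets.finite_UN) auto
    also have "measure P (\<Union>t\<le>T. ?D t) \<le> (\<Sum>t\<le>T. measure P (?D t))"
      using Dm by (intro finite_measure_subadditive_finite) auto
    also have "\<dots> \<le> (\<Sum>t\<le>T. 3 * exp (- X * (1 / rr\<^sup>2) ^ lag t))"
    proof (rule sum_mono)
      fix t assume "t \<in> {..T}"
      then have "measure P (?D t) \<le> 3 * exp (- real N * c1\<^sup>2 * (\<delta> t)\<^sup>2 / (8 * w1\<^sup>2 * (rr ^ (2 * lag t) * d)\<^sup>2))"
        using dev \<delta>_pos by simp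
      \<comment> \<open>The squared allotment contributes the power \<open>2 * lag t\<close> of
        \<open>rr\<close>, the squared oscillation the power \<open>4 * lag t\<close> in the
        denominator; hence the exponent grows like \<open>(1 / rr\<^sup>2) ^ lag t\<close>.\<close>
      also have "- real N * c1\<^sup>2 * (\<delta> t)\<^sup>2 / (8 * w1\<^sup>2 * (rr ^ (2 * lag t) * d)\<^sup>2) = - X * (1 / rr\<^sup>2) ^ lag t"
      proof -
        have gen: "- n * C\<^sup>2 * (k * r * e)\<^sup>2 / (8 * w\<^sup>2 * (r\<^sup>2 * d)\<^sup>2) =
            - (C\<^sup>2 * k\<^sup>2 / (8 * w\<^sup>2) * n * e\<^sup>2 / d\<^sup>2) * (1 / r\<^sup>2)"
          if "r \<noteq> 0" for n C k r e w :: real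
          using that by (simp add: power2_eq_square field_simps)
        have "rr ^ lag t \<noteq> 0" by (rule less_imp_neq[OF zero_less_power[OF rr_bounds(1)], symmetric])
        from gen[OF this, of "real N" c1 \<kappa>0 \<epsilon> w1] show ?thesis
          unfolding X_def \<delta>_def by (simp only: power_one_over power_mult[symmetric] mult.commute[of 2])
      qed
      finally show "measure P (?D t) \<le> 3 * exp (- X * (1 / rr\<^sup>2) ^ lag t)" .
    qed
    also have "\<dots> = 3 * (\<Sum>t\<le>T. exp (- X * (1 / rr\<^sup>2) ^ lag t))" by (rule sum_distrib_left[symmetric])
    also have "\<dots> \<le> 3 * (exp (- X) * (2 / (1 - exp (1 - 1 / rr\<^sup>2))))"
      unfolding lag_def by (intro mult_left_mono sum_exp_lag_le rr_bounds(1,2) 3(2)) simp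
    also have "measure P ?Z \<le> exp (- X)"
      unfolding X_def by (rule zero_weights_bound[OF \<epsilon> 3(1)])
    finally have "measure P ?E \<le> exp (- X) + 3 * (exp (- X) * (2 / (1 - exp (1 - 1 / rr\<^sup>2))))"
      by simp
    also have "\<dots> = (1 + 6 / (1 - exp (1 - 1 / rr\<^sup>2))) * exp (- X)"
      by (simp add: distrib_right)
    also have "\<dots> \<le> B0 * exp (- X)" using B0_bounds(3) by (intro mult_right_mono) auto
    finally show ?thesis .
  qed
  then show ?thesis unfolding X_def .
qed

end

subsection \<open>Sums over backward index paths\<close>

text \<open>The counterpart of \<open>backward\<close> on indices: \<open>p t i k\<close> is the
  probability of stepping back from \<open>i\<close> at time \<open>t + 1\<close> to
  \<open>k\<close> at time \<open>t\<close>.\<close>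

primrec path_mean :: "(nat \<Rightarrow> 'i \<Rightarrow> 'i \<Rightarrow> real) \<Rightarrow> 'i set \<Rightarrow> nat \<Rightarrow> nat \<Rightarrow> ('i \<Rightarrow> real) \<Rightarrow> 'i \<Rightarrow> real" where
  "path_mean p A s 0 h i = h i"
| "path_mean p A s (Suc n) h i = (\<Sum>k\<in>A. p (s + n) i k * path_mean p A s n h k)"

lemma sum_PiE_insert:
  assumes "finite S" "finite A" "x \<notin> S"
  shows "(\<Sum>j\<in>PiE (insert x S) (\<lambda>_. A). f j) = (\<Sum>i\<in>A. \<Sum>j\<in>PiE S (\<lambda>_. A). f (j(x := i)))"
proof -
  have "(\<Sum>j\<in>PiE (insert x S) (\<lambda>_. A). f j) = (\<Sum>(i, j)\<in>A \<times> PiE S (\<lambda>_. A). f (j(x := i)))"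
  proof -
    have "inj_on (\<lambda>(y, g). g(x := y)) (A \<times> PiE S (\<lambda>_. A))"
      by (rule inj_combinator[OF assms(3), where T = "\<lambda>_. A"])
    then show ?thesis
      unfolding PiE_insert_eq by (subst sum.reindex) (simp_all add: split_beta')
  qed
  then show ?thesis by (simp add: sum.cartesian_product)
qed

text \<open>The last coordinate is summed out, and the transition from it becomes the terminal
  weight \<open>w\<close> for the shorter path, so \<open>w\<close> must be arbitrary in the
  induction. Coordinates below \<open>s\<close> sum to 1 by \<open>p\<close>.\<close>

lemma path_sum:
  assumes A: "finite A" and p: "\<And>t i. i \<in> A \<Longrightarrow> (\<Sum>k\<in>A. p t i k) = 1"
  shows "s \<le> T \<Longrightarrow> (\<Sum>j\<in>PiE {..T} (\<lambda>_. A). w (j T) * (\<Prod>t<T. p t (j (Suc t)) (j t)) * h (j s)) =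
    (\<Sum>i\<in>A. w i * path_mean p A s (T - s) h i)"
proof (induction T arbitrary: w s h)
  case 0
  have "{..0} = insert 0 ({} :: nat set)" by auto
  then show ?case using 0 A by (simp add: sum_PiE_insert del: insert_iff)
next
  case (Suc T)
  have split: "(\<Sum>j\<in>PiE {..Suc T} (\<lambda>_. A). w (j (Suc T)) * (\<Prod>t<Suc T. p t (j (Suc t)) (j t)) * h (j s)) =
      (\<Sum>i\<in>A. w i * (\<Sum>j\<in>PiE {..T} (\<lambda>_. A).
        p T i (j T) * (\<Prod>t<T. p t (j (Suc t)) (j t)) * h ((j(Suc T := i)) s)))"
    unfolding atMost_Suc using A
    by (subst sum_PiE_insert) (simp_all add: sum_distrib_left mult_ac)
  show ?case
  proof (cases "s \<le> T")
    case True
    then have "(\<Sum>j\<in>PiE {..T} (\<lambda>_. A). p T i (j T) * (\<Prod>t<T. p t (j (Suc t)) (j t)) * h ((j(Suc T := i)) s)) =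
        path_mean p A s (Suc T - s) h i" for i
      using Suc.IH[OF True, of "p T i" h] by (simp add: Suc_diff_le)
    then show ?thesis unfolding split by simp
  next
    case False
    then have s: "s = Suc T" using Suc.prems by simp
    \<comment> \<open>Here \<open>h\<close> looks only at the coordinate already fixed to
      \<open>i\<close>, so the remaining sum is the total mass of the shorter paths: the induction
      hypothesis for a constant function.\<close>
    have "(\<Sum>j\<in>PiE {..T} (\<lambda>_. A). p T i (j T) * (\<Prod>t<T. p t (j (Suc t)) (j t)) * h ((j(Suc T := i)) s)) = h i"
      if "i \<in> A" for i
      using Suc.IH[OF order_refl, of "p T i" "\<lambda>_. h i"] p[OF that]
      by (simp add: s sum_distrib_right[symmetric])
    then show ?thesis unfolding split by (simp add: s)
  qed
qed

section \<open>The FFBSi estimator\<close>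

context mixing_filter
begin

abbreviation "index_paths (T :: nat) \<equiv> PiE {..T} (\<lambda>_. {1..N})"
abbreviation "back_prob \<omega> t i k \<equiv> nweight N (\<lambda>k. pw t k \<omega> * mdens S (\<xi> t k \<omega>) (\<xi> (Suc t) i \<omega>)) k"

definition path_dens :: "nat \<Rightarrow> 'w \<Rightarrow> (nat \<Rightarrow> nat) \<Rightarrow> real" where
  "path_dens T \<omega> j = nwt T (j T) \<omega> * (\<Prod>t<T. back_prob \<omega> t (j (Suc t)) (j t))"

abbreviation "Kpath T \<omega> \<equiv> density (count_space (index_paths T)) (\<lambda>j. ennreal (path_dens T \<omega> j))"

lemma finite_index_paths: "finite (index_paths T)"
  by (intro finite_PiE) auto

lemma index_path_law_eq: "index_path_law S N \<xi> I T \<omega> = Kpath T \<omega>"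
  by (simp add: index_path_law_def point_measure_def path_dens_def Suc_eq_plus1)

lemma back_prob_nonneg: "k \<in> {1..N} \<Longrightarrow> 0 \<le> back_prob \<omega> t i k"
  by (rule nweight_nonneg) (simp_all add: pw_nonneg mdens_nonneg)

lemma path_dens_nonneg: "j \<in> index_paths T \<Longrightarrow> 0 \<le> path_dens T \<omega> j"
  unfolding path_dens_def by (intro mult_nonneg_nonneg prod_nonneg nwt_nonneg back_prob_nonneg ballI) (auto simp: PiE_iff)

lemma path_dens_integral:
  fixes f :: "(nat \<Rightarrow> nat) \<Rightarrow> real"
  shows "(\<integral>j. f j \<partial>Kpath T \<omega>) = (\<Sum>j\<in>index_paths T. path_dens T \<omega> j * f j)"
  using path_dens_nonneg finite_index_paths
  by (subst integral_density) (auto simp: lebesgue_integral_count_space_finite intro!: AE_I2)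

lemma path_dens_sum:
  assumes "s \<le> T"
  shows "(\<Sum>j\<in>index_paths T. path_dens T \<omega> j * f (j s)) = (\<Sum>i=1..N. nwt T i \<omega> * path_mean (back_prob \<omega>) {1..N} s (T - s) f i)"
  unfolding path_dens_def using assms sum_nweight[OF N1] by (intro path_sum) auto

lemma prob_Kpath: "prob_space (Kpath T \<omega>)"
proof
  \<comment> \<open>Total mass one is the path formula for the constant function 1 at time
    \<open>T\<close>, where no backward step is left.\<close>
  have "(\<Sum>j\<in>index_paths T. path_dens T \<omega> j) = (\<Sum>i=1..N. nwt T i \<omega> * path_mean (back_prob \<omega>) {1..N} T (T - T) (\<lambda>_. 1) i)"
    using path_dens_sum[of T T \<omega> "\<lambda>_. 1"] by simp
  also have "\<dots> = 1" using sum_nweight[OF N1] by simp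
  finally have 1: "(\<Sum>j\<in>index_paths T. path_dens T \<omega> j) = 1" .
  have "emeasure (Kpath T \<omega>) (index_paths T) =
      (\<Sum>j\<in>index_paths T. ennreal (path_dens T \<omega> j))"
    using finite_index_paths by (subst emeasure_density) (simp_all add: nn_integral_count_space_finite)
  also have "\<dots> = ennreal (\<Sum>j\<in>index_paths T. path_dens T \<omega> j)"
    using path_dens_nonneg by (intro sum_ennreal) auto
  finally show "emeasure (Kpath T \<omega>)
      (space (Kpath T \<omega>)) = 1"
    using 1 by simp
qed

lemma measurable_path_section:
  fixes f :: "(nat \<Rightarrow> nat) \<Rightarrow> 'w \<Rightarrow> real"
  assumes "\<And>j. j \<in> index_paths T \<Longrightarrow> f j \<in> borel_measurable M"
  shows "(\<lambda>(\<omega>, j). f j \<omega>) \<in> borel_measurable (M \<Otimes>\<^sub>M count_space (index_paths T))"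
proof -
  have 1: "(\<lambda>q. f j (fst q)) \<in> borel_measurable (M \<Otimes>\<^sub>M count_space (index_paths T))" if "j \<in> index_paths T" for j
    by (rule measurable_compose[OF measurable_fst assms[OF that]])
  have 2: "snd \<in> measurable (M \<Otimes>\<^sub>M count_space (index_paths T)) (count_space (index_paths T))"
    by (rule measurable_snd)
  from measurable_compose_countable'[where f = "\<lambda>j q. f j (fst q)", OF 1 2 countable_finite[OF finite_index_paths]]
  show ?thesis by (simp add: split_beta')
qed

lemma path_dens_measurable: "(\<lambda>(\<omega>, j). path_dens T \<omega> j) \<in> borel_measurable (F T \<Otimes>\<^sub>M count_space (index_paths T))"
proof (rule measurable_path_section)
  fix j assume j: "j \<in> index_paths T"
  then have jr: "j t \<in> {1..N}" if "t \<le> T" for t using that by (auto simp: PiE_iff)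
  have "(\<lambda>\<omega>. back_prob \<omega> t (j (Suc t)) (j t)) \<in> borel_measurable (F T)" if t: "t < T" for t
  proof (rule nweight_measurable)
    fix k assume k: "k \<in> {1..N}"
    note [measurable] = history_measurable(1)[OF less_imp_le[OF t] k] history_measurable(2)[OF less_imp_le[OF t] k]
      history_measurable(1)[OF Suc_leI[OF t] jr[OF Suc_leI[OF t]]]
    show "(\<lambda>\<omega>. pw t k \<omega> * mdens S (\<xi> t k \<omega>) (\<xi> (Suc t) (j (Suc t)) \<omega>)) \<in> borel_measurable (F T)"
      by measurable
  qed (use jr t in simp)
  moreover have "(\<lambda>\<omega>. nwt T (j T) \<omega>) \<in> borel_measurable (F T)"
    using history_measurable(2)[OF order_refl] jr by (intro nweight_measurable) auto
  ultimately show "(\<lambda>\<omega>. path_dens T \<omega> j) \<in> borel_measurable (F T)"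
    unfolding path_dens_def by (intro borel_measurable_times borel_measurable_prod) auto
qed

lemma backward_cond_iid:
  assumes "backward_sampler S N P \<xi> I T J"
  shows "cond_iid_density P (F T) (count_space (index_paths T)) (path_dens T) {1..N} (\<lambda>l \<omega>. \<lambda>t\<in>{..T}. J t l \<omega>)"
proof (intro cond_iid_density.intro cond_iid_density_axioms.intro)
  have ci: "cond_iid P (F T) {1..N} (count_space (index_paths T)) (\<lambda>l \<omega>. \<lambda>t\<in>{..T}. J t l \<omega>) (index_path_law S N \<xi> I T)"
    using assms by (simp add: backward_sampler_def)
  show "sigma_finite_measure (count_space (index_paths T))"
    by (rule sigma_finite_measure_count_space_finite[OF finite_index_paths])
  show "(\<lambda>\<omega>. \<lambda>t\<in>{..T}. J t l \<omega>) \<in> measurable P (count_space (index_paths T))" if "l \<in> {1..N}" for l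
    using ci that unfolding cond_iid_def by blast
  show "emeasure P {\<omega> \<in> G. \<forall>l\<in>{1..N}. (\<lambda>t\<in>{..T}. J t l \<omega>) \<in> D l} =
      (\<integral>\<^sup>+\<omega>. indicator G \<omega> * (\<Prod>l=1..N. emeasure (Kpath T \<omega>) (D l)) \<partial>P)"
    if "G \<in> sets (F T)" "\<And>l. l \<in> {1..N} \<Longrightarrow> D l \<in> sets (count_space (index_paths T))" for G D
    unfolding index_path_law_eq[symmetric]
    by (rule cond_iid_emeasure[OF prob_space_axioms sub_history _ ci _ that])
      (simp_all add: index_path_law_eq prob_Kpath)
qed (use prob_space_axioms sub_history path_dens_measurable prob_Kpath path_dens_nonneg in auto)

text \<open>The index chain normalises products of raw weights and transition densities, the
  backward kernel starts from normalised weights. They agree when the total weight is positive,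
  since the normalising constant then cancels.\<close>

lemma path_mean_eq_bk:
  assumes h: "h \<in> borel_measurable borel" and pos: "\<And>t. 0 < (\<Sum>i=1..N. pw t i \<omega>)"
  shows "path_mean (back_prob \<omega>) {1..N} s n (\<lambda>k. h (\<xi> s k \<omega>)) i = bk s n h \<omega> (\<xi> (s + n) i \<omega>)"
proof (induction n arbitrary: i)
  case (Suc n)
  let ?m = "\<lambda>k. mdens S (\<xi> (s + n) k \<omega>) (\<xi> (Suc (s + n)) i \<omega>)"
  have "0 < \<sigma>m * (\<Sum>k=1..N. pw (s + n) k \<omega>)" using \<sigma>m pos by simp
  also have "\<dots> = (\<Sum>k=1..N. pw (s + n) k \<omega> * \<sigma>m)" by (simp add: sum_distrib_left mult.commute)
  also have "\<dots> \<le> (\<Sum>k=1..N. pw (s + n) k \<omega> * ?m k)"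
    using pw_nonneg mdens_bounds by (intro sum_mono mult_left_mono) auto
  finally have mpos: "0 < (\<Sum>k=1..N. pw (s + n) k \<omega> * ?m k)" .
  have "path_mean (back_prob \<omega>) {1..N} s (Suc n) (\<lambda>k. h (\<xi> s k \<omega>)) i =
      (\<Sum>k=1..N. pw (s + n) k \<omega> * (?m k * bk s n h \<omega> (\<xi> (s + n) k \<omega>))) / (\<Sum>k=1..N. pw (s + n) k \<omega> * ?m k)"
  proof -
    have "path_mean (back_prob \<omega>) {1..N} s (Suc n) (\<lambda>k. h (\<xi> s k \<omega>)) i =
        (\<Sum>k=1..N. back_prob \<omega> (s + n) i k * bk s n h \<omega> (\<xi> (s + n) k \<omega>))"
      by (simp only: path_mean.simps Suc)
    then show ?thesis
      using mpos by (simp add: nweight_def sum_divide_distrib mult.assoc)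
  qed
  also have "\<dots> = bk s (Suc n) h \<omega> (\<xi> (Suc (s + n)) i \<omega>)"
    unfolding bk_Suc[OF h] using pos[of "s + n"] by (subst ratio_nweight) auto
  finally show ?case by simp
qed simp

lemma path_dens_mean:
  assumes h: "h \<in> borel_measurable borel" and sT: "s \<le> T" and pos: "\<And>t. 0 < (\<Sum>i=1..N. pw t i \<omega>)"
  shows "(\<integral>j. h (\<xi> s (j s) \<omega>) \<partial>Kpath T \<omega>) = ffbs S N \<xi> I s T h \<omega>"
proof -
  have "(\<integral>j. h (\<xi> s (j s) \<omega>) \<partial>Kpath T \<omega>) =
      (\<Sum>i=1..N. nwt T i \<omega> * bk s (T - s) h \<omega> (\<xi> T i \<omega>))"
    using path_dens_sum[OF sT, of \<omega> "\<lambda>k. h (\<xi> s k \<omega>)"] sT by (simp add: path_dens_integral path_mean_eq_bk[OF h pos])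
  also have "\<dots> = ffbs S N \<xi> I s T h \<omega>"
    unfolding ffbs_def using h by (simp add: integral_filter)
  finally show ?thesis .
qed

text \<open>Given all particles and weights up to \<open>T\<close>, the index paths are i.i.d. and
  their mean value of \<open>h\<close> is the FFBS estimator, except where the initial weights
  vanish. Half of \<epsilon> goes to resampling the paths and half to FFBS itself.\<close>

lemma ffbsi_deviation:
  assumes J: "backward_sampler S N P \<xi> I T J"
    and h: "h \<in> borel_measurable borel" and ho: "osc_le h d" and d: "0 < d" and sT: "s \<le> T" and \<epsilon>: "0 < \<epsilon>"
  shows "\<P>(\<omega> in P. \<epsilon> \<le> \<bar>ffbsi N \<xi> J s h \<omega> - marg_smooth S s T h\<bar>) \<le>
    B1 * exp (- (C1 * real N * \<epsilon>\<^sup>2 / d\<^sup>2))" (is "measure P ?E \<le> _")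
proof -
  interpret D: cond_iid_density P "F T" "count_space (index_paths T)" "path_dens T" "{1..N}" "\<lambda>l \<omega>. \<lambda>t\<in>{..T}. J t l \<omega>"
    by (rule backward_cond_iid[OF J])
  obtain lo where lo: "\<And>x. lo \<le> h x \<and> h x \<le> lo + d" using ho by (auto simp: osc_le_def)
  have N0: "0 < real N" using N1 by simp
  \<comment> \<open>Centring at the conditional mean, not at the FFBS estimator, lets Hoeffding's
    bound hold without exception; the two are identified afterwards, off \<open>?Z\<close>.\<close>
  define mu where "mu = (\<lambda>\<omega>. \<integral>j. h (\<xi> s (j s) \<omega>) \<partial>D.K \<omega>)"
  define \<phi> where "\<phi> = (\<lambda>\<omega> (j :: nat \<Rightarrow> nat). h (\<xi> s (j s) \<omega>) - mu \<omega>)"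
  have hm: "(\<lambda>(\<omega>, j). h (\<xi> s (j s) \<omega>)) \<in> borel_measurable (F T \<Otimes>\<^sub>M count_space (index_paths T))"
  proof (rule measurable_path_section)
    fix j assume "j \<in> index_paths T"
    then have "j s \<in> {1..N}" using sT by (auto simp: PiE_iff)
    from measurable_compose[OF history_measurable(1)[OF sT this] h]
    show "(\<lambda>\<omega>. h (\<xi> s (j s) \<omega>)) \<in> borel_measurable (F T)" .
  qed
  have mum [measurable]: "mu \<in> borel_measurable (F T)"
    unfolding mu_def by (rule D.integral_K_measurable[OF hm])
  have \<phi>m: "(\<lambda>(\<omega>, j). \<phi> \<omega> j) \<in> borel_measurable (F T \<Otimes>\<^sub>M count_space (index_paths T))"
  proof -
    have "(\<lambda>p. mu (fst p)) \<in> borel_measurable (F T \<Otimes>\<^sub>M count_space (index_paths T))"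
      by (rule measurable_compose[OF measurable_fst mum])
    from borel_measurable_diff[OF hm this] show ?thesis by (simp add: \<phi>_def split_beta')
  qed
  have sum_\<phi>: "(\<Sum>l\<in>{1..N}. \<phi> \<omega> (\<lambda>t\<in>{..T}. J t l \<omega>)) = real N * (ffbsi N \<xi> J s h \<omega> - mu \<omega>)" for \<omega>
    using sT N0 by (simp add: \<phi>_def sum_subtractf ffbsi_def right_diff_distrib)
  have hoeff: "\<P>(\<omega> in P. \<epsilon> / 2 * real (card {1..N}) \<le> \<bar>\<Sum>l\<in>{1..N}. \<phi> \<omega> (\<lambda>t\<in>{..T}. J t l \<omega>)\<bar>)
      \<le> 2 * exp (- 2 * real (card {1..N}) * (\<epsilon> / 2)\<^sup>2 / d\<^sup>2)"
  proof (rule D.cond_Hoeffding_abs_ge[OF \<phi>m, where lo = "\<lambda>\<omega>. lo - mu \<omega>"])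
    show "lo - mu \<omega> \<le> \<phi> \<omega> j \<and> \<phi> \<omega> j \<le> lo - mu \<omega> + d" for \<omega> j
      using lo[of "\<xi> s (j s) \<omega>"] by (simp add: \<phi>_def)
    show "(\<integral>j. \<phi> \<omega> j \<partial>D.K \<omega>) = 0" if w: "\<omega> \<in> space P" for \<omega>
    proof -
      interpret Kp: prob_space "D.K \<omega>" by (rule prob_Kpath)
      show ?thesis
        unfolding \<phi>_def using D.integrable_K_bounded[OF hm w, of lo "lo + d"] lo Kp.prob_space
        by (subst Bochner_Integration.integral_diff) (simp_all add: mu_def)
    qed
  qed (use d \<epsilon> N1 in simp_all)
  show ?thesis
  proof (cases "\<epsilon> \<le> d")
    case False
    have "lo \<le> ffbsi N \<xi> J s h \<omega> \<and> ffbsi N \<xi> J s h \<omega> \<le> lo + d" for \<omega>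
    proof -
      have "(\<Sum>l=1..N. lo) \<le> (\<Sum>l=1..N. h (\<xi> s (J s l \<omega>) \<omega>))" "(\<Sum>l=1..N. h (\<xi> s (J s l \<omega>) \<omega>)) \<le> (\<Sum>l=1..N. lo + d)"
        using lo by (intro sum_mono; simp)+
      then show ?thesis using N0 by (simp add: ffbsi_def pos_le_divide_eq pos_divide_le_eq mult.commute)
    qed
    then have "\<bar>ffbsi N \<xi> J s h \<omega> - marg_smooth S s T h\<bar> \<le> d" for \<omega>
      using marg_smooth_bounds[OF h lo sT] by (smt (verit))
    then have "?E = {}" using False by (auto simp: not_le intro: le_less_trans)
    moreover have "0 \<le> B1 * exp (- (C1 * real N * \<epsilon>\<^sup>2 / d\<^sup>2))"
      by (rule mult_nonneg_nonneg[OF _ exp_ge_zero]) (use B0_bounds(1) in linarith)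
    ultimately show ?thesis by (simp only: measure_empty)
  next
    case True
    define Y where "Y = real N * \<epsilon>\<^sup>2 / d\<^sup>2"
    have Y: "0 \<le> Y" by (simp add: Y_def)
    let ?Z = "{\<omega> \<in> space P. (\<Sum>i=1..N. pw 0 i \<omega>) \<le> 0}"
    let ?A = "{\<omega> \<in> space P. \<epsilon> / 2 \<le> \<bar>ffbs S N \<xi> I s T h \<omega> - marg_smooth S s T h\<bar>}"
    let ?H = "{\<omega> \<in> space P. \<epsilon> / 2 * real (card {1..N}) \<le> \<bar>\<Sum>l\<in>{1..N}. \<phi> \<omega> (\<lambda>t\<in>{..T}. J t l \<omega>)\<bar>}"
    have A: "?A \<in> events"
    proof -
      note [measurable] = interp_measurable[OF h, of s T T]
      show ?thesis unfolding ffbs_eq[OF h sT] by measurable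
    qed
    have H: "?H \<in> events"
    proof -
      have [measurable]: "(\<lambda>\<omega>. \<Sum>l\<in>{1..N}. \<phi> \<omega> (\<lambda>t\<in>{..T}. J t l \<omega>)) \<in> borel_measurable P"
        by (intro borel_measurable_sum D.Z_pair_measurable[OF _ \<phi>m])
      show ?thesis by measurable
    qed
    have "?E \<subseteq> ?Z \<union> (?A \<union> ?H)"
    proof (rule subsetI, rule ccontr)
      fix \<omega> assume E: "\<omega> \<in> ?E" and n: "\<omega> \<notin> ?Z \<union> (?A \<union> ?H)"
      then have z: "0 < (\<Sum>i=1..N. pw 0 i \<omega>)"
        and a: "\<bar>ffbs S N \<xi> I s T h \<omega> - marg_smooth S s T h\<bar> < \<epsilon> / 2"
        and b: "\<bar>\<Sum>l\<in>{1..N}. \<phi> \<omega> (\<lambda>t\<in>{..T}. J t l \<omega>)\<bar> < \<epsilon> / 2 * real N" by auto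
      have pos: "0 < (\<Sum>i=1..N. pw t i \<omega>)" for t
        using z pw_sum_pos[of _ \<omega>] by (cases t) auto
      have "mu \<omega> = ffbs S N \<xi> I s T h \<omega>"
        unfolding mu_def by (rule path_dens_mean[OF h sT pos])
      moreover have "real N * \<bar>ffbsi N \<xi> J s h \<omega> - mu \<omega>\<bar> < real N * (\<epsilon> / 2)"
        using b by (simp add: sum_\<phi> abs_mult mult.commute)
      then have "\<bar>ffbsi N \<xi> J s h \<omega> - mu \<omega>\<bar> < \<epsilon> / 2" using N0 by (simp only: mult_less_cancel_left_pos)
      ultimately have "\<bar>ffbsi N \<xi> J s h \<omega> - ffbs S N \<xi> I s T h \<omega>\<bar> < \<epsilon> / 2" by simp
      moreover have "\<epsilon> \<le> \<bar>ffbsi N \<xi> J s h \<omega> - marg_smooth S s T h\<bar>" using E by simp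
      ultimately show False using a by linarith
    qed
    then have "measure P ?E \<le> measure P (?Z \<union> (?A \<union> ?H))"
      using zero_weights_events A H by (intro finite_measure_mono) auto
    also have "\<dots> \<le> measure P ?Z + (measure P ?A + measure P ?H)"
      using zero_weights_events A H
      by (intro order_trans[OF measure_Un_le] add_left_mono measure_Un_le) auto
    also have "measure P ?Z \<le> exp (- (C1 * Y))"
    proof -
      have "measure P ?Z \<le> exp (- (C0 * Y))"
        using zero_weights_bound[OF \<epsilon> True] by (simp only: Y_def times_divide_eq_right mult.assoc)
      moreover have "C1 * Y \<le> C0 * Y" by (rule mult_right_mono[OF C1_bounds(2) Y])
      then have "exp (- (C0 * Y)) \<le> exp (- (C1 * Y))" by (simp only: exp_le_cancel_iff neg_le_iff_le)
      ultimately show ?thesis by (rule order_trans)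
    qed
    also have "measure P ?A \<le> B0 * exp (- (C1 * Y))"
    proof -
      have "C0 * real N * (\<epsilon> / 2)\<^sup>2 / d\<^sup>2 = (C0 / 4) * Y"
        by (simp only: Y_def power_divide) (simp add: mult_ac)
      then have "measure P ?A \<le> B0 * exp (- ((C0 / 4) * Y))"
        using ffbs_deviation[OF h ho d sT, of "\<epsilon> / 2"] \<epsilon> by (simp only: half_gt_zero)
      also have "C1 * Y \<le> (C0 / 4) * Y" by (rule mult_right_mono[OF C1_bounds(3) Y])
      then have "exp (- ((C0 / 4) * Y)) \<le> exp (- (C1 * Y))" by (simp only: exp_le_cancel_iff neg_le_iff_le)
      then have "B0 * exp (- ((C0 / 4) * Y)) \<le> B0 * exp (- (C1 * Y))"
        by (rule mult_left_mono) (use B0_bounds(1) in linarith)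
      finally show ?thesis .
    qed
    also have "measure P ?H \<le> 2 * exp (- (C1 * Y))"
    proof -
      have "- 2 * real (card {1..N}) * (\<epsilon> / 2)\<^sup>2 / d\<^sup>2 = - (1 / 2 * Y)"
        by (simp add: Y_def power_divide)
      with hoeff have "measure P ?H \<le> 2 * exp (- (1 / 2 * Y))" by (simp only:)
      also have "C1 * Y \<le> 1 / 2 * Y" by (rule mult_right_mono[OF C1_bounds(4) Y])
      then have "exp (- (1 / 2 * Y)) \<le> exp (- (C1 * Y))" by (simp only: exp_le_cancel_iff neg_le_iff_le)
      then have "2 * exp (- (1 / 2 * Y)) \<le> 2 * exp (- (C1 * Y))" by (rule mult_left_mono) simp
      finally show ?thesis .
    qed
    finally have "measure P ?E \<le> exp (- (C1 * Y)) + (B0 * exp (- (C1 * Y)) + 2 * exp (- (C1 * Y)))"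
      by simp
    also have "\<dots> = B1 * exp (- (C1 * Y))" by (simp add: distrib_right)
    finally show ?thesis by (simp only: Y_def times_divide_eq_right mult.assoc)
  qed
qed

end

section \<open>From the hypotheses to the constants\<close>

lemma sup_norm_bound:
  assumes "(SUP t\<in>A. sup_norm (f t)) < \<infinity>"
  shows "\<exists>b. \<forall>t\<in>A. \<forall>z. f t z \<le> b"
proof -
  let ?s = "SUP t\<in>A. sup_norm (f t)"
  have le: "ereal \<bar>f t z\<bar> \<le> ?s" if "t \<in> A" for t z
    using that unfolding sup_norm_def by (intro SUP_upper2[of t] SUP_upper2[of z]) auto
  show ?thesis
  proof (cases ?s)
    case (real r)
    then have "\<bar>f t z\<bar> \<le> r" if "t \<in> A" for t z using le[OF that, of z] by simp
    then show ?thesis by (intro exI[of _ r]) (auto simp: abs_le_iff)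
  next
    \<comment> \<open>A nonempty family has supremum at least the absolute value of some function
      value, so minus infinity means an empty index set.\<close>
    case MInf
    then have "A = {}" using le by (metis ex_in_conv ereal_infty_less_eq2(2) ereal.distinct(5) uminus_ereal.simps(2) MInfty_neq_ereal(2))
    then show ?thesis by simp
  qed (use assms in simp)
qed

theorem theorem11:
  fixes S :: "('x::polish_space, 'y::polish_space) smc"
  assumes model: "smc_model S"
    and A1: "\<forall>t x. 0 < gt S t x" "(SUP t. sup_norm (gt S t)) < \<infinity>"
    and A2: "(SUP t\<in>{1..}. sup_norm (theta S t)) < \<infinity>"
      "sup_norm (weight0 S) < \<infinity>"
      "(SUP t\<in>{1..}. sup_norm (\<lambda>(x, x'). weight S t x x')) < \<infinity>"
    and A3: "sup_norm (\<lambda>(x, x'). mdens S x x') < \<infinity>"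
      "(SUP t\<in>{1..}. sup_norm (\<lambda>(x, x'). pdens S t x x')) < \<infinity>"
    and A4: "\<exists>\<sigma>m \<sigma>p. 0 < \<sigma>m \<and> \<sigma>m \<le> \<sigma>p \<and> (\<forall>x x'. \<sigma>m \<le> mdens S x x' \<and> mdens S x x' \<le> \<sigma>p)"
      "\<exists>c>0. c \<le> (\<integral>x. gt S 0 x \<partial>chi S) \<and>
         (\<forall>t\<ge>1. c \<le> (INF x. \<integral>x'. gt S t x' \<partial>Mker S x))"
  shows "\<exists>B>0. \<exists>C>0. \<forall>N\<ge>1. \<forall>(P :: 'w measure) \<xi> I. particle_filter S N P \<xi> I \<longrightarrow>
    (\<forall>s T. \<forall>\<epsilon>>0. \<forall>h\<in>Fb. s \<le> T \<longrightarrow>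
       measure P {\<omega> \<in> space P. \<bar>ffbs S N \<xi> I s T h \<omega> - marg_smooth S s T h\<bar> \<ge> \<epsilon>}
         \<le> dev_bound B C N \<epsilon> h \<and>
       (\<forall>J. backward_sampler S N P \<xi> I T J \<longrightarrow>
          measure P {\<omega> \<in> space P. \<bar>ffbsi N \<xi> J s h \<omega> - marg_smooth S s T h\<bar> \<ge> \<epsilon>}
            \<le> dev_bound B C N \<epsilon> h))"
proof -
  obtain gmax where g_le: "\<And>t x. gt S t x \<le> gmax"
    using sup_norm_bound[OF A1(2)] by auto
  obtain th where th: "\<And>t x. 1 \<le> t \<Longrightarrow> theta S t x \<le> th"
    using sup_norm_bound[OF A2(1)] by auto
  obtain w0 where w0: "\<And>x. weight0 S x \<le> w0"
    using sup_norm_bound[of "\<lambda>_. weight0 S" "{()}"] A2(2) by auto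
  obtain w where w: "\<And>t x x'. 1 \<le> t \<Longrightarrow> weight S t x x' \<le> w"
    using sup_norm_bound[OF A2(3)] by auto
  obtain \<sigma>m \<sigma>p where \<sigma>: "0 < \<sigma>m" "\<And>x x'. \<sigma>m \<le> mdens S x x' \<and> mdens S x x' \<le> \<sigma>p"
    using A4(1) by auto
  obtain c where c: "0 < c" "c \<le> (\<integral>x. gt S 0 x \<partial>chi S)"
      "\<And>t. 1 \<le> t \<Longrightarrow> c \<le> (INF x. \<integral>x'. gt S t x' \<partial>Mker S x)"
    using A4(2) by auto
  have c': "c \<le> (\<integral>x'. gt S t x' \<partial>Mker S x)" if t: "1 \<le> t" for t x
  proof -
    \<comment> \<open>The infimum is taken in the reals, so it bounds its members only once a lower
      bound is known; positivity of the likelihood gives 0.\<close>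
    have "bdd_below (range (\<lambda>x. \<integral>x'. gt S t x' \<partial>Mker S x))"
      using A1(1) by (intro bdd_belowI[of _ 0]) (auto intro!: integral_nonneg simp: less_imp_le)
    then have "(INF x. \<integral>x'. gt S t x' \<partial>Mker S x) \<le> (\<integral>x'. gt S t x' \<partial>Mker S x)"
      by (intro cINF_lower) auto
    then show ?thesis using c(3)[OF t] by simp
  qed
  interpret M: mixing_smc S gmax "max 1 th" "max w0 w" \<sigma>m \<sigma>p c
    using model A1(1) g_le th w0 w \<sigma> c(1,2) c' by unfold_locales (auto simp: le_max_iff_disj)
  \<comment> \<open>Both constants come from the model alone, before \<open>N\<close>, the filter
    and \<open>h\<close> are fixed. The pair for FFBSi also serves FFBS, since \<open>B1\<close>
    exceeds \<open>B0\<close> and \<open>C1\<close> is at most \<open>C0\<close>.\<close>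
  define B where "B = M.B1"
  define C where "C = M.C1"
  have B: "0 < B" "M.B0 \<le> B" using M.B0_bounds(1) unfolding B_def by linarith+
  have C: "0 < C" "C \<le> M.C0" unfolding C_def by (fact M.C1_bounds)+
  have main: "measure P {\<omega> \<in> space P. \<bar>ffbs S N \<xi> I s T h \<omega> - marg_smooth S s T h\<bar> \<ge> \<epsilon>} \<le> dev_bound B C N \<epsilon> h \<and>
       (\<forall>J. backward_sampler S N P \<xi> I T J \<longrightarrow>
          measure P {\<omega> \<in> space P. \<bar>ffbsi N \<xi> J s h \<omega> - marg_smooth S s T h\<bar> \<ge> \<epsilon>}
            \<le> dev_bound B C N \<epsilon> h)"
    if N: "1 \<le> N" and pf: "particle_filter S N P \<xi> I" and \<epsilon>: "0 < \<epsilon>" and h: "h \<in> Fb" and sT: "s \<le> T"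
    for N and P :: "'w measure" and \<xi> I s T \<epsilon> h
  proof -
    interpret mixing_filter S gmax "max 1 th" "max w0 w" \<sigma>m \<sigma>p c N P \<xi> I
      using N pf by unfold_locales
    note hm = Fb_osc(1)[OF h] and ho = Fb_osc(3)[OF h]
    show ?thesis
    proof (cases "osc h = 0")
      \<comment> \<open>The bound is 0 here, so probabilities must vanish: \<open>h\<close> is
        constant, and both estimators and the target equal its value.\<close>
      case True
      obtain lo where lo: "\<And>x. lo \<le> h x \<and> h x \<le> lo + 0"
        using ho True by (auto simp: osc_le_def)
      have m: "marg_smooth S s T h = lo"
        using marg_smooth_bounds[OF hm lo sT] by simp
      have "h x = lo" for x using lo[of x] by simp
      then have "ffbsi N \<xi> J s h \<omega> = lo" for J \<omega>
        using N by (simp add: ffbsi_def)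
      moreover have "ffbs S N \<xi> I s T h \<omega> = lo" for \<omega>
        using ffbs_bounds[OF hm lo sT, of \<omega>] by simp
      ultimately show ?thesis using True \<epsilon> by (simp add: m dev_bound_def)
    next
      case False
      then have o: "0 < osc h" using Fb_osc(2)[OF h] by simp
      have bound: "B * exp (- (C * real N * \<epsilon>\<^sup>2 / (osc h)\<^sup>2)) = dev_bound B C N \<epsilon> h"
        using False by (simp add: dev_bound_def)
      have "B * exp (- (C * real N * \<epsilon>\<^sup>2 / (osc h)\<^sup>2)) \<ge> M.B0 * exp (- (M.C0 * real N * \<epsilon>\<^sup>2 / (osc h)\<^sup>2))"
      proof (intro mult_mono)
        have "C * real N * \<epsilon>\<^sup>2 / (osc h)\<^sup>2 \<le> M.C0 * real N * \<epsilon>\<^sup>2 / (osc h)\<^sup>2"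
          by (intro divide_right_mono mult_right_mono C(2)) auto
        then show "exp (- (M.C0 * real N * \<epsilon>\<^sup>2 / (osc h)\<^sup>2)) \<le> exp (- (C * real N * \<epsilon>\<^sup>2 / (osc h)\<^sup>2))"
          by (simp only: exp_le_cancel_iff neg_le_iff_le)
        show "M.B0 \<le> B" by (rule B(2))
        show "0 \<le> B" using B(1) by simp
      qed (rule exp_ge_zero)
      from order_trans[OF ffbs_deviation[OF hm ho o sT \<epsilon>] this]
      have "measure P {\<omega> \<in> space P. \<bar>ffbs S N \<xi> I s T h \<omega> - marg_smooth S s T h\<bar> \<ge> \<epsilon>} \<le> dev_bound B C N \<epsilon> h"
        by (simp only: bound)
      moreover have "measure P {\<omega> \<in> space P. \<bar>ffbsi N \<xi> J s h \<omega> - marg_smooth S s T h\<bar> \<ge> \<epsilon>} \<le> dev_bound B C N \<epsilon> h"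
        if "backward_sampler S N P \<xi> I T J" for J
        using ffbsi_deviation[OF that hm ho o sT \<epsilon>, folded B_def C_def] by (simp only: bound)
      ultimately show ?thesis by blast
    qed
  qed
  show ?thesis
    by (rule exI[of _ B], rule conjI[OF B(1)], rule exI[of _ C], rule conjI[OF C(1)]) (use main in blast)
qed

end
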